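(* Let $k$ be a field and let $R$ be a right noetherian $k$-algebra with $\operatorname{GKdim}_k R < \infty$. Let $\mathcal{F}$ be an extensive class of field extensions. Fix a field extension $k \subseteq K$ in the class $\mathcal{F}$, and call a field $L$ small if $k \subseteq L \subseteq K$, with $k \subseteq L$ and $L \subseteq K$ in the class $\mathcal{F}$, and with $k \subseteq L$ a finitely generated field extension. For a field extension $k \subseteq L$ write $R_L = R \otimes_k L$. Suppose that (i) for all small fields $L$, the GK dimension (over $L$) of finitely generated right $R_L$-modules is exact, finitely partitive, and integer valued; and (ii) given any small field $L$ and any finitely generated right $R_L$-module $M$, there is an upper bound $n = n(M)$ on the lengths of the $\operatorname{GKdim}_{L'}$-critical composition series for the $R_{L'}$-modules $M_{L'} = M \otimes_L L'$, as $L'$ varies over all small fields with $L \subseteq L'$ in the class $\mathcal{F}$. Then $R \otimes_k K$ is right noetherian. In particular, if conditions (i) and (ii) hold for all extensions $k \subseteq K$ in the class $\mathcal{F}$, then $R$ is $\mathcal{F}$-stably right noetherian over $k$.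
   Context: Algebras are unital, associative, not necessarily commutative. GK dimension: for a $k$-algebra $R$, $\operatorname{GKdim}_k(R) = \sup_V \limsup_{n\to\infty} \log_n(\dim_k V^n)$, $V$ ranging over finite-dimensional $k$-subspaces of $R$. For a right $R$-module $M$, $\operatorname{GKdim}_k(M) = \sup_{W,V} \limsup_{n \to \infty} \log_n(\dim_k W V^n)$, $W$, $V$ ranging over finite-dimensional $k$-subspaces of $M$, $R$ respectively; $\operatorname{GKdim}_k(0) = -1$ by convention. GK dimension of finitely generated right $R$-modules is exact if for every short exact sequence $0 \to M \to N \to P \to 0$ of such modules $\operatorname{GKdim}(N) = \max(\operatorname{GKdim}(M), \operatorname{GKdim}(P))$; finitely partitive if for every finitely generated right module $N$ with $\operatorname{GKdim}(N)=d$ there is an upper bound (depending on $N$) on the lengths $n$ of chains $N = N_0 \supsetneq N_1 \supsetneq \dots \supsetneq N_n$ with $\operatorname{GKdim}(N_i/N_{i+1}) = d$ for all $0 \le i \le n-1$. A nonzero right module $M$ is $d$-critical if $\operatorname{GKdim}(M) = d<\infty$ and $\operatorname{GKdim}(M/N) < d$ for all nonzero submodules $N$. A critical composition series of $M$ is a finite series of submodules $0 = M_0 \subsetneq M_1 \subsetneq \dots \subsetneq M_n = M$ such that $M_i/M_{i-1}$ is $d_i$-critical for $1 \le i \le n$, with $d_i \leq d_{i+1}$ for all $i$; $n$ is its length (when GK dimension is exact, any two critical composition series of $M$ have the same length). "$\operatorname{GKdim}_{L}$-critical" means with respect to GK dimension over the field $L$. A class $\mathcal{F}$ of field extensions is extensive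 if: (i) if $k \subseteq L$ and $L \subseteq K$ are in the class, then $k \subseteq K$ is in the class; (ii) if $k \subseteq L$ and $k \subseteq L'$ are in the class, there is an extension $k \subseteq E$ in the class with subfields $k \subseteq F \subseteq E$, $k \subseteq F' \subseteq E$, and $k$-isomorphisms $L \cong F$ and $L' \cong F'$; (iii) if $k \subseteq K$ is in the class and $k \subseteq L \subseteq K$ and $k \subseteq L' \subseteq K$ are subextensions with $k \subseteq L$ and $k \subseteq L'$ finitely generated, then there is a subextension $k \subseteq LL' \subseteq M \subseteq K$ with $k \subseteq M$ finitely generated, and with $k \subseteq M$ and $M \subseteq K$ in the class. $R$ is $\mathcal{F}$-stably right noetherian over $k$ if $R \otimes_k K$ is right noetherian for all extensions $k \subseteq K$ in $\mathcal{F}$. *)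

theory Defs
  imports
    "HOL-Algebra.QuotRing"
    "HOL-Algebra.Generated_Fields"
    "HOL-Algebra.Free_Abelian_Groups"
    "HOL-Library.Extended_Real"
    "Jordan_Normal_Form.Missing_VectorSpace"
begin

section \<open>Noncommutative algebras and right modules\<close>

text \<open>The library locale \<^locale>\<open>algebra\<close> only covers commutative algebras. As there, an algebra is a
  \<^typ>\<open>('a, 'b) module\<close> record, which carries both the ring operations and the scalar action.\<close>

definition assoc_algebra :: "('a, 'c) ring_scheme \<Rightarrow> ('a, 'b, 'd) module_scheme \<Rightarrow> bool" where
  "assoc_algebra k A \<longleftrightarrow> vectorspace k A \<and> ring A \<and>
     (\<forall>c\<in>carrier k. \<forall>x\<in>carrier A. \<forall>y\<in>carrier A.
        (c \<odot>\<^bsub>A\<^esub> x) \<otimes>\<^bsub>A\<^esub> y = c \<odot>\<^bsub>A\<^esub> (x \<otimes>\<^bsub>A\<^esub> y) \<and> x \<otimes>\<^bsub>A\<^esub> (c \<odot>\<^bsub>A\<^esub> y) = c \<odot>\<^bsub>A\<^esub> (x \<otimes>\<^bsub>A\<^esub> y))"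

text \<open>A right \<open>S\<close>-module is also a \<^typ>\<open>('s, 'm) module\<close> record, but \<open>s \<odot>\<^bsub>M\<^esub> m\<close> stands for \<open>m \<cdot> s\<close>.
  As in quotients and base changes below, the ring multiplication and the one of the record
  play no role.\<close>

definition right_module :: "('s, 'c) ring_scheme \<Rightarrow> ('s, 'm, 'd) module_scheme \<Rightarrow> bool" where
  "right_module S M \<longleftrightarrow> ring S \<and> abelian_group M \<and>
     (\<forall>s\<in>carrier S. \<forall>x\<in>carrier M. s \<odot>\<^bsub>M\<^esub> x \<in> carrier M) \<and>
     (\<forall>s\<in>carrier S. \<forall>t\<in>carrier S. \<forall>x\<in>carrier M.
        (s \<oplus>\<^bsub>S\<^esub> t) \<odot>\<^bsub>M\<^esub> x = s \<odot>\<^bsub>M\<^esub> x \<oplus>\<^bsub>M\<^esub> t \<odot>\<^bsub>M\<^esub> x) \<and>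
     (\<forall>s\<in>carrier S. \<forall>x\<in>carrier M. \<forall>y\<in>carrier M.
        s \<odot>\<^bsub>M\<^esub> (x \<oplus>\<^bsub>M\<^esub> y) = s \<odot>\<^bsub>M\<^esub> x \<oplus>\<^bsub>M\<^esub> s \<odot>\<^bsub>M\<^esub> y) \<and>
     (\<forall>s\<in>carrier S. \<forall>t\<in>carrier S. \<forall>x\<in>carrier M.
        (s \<otimes>\<^bsub>S\<^esub> t) \<odot>\<^bsub>M\<^esub> x = t \<odot>\<^bsub>M\<^esub> (s \<odot>\<^bsub>M\<^esub> x)) \<and>
     (\<forall>x\<in>carrier M. \<one>\<^bsub>S\<^esub> \<odot>\<^bsub>M\<^esub> x = x)"

text \<open>\<open>Module.submodule\<close> is the notion of HOL-Algebra; it does not presuppose commutativity of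
  the ring, unlike the homonymous locale of the AFP entry on vector spaces.\<close>

abbreviation is_submodule :: "('s, 'c) ring_scheme \<Rightarrow> ('s, 'm, 'd) module_scheme \<Rightarrow> 'm set \<Rightarrow> bool" where
  "is_submodule S M N \<equiv> Module.submodule N S M"

definition quotient_module :: "('s, 'm, 'd) module_scheme \<Rightarrow> 'm set \<Rightarrow> ('s, 'm set) module" where
  "quotient_module M N = \<lparr>carrier = a_rcosets\<^bsub>M\<^esub> N, mult = undefined, one = undefined,
     ring.zero = N, add = set_add M, smult = (\<lambda>s X. \<Union>x\<in>X. N +>\<^bsub>M\<^esub> (s \<odot>\<^bsub>M\<^esub> x))\<rparr>"

definition fg_right_module :: "('s, 'c) ring_scheme \<Rightarrow> ('s, 'm, 'd) module_scheme \<Rightarrow> bool" where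
  "fg_right_module S M \<longleftrightarrow> right_module S M \<and>
     (\<exists>X. finite X \<and> X \<subseteq> carrier M \<and> (\<forall>N. is_submodule S M N \<and> X \<subseteq> N \<longrightarrow> N = carrier M))"

definition regular_module :: "('s, 'c) ring_scheme \<Rightarrow> ('s, 's) module" where
  "regular_module S = \<lparr>carrier = carrier S, mult = mult S, one = one S, ring.zero = ring.zero S, add = add S,
     smult = (\<lambda>s x. x \<otimes>\<^bsub>S\<^esub> s)\<rparr>"

definition right_noetherian :: "('s, 'c) ring_scheme \<Rightarrow> bool" where
  "right_noetherian S \<longleftrightarrow> ring S \<and>
     (\<forall>I. is_submodule S (regular_module S) I \<longrightarrow> fg_right_module S ((regular_module S)\<lparr>carrier := I\<rparr>))"


section \<open>Gelfand-Kirillov dimension\<close>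

text \<open>Here \<open>log 0 = -\<infinity>\<close>, whereas \<^const>\<open>log\<close> maps \<open>0\<close> to \<open>0\<close>.\<close>

definition growth_exponent :: "(nat \<Rightarrow> nat) \<Rightarrow> ereal" where
  "growth_exponent d = limsup (\<lambda>n. if d n = 0 then - \<infinity> else ereal (log (real n) (real (d n))))"

definition fd_subspace :: "('a, 'c) ring_scheme \<Rightarrow> ('a, 'b, 'd) module_scheme \<Rightarrow> 'b set \<Rightarrow> bool" where
  "fd_subspace k A V \<longleftrightarrow> subspace k V A \<and> vectorspace.fin_dim k (A\<lparr>carrier := V\<rparr>)"

definition subspace_dim :: "('a, 'c) ring_scheme \<Rightarrow> ('a, 'b, 'd) module_scheme \<Rightarrow> 'b set \<Rightarrow> nat" where
  "subspace_dim k A V = vectorspace.dim k (A\<lparr>carrier := V\<rparr>)"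

fun subspace_power ::
  "('a, 'c) ring_scheme \<Rightarrow> ('a, 'b, 'd) module_scheme \<Rightarrow> 'b set \<Rightarrow> nat \<Rightarrow> 'b set" where
  "subspace_power k A V 0 = module.span k A {\<one>\<^bsub>A\<^esub>}"
| "subspace_power k A V (Suc n) =
     module.span k A {x \<otimes>\<^bsub>A\<^esub> v | x v. x \<in> subspace_power k A V n \<and> v \<in> V}"

definition GKdim_algebra :: "('a, 'c) ring_scheme \<Rightarrow> ('a, 'b, 'd) module_scheme \<Rightarrow> ereal" where
  "GKdim_algebra k A = (SUP V \<in> {V. fd_subspace k A V}.
     growth_exponent (\<lambda>n. subspace_dim k A (subspace_power k A V n)))"

text \<open>The vector space over the base field underlying a right module over the algebra \<open>S\<close>.\<close>

definition restrict_scalars ::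
  "('a, 's, 'c) module_scheme \<Rightarrow> ('s, 'm, 'd) module_scheme \<Rightarrow> ('a, 'm) module" where
  "restrict_scalars S M = \<lparr>carrier = carrier M, mult = mult M, one = one M, ring.zero = ring.zero M, add = add M,
     smult = (\<lambda>c m. (c \<odot>\<^bsub>S\<^esub> \<one>\<^bsub>S\<^esub>) \<odot>\<^bsub>M\<^esub> m)\<rparr>"

definition GKdim ::
  "('a, 'c) ring_scheme \<Rightarrow> ('a, 's, 'd) module_scheme \<Rightarrow> ('s, 'm, 'e) module_scheme \<Rightarrow> ereal" where
  "GKdim k S M = (if carrier M = {\<zero>\<^bsub>M\<^esub>} then - 1 else
     (SUP (W, V) \<in> {W. fd_subspace k (restrict_scalars S M) W} \<times> {V. fd_subspace k S V}.
        growth_exponent (\<lambda>n. subspace_dim k (restrict_scalars S M)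
          (module.span k (restrict_scalars S M)
             {v \<odot>\<^bsub>M\<^esub> w | v w. v \<in> subspace_power k S V n \<and> w \<in> W}))))"

text \<open>The next three properties concern all finitely generated right \<open>S\<close>-modules. Up to isomorphism
  these are the quotients of the modules \<open>S\<^sup>n\<close>; an element of such a quotient is a set of functions
  from \<open>nat\<close> to \<open>S\<close>, so the type \<open>('s, 's fg_elem) module\<close> contains a copy of each of them.\<close>

type_synonym 's fg_elem = "(nat \<Rightarrow> 's) set"

definition GK_exact :: "('a, 'c) ring_scheme \<Rightarrow> ('a, 's) module \<Rightarrow> bool" where
  "GK_exact k S \<longleftrightarrow> (\<forall>(M :: ('s, 's fg_elem) module) (N :: ('s, 's fg_elem) module)
       (P :: ('s, 's fg_elem) module) f g.
     fg_right_module S M \<and> fg_right_module S N \<and> fg_right_module S P \<and>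
     f \<in> module_hom S M N \<and> g \<in> module_hom S N P \<and>
     inj_on f (carrier M) \<and> f ` carrier M = {x \<in> carrier N. g x = \<zero>\<^bsub>P\<^esub>} \<and> g ` carrier N = carrier P
     \<longrightarrow> GKdim k S N = max (GKdim k S M) (GKdim k S P))"

definition GK_finitely_partitive :: "('a, 'c) ring_scheme \<Rightarrow> ('a, 's) module \<Rightarrow> bool" where
  "GK_finitely_partitive k S \<longleftrightarrow> (\<forall>N :: ('s, 's fg_elem) module. fg_right_module S N \<longrightarrow>
     (\<exists>b. \<forall>n C. C 0 = carrier N \<and> (\<forall>i\<le>n. is_submodule S N (C i)) \<and>
        (\<forall>i<n. C (Suc i) \<subset> C i \<and>
           GKdim k S (quotient_module (N\<lparr>carrier := C i\<rparr>) (C (Suc i))) = GKdim k S N)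
        \<longrightarrow> n \<le> b))"

definition GK_integer_valued :: "('a, 'c) ring_scheme \<Rightarrow> ('a, 's) module \<Rightarrow> bool" where
  "GK_integer_valued k S \<longleftrightarrow> (\<forall>M :: ('s, 's fg_elem) module. fg_right_module S M \<longrightarrow>
     (\<exists>z::int. GKdim k S M = ereal (of_int z)))"

definition GK_critical ::
  "('a, 'c) ring_scheme \<Rightarrow> ('a, 's, 'd) module_scheme \<Rightarrow> ereal \<Rightarrow> ('s, 'm, 'e) module_scheme \<Rightarrow> bool" where
  "GK_critical k S d M \<longleftrightarrow> carrier M \<noteq> {\<zero>\<^bsub>M\<^esub>} \<and> GKdim k S M = d \<and> d < \<infinity> \<and>
     (\<forall>N. is_submodule S M N \<and> N \<noteq> {\<zero>\<^bsub>M\<^esub>} \<longrightarrow> GKdim k S (quotient_module M N) < d)"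

text \<open>\<open>C 0, \<dots>, C n\<close> is a critical composition series of \<open>M\<close> of length \<open>n\<close>.\<close>

definition critical_composition_series ::
  "('a, 'c) ring_scheme \<Rightarrow> ('a, 's, 'd) module_scheme \<Rightarrow> ('s, 'm, 'e) module_scheme \<Rightarrow>
   (nat \<Rightarrow> 'm set) \<Rightarrow> nat \<Rightarrow> bool" where
  "critical_composition_series k S M C n \<longleftrightarrow>
     C 0 = {\<zero>\<^bsub>M\<^esub>} \<and> C n = carrier M \<and> (\<forall>i\<le>n. is_submodule S M (C i)) \<and>
     (\<exists>d. (\<forall>i\<in>{1..n}. C (i - 1) \<subset> C i \<and>
             GK_critical k S (d i) (quotient_module (M\<lparr>carrier := C i\<rparr>) (C (i - 1)))) \<and>
          (\<forall>i. 1 \<le> i \<and> i < n \<longrightarrow> d i \<le> d (i + 1)))"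


section \<open>Field extensions\<close>

text \<open>An extension \<open>k \<subseteq> L\<close> is an honest inclusion of carriers; operations are only compared on the
  smaller carrier, since their values elsewhere are meaningless.\<close>

definition field_extension :: "'a ring \<Rightarrow> 'a ring \<Rightarrow> bool" where
  "field_extension k L \<longleftrightarrow> field k \<and> field L \<and> (\<lambda>x. x) \<in> ring_hom k L"

definition fg_field_extension :: "'a ring \<Rightarrow> 'a ring \<Rightarrow> bool" where
  "fg_field_extension k L \<longleftrightarrow> field_extension k L \<and>
     (\<exists>X. finite X \<and> X \<subseteq> carrier L \<and> generate_field L (carrier k \<union> X) = carrier L)"

text \<open>A class of field extensions is a binary relation on the fields whose elements belong to the
  arbitrary type \<open>'a\<close>, which plays the role of a universe.\<close>

definition extensive :: "('a ring \<Rightarrow> 'a ring \<Rightarrow> bool) \<Rightarrow> bool" where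
  "extensive \<F> \<longleftrightarrow>
     (\<forall>k L. \<F> k L \<longrightarrow> field_extension k L) \<and>
     (\<forall>k L K. \<F> k L \<and> \<F> L K \<longrightarrow> \<F> k K) \<and>
     (\<forall>k L L'. \<F> k L \<and> \<F> k L' \<longrightarrow>
        (\<exists>E F F' \<phi> \<phi>'. \<F> k E \<and>
           subfield F E \<and> carrier k \<subseteq> F \<and> subfield F' E \<and> carrier k \<subseteq> F' \<and>
           \<phi> \<in> ring_iso L (E\<lparr>carrier := F\<rparr>) \<and> (\<forall>c\<in>carrier k. \<phi> c = c) \<and>
           \<phi>' \<in> ring_iso L' (E\<lparr>carrier := F'\<rparr>) \<and> (\<forall>c\<in>carrier k. \<phi>' c = c))) \<and>
     (\<forall>k K L L'. \<F> k K \<and> fg_field_extension k L \<and> field_extension L K \<and>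
        fg_field_extension k L' \<and> field_extension L' K \<longrightarrow>
        (\<exists>M. generate_field K (carrier L \<union> carrier L') \<subseteq> carrier M \<and>
           \<F> k M \<and> \<F> M K \<and> fg_field_extension k M))"

definition small_field ::
  "('a ring \<Rightarrow> 'a ring \<Rightarrow> bool) \<Rightarrow> 'a ring \<Rightarrow> 'a ring \<Rightarrow> 'a ring \<Rightarrow> bool" where
  "small_field \<F> k K L \<longleftrightarrow> \<F> k L \<and> \<F> L K \<and> fg_field_extension k L"


section \<open>Base change along a field extension\<close>

text \<open>For a vector space \<open>A\<close> over \<open>k\<close> and an extension field \<open>L\<close>, the tensor product of \<open>A\<close> and \<open>L\<close>
  over \<open>k\<close> is the free abelian group on \<open>carrier A \<times> carrier L\<close> modulo the subgroup generated by
  the usual relations. Its elements are cosets.\<close>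

type_synonym ('x, 'a) tensor = "('x \<times> 'a \<Rightarrow>\<^sub>0 int) set"

definition tensor_free ::
  "('a, 'x, 'c) module_scheme \<Rightarrow> 'a ring \<Rightarrow> ('x \<times> 'a \<Rightarrow>\<^sub>0 int) monoid" where
  "tensor_free A L = free_Abelian_group (carrier A \<times> carrier L)"

definition tensor_rels ::
  "'a ring \<Rightarrow> ('a, 'x, 'c) module_scheme \<Rightarrow> 'a ring \<Rightarrow> ('x \<times> 'a \<Rightarrow>\<^sub>0 int) set" where
  "tensor_rels k A L =
     {frag_of (x \<oplus>\<^bsub>A\<^esub> y, a) - frag_of (x, a) - frag_of (y, a) | x y a.
        x \<in> carrier A \<and> y \<in> carrier A \<and> a \<in> carrier L} \<union>
     {frag_of (x, a \<oplus>\<^bsub>L\<^esub> b) - frag_of (x, a) - frag_of (x, b) | x a b.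
        x \<in> carrier A \<and> a \<in> carrier L \<and> b \<in> carrier L} \<union>
     {frag_of (c \<odot>\<^bsub>A\<^esub> x, a) - frag_of (x, c \<otimes>\<^bsub>L\<^esub> a) | c x a.
        c \<in> carrier k \<and> x \<in> carrier A \<and> a \<in> carrier L}"

definition tensor_null ::
  "'a ring \<Rightarrow> ('a, 'x, 'c) module_scheme \<Rightarrow> 'a ring \<Rightarrow> ('x \<times> 'a \<Rightarrow>\<^sub>0 int) set" where
  "tensor_null k A L = generate (tensor_free A L) (tensor_rels k A L)"

definition tensor_class ::
  "'a ring \<Rightarrow> ('a, 'x, 'c) module_scheme \<Rightarrow> 'a ring \<Rightarrow> ('x \<times> 'a \<Rightarrow>\<^sub>0 int) \<Rightarrow> ('x, 'a) tensor" where
  "tensor_class k A L x = tensor_null k A L #>\<^bsub>tensor_free A L\<^esub> x"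

text \<open>\<open>base_change_algebra k R L\<close> is the \<open>L\<close>-algebra \<open>R\<^sub>L\<close>. Every operation is given by
  representatives, as in \<^const>\<open>rcoset_mult\<close>.\<close>

definition base_change_algebra ::
  "'a ring \<Rightarrow> ('a, 'r) module \<Rightarrow> 'a ring \<Rightarrow> ('a, ('r, 'a) tensor) module" where
  "base_change_algebra k R L =
     \<lparr>carrier = rcosets\<^bsub>tensor_free R L\<^esub> (tensor_null k R L),
      mult = (\<lambda>X Y. \<Union>x\<in>X. \<Union>y\<in>Y. tensor_class k R L
        (frag_extend (\<lambda>(r, a). frag_extend (\<lambda>(s, b). frag_of (r \<otimes>\<^bsub>R\<^esub> s, a \<otimes>\<^bsub>L\<^esub> b)) y) x)),
      one = tensor_class k R L (frag_of (\<one>\<^bsub>R\<^esub>, \<one>\<^bsub>L\<^esub>)),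
      ring.zero = tensor_null k R L,
      add = (\<lambda>X Y. X <#>\<^bsub>tensor_free R L\<^esub> Y),
      smult = (\<lambda>l X. \<Union>x\<in>X. tensor_class k R L
        (frag_extend (\<lambda>(r, a). frag_of (r, l \<otimes>\<^bsub>L\<^esub> a)) x))\<rparr>"

text \<open>For a right \<open>R\<^sub>L\<close>-module \<open>M\<close> and \<open>L \<subseteq> L'\<close>, the right \<open>R\<^sub>L\<^sub>'\<close>-module \<open>M\<^sub>L\<^sub>'\<close> is the tensor product of \<open>M\<close> and \<open>L'\<close>
  over \<open>L\<close>, the element \<open>r \<otimes> b\<close> of \<open>R\<^sub>L\<^sub>'\<close> taking \<open>m \<otimes> a\<close> to \<open>m \<cdot> (r \<otimes> 1) \<otimes> a b\<close>.\<close>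

definition base_change_module ::
  "'a ring \<Rightarrow> ('a, 'r) module \<Rightarrow> 'a ring \<Rightarrow> 'a ring \<Rightarrow> (('r, 'a) tensor, 'm) module \<Rightarrow>
   (('r, 'a) tensor, ('m, 'a) tensor) module" where
  "base_change_module k R L L' M =
     (let M\<^sub>0 = restrict_scalars (base_change_algebra k R L) M in
     \<lparr>carrier = rcosets\<^bsub>tensor_free M\<^sub>0 L'\<^esub> (tensor_null L M\<^sub>0 L'),
      mult = undefined,
      one = undefined,
      ring.zero = tensor_null L M\<^sub>0 L',
      add = (\<lambda>X Y. X <#>\<^bsub>tensor_free M\<^sub>0 L'\<^esub> Y),
      smult = (\<lambda>T X. \<Union>t\<in>T. \<Union>x\<in>X. tensor_class L M\<^sub>0 L'
        (frag_extend (\<lambda>(m, a). frag_extend (\<lambda>(r, b).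
           frag_of (tensor_class k R L (frag_of (r, \<one>\<^bsub>L\<^esub>)) \<odot>\<^bsub>M\<^esub> m, a \<otimes>\<^bsub>L'\<^esub> b)) t) x))\<rparr>)"


section \<open>Stable noetherianity and the two hypotheses\<close>

definition stably_right_noetherian ::
  "('a ring \<Rightarrow> 'a ring \<Rightarrow> bool) \<Rightarrow> 'a ring \<Rightarrow> ('a, 'r) module \<Rightarrow> bool" where
  "stably_right_noetherian \<F> k R \<longleftrightarrow>
     (\<forall>K. \<F> k K \<longrightarrow> right_noetherian (base_change_algebra k R K))"

definition GK_well_behaved ::
  "('a ring \<Rightarrow> 'a ring \<Rightarrow> bool) \<Rightarrow> 'a ring \<Rightarrow> ('a, 'r) module \<Rightarrow> 'a ring \<Rightarrow> bool" where
  "GK_well_behaved \<F> k R K \<longleftrightarrow> (\<forall>L. small_field \<F> k K L \<longrightarrow>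
     GK_exact L (base_change_algebra k R L) \<and>
     GK_finitely_partitive L (base_change_algebra k R L) \<and>
     GK_integer_valued L (base_change_algebra k R L))"

definition critical_lengths_bounded ::
  "('a ring \<Rightarrow> 'a ring \<Rightarrow> bool) \<Rightarrow> 'a ring \<Rightarrow> ('a, 'r) module \<Rightarrow> 'a ring \<Rightarrow> bool" where
  "critical_lengths_bounded \<F> k R K \<longleftrightarrow> (\<forall>L. small_field \<F> k K L \<longrightarrow>
     (\<forall>M :: (('r, 'a) tensor, ('r, 'a) tensor fg_elem) module.
        fg_right_module (base_change_algebra k R L) M \<longrightarrow>
        (\<exists>n. \<forall>L'. small_field \<F> k K L' \<and> \<F> L L' \<longrightarrow>
           (\<forall>C m. critical_composition_series L' (base_change_algebra k R L')
                    (base_change_module k R L L' M) C m \<longrightarrow> m \<le> n))))"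

end

theory Submission
  imports Defs
begin

text \<open>Write \<open>S\<^sub>L\<close> for \<open>R \<otimes>\<^sub>k L\<close>. For a right ideal \<open>I\<close> of \<open>S\<^sub>L\<close> and \<open>e \<ge> 0\<close>, let \<open>\<lambda>\<^sub>e(I)\<close> be the largest number of
  factors of GK dimension \<open>e\<close> in a chain of submodules of dimension at most \<open>e\<close> of \<open>S\<^sub>L/I\<close>. Every critical
  composition series of \<open>S\<^sub>L/I\<close> has length at least \<open>\<lambda>\<^sub>e(I)\<close>, so hypothesis (ii) bounds these numbers for all
  base changes of \<open>S\<^sub>L/I\<close> to larger small fields. Replacing \<open>I\<close> by a larger right ideal \<open>J\<close> lowers \<open>\<lambda>\<^sub>e\<close> for
  \<open>e = GKdim(J/I)\<close> and does not raise \<open>\<lambda>\<^sub>e\<^sub>'\<close> for \<open>e' > e\<close>; hence the lexicographic maximum of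
  \<open>(\<lambda>\<^sub>b, \<dots>, \<lambda>\<^sub>0)\<close> over all larger small fields is a measure for well-founded induction. A right ideal of
  \<open>S\<^sub>K\<close> that properly contains \<open>I S\<^sub>K\<close> has an element outside \<open>I S\<^sub>K\<close>, which is defined over a small field;
  adjoining it to \<open>I\<close> lowers the measure. Two further facts enter: \<open>S\<^sub>L\<close> is right noetherian for finitely
  generated \<open>L\<close> (Hilbert basis theorem and localization), and the dimensions are bounded uniformly in \<open>L\<close>,
  since \<open>S\<^sub>L\<close> grows no faster than \<open>R\<close>. Only cyclic modules occur, so everything takes place among right
  ideals.\<close>

section \<open>Right modules\<close>

text \<open>Uniqueness of the length of critical series is bypassed: since hypothesis (ii) speaks of
  every such series, one existing series of dominating length is enough. The domination holds
  because intersecting a chain with the next lower member of the series costs at most one step. The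
  maximum over all larger small fields is forced by an obstacle: an extension of scalars may destroy
  criticality, so nothing controls how \<open>\<lambda>\<^sub>e\<close> changes from one field to
  the next. Only vectors over the same field are compared, and the maximum is a quantity that does
  not refer to one field. Large dimensions come first in the vector because replacing
  \<open>I\<close> by \<open>J\<close> leaves the entries below \<open>GKdim(J/I)\<close>
  uncontrolled. The lexicographic order is well-founded only for lists of a fixed length; this is
  where a bound on dimensions independent of \<open>L\<close> enters. A formal obstacle is that (i)
  and (ii) quantify over modules of one fixed type. Every quotient of right ideals is therefore
  replaced by an isomorphic copy in that type, and dimensions are then read off as a function of
  pairs of right ideals.\<close>

locale rmod = S: ring S + M: abelian_group M
  for S :: "('s, 'c) ring_scheme" (structure) and M :: "('s, 'm, 'd) module_scheme" (structure) +
  assumes act_closed [simp, intro]: "\<lbrakk>s \<in> carrier S; x \<in> carrier M\<rbrakk> \<Longrightarrow> s \<odot>\<^bsub>M\<^esub> x \<in> carrier M"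
    and act_ladd: "\<lbrakk>s \<in> carrier S; t \<in> carrier S; x \<in> carrier M\<rbrakk> \<Longrightarrow>
      (s \<oplus>\<^bsub>S\<^esub> t) \<odot>\<^bsub>M\<^esub> x = s \<odot>\<^bsub>M\<^esub> x \<oplus>\<^bsub>M\<^esub> t \<odot>\<^bsub>M\<^esub> x"
    and act_radd: "\<lbrakk>s \<in> carrier S; x \<in> carrier M; y \<in> carrier M\<rbrakk> \<Longrightarrow>
      s \<odot>\<^bsub>M\<^esub> (x \<oplus>\<^bsub>M\<^esub> y) = s \<odot>\<^bsub>M\<^esub> x \<oplus>\<^bsub>M\<^esub> s \<odot>\<^bsub>M\<^esub> y"
    and act_mult: "\<lbrakk>s \<in> carrier S; t \<in> carrier S; x \<in> carrier M\<rbrakk> \<Longrightarrow>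
      (s \<otimes>\<^bsub>S\<^esub> t) \<odot>\<^bsub>M\<^esub> x = t \<odot>\<^bsub>M\<^esub> (s \<odot>\<^bsub>M\<^esub> x)"
    and act_one [simp]: "x \<in> carrier M \<Longrightarrow> \<one>\<^bsub>S\<^esub> \<odot>\<^bsub>M\<^esub> x = x"

lemma right_module_iff_rmod: "right_module S M \<longleftrightarrow> rmod S M"
  unfolding right_module_def rmod_def rmod_axioms_def by (auto simp: Ball_def)

context rmod
begin

lemma act_zero_left [simp]:
  assumes "x \<in> carrier M" shows "\<zero>\<^bsub>S\<^esub> \<odot>\<^bsub>M\<^esub> x = \<zero>\<^bsub>M\<^esub>"
  using act_ladd[of "\<zero>\<^bsub>S\<^esub>" "\<zero>\<^bsub>S\<^esub>" x] assms
  by (metis S.zero_closed S.r_zero act_closed M.add.l_cancel_one')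

lemma act_zero_right [simp]:
  assumes "s \<in> carrier S" shows "s \<odot>\<^bsub>M\<^esub> \<zero>\<^bsub>M\<^esub> = \<zero>\<^bsub>M\<^esub>"
  using act_radd[of s "\<zero>\<^bsub>M\<^esub>" "\<zero>\<^bsub>M\<^esub>"] assms
  by (metis M.zero_closed M.r_zero act_closed M.add.l_cancel_one')

lemma act_minus_one:
  assumes "x \<in> carrier M" shows "(\<ominus>\<^bsub>S\<^esub> \<one>\<^bsub>S\<^esub>) \<odot>\<^bsub>M\<^esub> x = \<ominus>\<^bsub>M\<^esub> x"
proof -
  have "(\<ominus>\<^bsub>S\<^esub> \<one>\<^bsub>S\<^esub>) \<odot>\<^bsub>M\<^esub> x \<oplus>\<^bsub>M\<^esub> x = (\<ominus>\<^bsub>S\<^esub> \<one>\<^bsub>S\<^esub> \<oplus>\<^bsub>S\<^esub> \<one>\<^bsub>S\<^esub>) \<odot>\<^bsub>M\<^esub> x"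
    using act_ladd[of "\<ominus>\<^bsub>S\<^esub> \<one>\<^bsub>S\<^esub>" "\<one>\<^bsub>S\<^esub>" x] assms by simp
  also have "\<dots> = \<zero>\<^bsub>M\<^esub>" using assms by (simp add: S.l_neg)
  finally show ?thesis using assms by (simp add: M.minus_equality)
qed

text \<open>Negatives are absent on the right because they arise from the action of minus
  one.\<close>

lemma submodule_iff:
  "is_submodule S M N \<longleftrightarrow> N \<subseteq> carrier M \<and> \<zero>\<^bsub>M\<^esub> \<in> N \<and> (\<forall>x\<in>N. \<forall>y\<in>N. x \<oplus>\<^bsub>M\<^esub> y \<in> N) \<and>
     (\<forall>s\<in>carrier S. \<forall>x\<in>N. s \<odot>\<^bsub>M\<^esub> x \<in> N)"
proof
  assume "is_submodule S M N"
  then interpret N: Module.submodule N S M .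
  show "N \<subseteq> carrier M \<and> \<zero>\<^bsub>M\<^esub> \<in> N \<and> (\<forall>x\<in>N. \<forall>y\<in>N. x \<oplus>\<^bsub>M\<^esub> y \<in> N) \<and> (\<forall>s\<in>carrier S. \<forall>x\<in>N. s \<odot>\<^bsub>M\<^esub> x \<in> N)"
    using N.subset N.one_closed N.m_closed N.smult_closed by auto
next
  assume *: "N \<subseteq> carrier M \<and> \<zero>\<^bsub>M\<^esub> \<in> N \<and> (\<forall>x\<in>N. \<forall>y\<in>N. x \<oplus>\<^bsub>M\<^esub> y \<in> N) \<and> (\<forall>s\<in>carrier S. \<forall>x\<in>N. s \<odot>\<^bsub>M\<^esub> x \<in> N)"
  have inv: "\<ominus>\<^bsub>M\<^esub> x \<in> N" if "x \<in> N" for x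
    using * that act_minus_one[of x] by (metis S.add.inv_closed S.one_closed subsetD)
  show "is_submodule S M N"
    by (intro Module.submodule.intro subgroup.intro submodule_axioms.intro)
       (use * inv in \<open>auto simp: a_inv_def\<close>)
qed

lemma submodule_minus: "is_submodule S M N \<Longrightarrow> x \<in> N \<Longrightarrow> \<ominus>\<^bsub>M\<^esub> x \<in> N"
  unfolding submodule_iff by (metis S.add.inv_closed S.one_closed act_minus_one subsetD)

end

text \<open>Since all module axioms except the existence of negatives are equations, an operation
  preserving surjection from a module turns its target into a module.\<close>

definition hom_onto ::
  "('s, 'c) ring_scheme \<Rightarrow> ('s, 'm, 'd) module_scheme \<Rightarrow> ('s, 'n, 'e) module_scheme \<Rightarrow> ('m \<Rightarrow> 'n) \<Rightarrow> bool" where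
  "hom_onto S M Q f \<longleftrightarrow> rmod S M \<and> f ` carrier M = carrier Q \<and> f \<zero>\<^bsub>M\<^esub> = \<zero>\<^bsub>Q\<^esub> \<and>
     (\<forall>x\<in>carrier M. \<forall>y\<in>carrier M. f (x \<oplus>\<^bsub>M\<^esub> y) = f x \<oplus>\<^bsub>Q\<^esub> f y) \<and>
     (\<forall>s\<in>carrier S. \<forall>x\<in>carrier M. f (s \<odot>\<^bsub>M\<^esub> x) = s \<odot>\<^bsub>Q\<^esub> f x)"

lemma hom_onto_rmod:
  assumes "hom_onto S M Q f" shows "rmod S Q"
proof -
  interpret M: rmod S M using assms unfolding hom_onto_def by blast
  have im: "carrier Q = f ` carrier M" and z: "\<zero>\<^bsub>Q\<^esub> = f \<zero>\<^bsub>M\<^esub>"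
    and a: "\<And>x y. x \<in> carrier M \<Longrightarrow> y \<in> carrier M \<Longrightarrow> f x \<oplus>\<^bsub>Q\<^esub> f y = f (x \<oplus>\<^bsub>M\<^esub> y)"
    and s: "\<And>s x. s \<in> carrier S \<Longrightarrow> x \<in> carrier M \<Longrightarrow> s \<odot>\<^bsub>Q\<^esub> f x = f (s \<odot>\<^bsub>M\<^esub> x)"
    using assms unfolding hom_onto_def by auto
  have "abelian_group Q"
  proof (rule abelian_groupI)
    show "\<exists>y\<in>carrier Q. y \<oplus>\<^bsub>Q\<^esub> x = \<zero>\<^bsub>Q\<^esub>" if x: "x \<in> carrier Q" for x
    proof -
      obtain u where "u \<in> carrier M" "x = f u" using x im by blast
      then show ?thesis using im z a[of "\<ominus>\<^bsub>M\<^esub> u" u] M.M.l_neg by (intro bexI[of _ "f (\<ominus>\<^bsub>M\<^esub> u)"]) auto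
    qed
  qed (auto simp: im z a M.M.a_ac)
  then show ?thesis
    unfolding rmod_def rmod_axioms_def
    by (auto simp: im a s M.S.ring_axioms M.act_ladd M.act_radd M.act_mult)
qed

lemma hom_onto_diff:
  assumes "hom_onto S M Q f" "x \<in> carrier M" "y \<in> carrier M"
  shows "f (x \<ominus>\<^bsub>M\<^esub> y) = f x \<ominus>\<^bsub>Q\<^esub> f y"
proof -
  interpret M: rmod S M using assms unfolding hom_onto_def by blast
  interpret Q: rmod S Q using hom_onto_rmod[OF assms(1)] .
  have c: "\<And>u. u \<in> carrier M \<Longrightarrow> f u \<in> carrier Q" using assms(1) unfolding hom_onto_def by auto
  have "f (x \<ominus>\<^bsub>M\<^esub> y) \<oplus>\<^bsub>Q\<^esub> f y = f (x \<ominus>\<^bsub>M\<^esub> y \<oplus>\<^bsub>M\<^esub> y)"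
    using assms unfolding hom_onto_def by auto
  also have "x \<ominus>\<^bsub>M\<^esub> y \<oplus>\<^bsub>M\<^esub> y = x"
    using assms by (simp add: M.M.minus_eq M.M.a_assoc M.M.l_neg)
  finally have *: "f (x \<ominus>\<^bsub>M\<^esub> y) \<oplus>\<^bsub>Q\<^esub> f y = f x" .
  show ?thesis
    unfolding *[symmetric] using c assms by (simp add: Q.M.minus_eq Q.M.a_assoc Q.M.r_neg)
qed

lemma hom_onto_eq_iff:
  assumes "hom_onto S M Q f" "x \<in> carrier M" "y \<in> carrier M"
  shows "f x = f y \<longleftrightarrow> f (x \<ominus>\<^bsub>M\<^esub> y) = \<zero>\<^bsub>Q\<^esub>"
proof -
  interpret Q: rmod S Q using hom_onto_rmod[OF assms(1)] .
  have "f x \<in> carrier Q" "f y \<in> carrier Q" using assms unfolding hom_onto_def by auto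
  then show ?thesis by (simp add: hom_onto_diff[OF assms])
qed

lemma hom_onto_comp:
  assumes f: "hom_onto S M P f" and h: "hom_onto S P Q h"
  shows "hom_onto S M Q (h \<circ> f)"
proof -
  have c: "\<And>x. x \<in> carrier M \<Longrightarrow> f x \<in> carrier P" using f unfolding hom_onto_def by auto
  show ?thesis using f h unfolding hom_onto_def image_comp[symmetric] by (simp add: c)
qed

definition hom_kernel :: "('s, 'm, 'd) module_scheme \<Rightarrow> ('s, 'n, 'e) module_scheme \<Rightarrow> ('m \<Rightarrow> 'n) \<Rightarrow> 'm set" where
  "hom_kernel M Q f = {x \<in> carrier M. f x = \<zero>\<^bsub>Q\<^esub>}"

lemma hom_onto_submodule_image:
  assumes f: "hom_onto S M Q f" and N: "is_submodule S M N"
  shows "is_submodule S Q (f ` N)"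
proof -
  interpret M: rmod S M using assms unfolding hom_onto_def by blast
  interpret Q: rmod S Q using hom_onto_rmod[OF assms(1)] .
  have N': "N \<subseteq> carrier M" "\<zero>\<^bsub>M\<^esub> \<in> N" "\<And>x y. x \<in> N \<Longrightarrow> y \<in> N \<Longrightarrow> x \<oplus>\<^bsub>M\<^esub> y \<in> N"
    "\<And>s x. s \<in> carrier S \<Longrightarrow> x \<in> N \<Longrightarrow> s \<odot>\<^bsub>M\<^esub> x \<in> N"
    using N unfolding M.submodule_iff by auto
  have h: "f \<zero>\<^bsub>M\<^esub> = \<zero>\<^bsub>Q\<^esub>" "f ` carrier M = carrier Q"
     "\<And>x y. x \<in> N \<Longrightarrow> y \<in> N \<Longrightarrow> f x \<oplus>\<^bsub>Q\<^esub> f y = f (x \<oplus>\<^bsub>M\<^esub> y)"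
     "\<And>s x. s \<in> carrier S \<Longrightarrow> x \<in> N \<Longrightarrow> s \<odot>\<^bsub>Q\<^esub> f x = f (s \<odot>\<^bsub>M\<^esub> x)"
    using f subsetD[OF N'(1)] unfolding hom_onto_def by simp_all
  show ?thesis unfolding Q.submodule_iff
    using image_mono[OF N'(1), of f] N'(2-4) h(2) by (auto simp: h(3,4) h(1)[symmetric])
qed

lemma hom_onto_submodule_preimage:
  assumes f: "hom_onto S M Q f" and N: "is_submodule S Q N"
  shows "is_submodule S M {x \<in> carrier M. f x \<in> N}"
proof -
  interpret M: rmod S M using assms unfolding hom_onto_def by blast
  interpret Q: rmod S Q using hom_onto_rmod[OF assms(1)] .
  show ?thesis using f N unfolding M.submodule_iff Q.submodule_iff hom_onto_def by auto
qed

lemma hom_kernel_submodule: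
  assumes f: "hom_onto S M Q f"
  shows "is_submodule S M (hom_kernel M Q f)"
proof -
  interpret Q: rmod S Q using hom_onto_rmod[OF assms(1)] .
  have "is_submodule S Q {\<zero>\<^bsub>Q\<^esub>}" unfolding Q.submodule_iff by auto
  from hom_onto_submodule_preimage[OF f this] show ?thesis by (simp add: hom_kernel_def)
qed

lemma submodule_rmod:
  assumes "rmod S M" "is_submodule S M N" shows "rmod S (M\<lparr>carrier := N\<rparr>)"
proof -
  interpret M: rmod S M by fact
  have N': "N \<subseteq> carrier M" "\<zero>\<^bsub>M\<^esub> \<in> N" "\<And>x y. x \<in> N \<Longrightarrow> y \<in> N \<Longrightarrow> x \<oplus>\<^bsub>M\<^esub> y \<in> N"
    "\<And>s x. s \<in> carrier S \<Longrightarrow> x \<in> N \<Longrightarrow> s \<odot>\<^bsub>M\<^esub> x \<in> N"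
    using assms(2) unfolding M.submodule_iff by auto
  have c: "\<And>x. x \<in> N \<Longrightarrow> x \<in> carrier M" using N' by auto
  have "abelian_group (M\<lparr>carrier := N\<rparr>)"
  proof (rule abelian_groupI; simp)
    show "\<exists>y\<in>N. y \<oplus>\<^bsub>M\<^esub> x = \<zero>\<^bsub>M\<^esub>" if "x \<in> N" for x
      using M.submodule_minus[OF assms(2) that] M.M.l_neg[of x] c[OF that] by blast
  qed (use N' c in \<open>auto simp: M.M.a_ac\<close>)
  then show ?thesis
    unfolding rmod_def rmod_axioms_def
    using N' c by (auto simp: M.S.ring_axioms M.act_ladd M.act_radd M.act_mult)
qed

lemma submodule_restrict_iff:
  assumes "rmod S M" "is_submodule S M A"
  shows "is_submodule S (M\<lparr>carrier := A\<rparr>) N \<longleftrightarrow> is_submodule S M N \<and> N \<subseteq> A"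
proof -
  interpret M: rmod S M by fact
  interpret A: rmod S "M\<lparr>carrier := A\<rparr>" by (rule submodule_rmod[OF assms])
  show ?thesis using assms(2) unfolding M.submodule_iff A.submodule_iff by auto
qed

lemma hom_onto_restrict:
  assumes f: "hom_onto S M Q f" and N: "is_submodule S M N"
  shows "hom_onto S (M\<lparr>carrier := N\<rparr>) (Q\<lparr>carrier := f ` N\<rparr>) f"
proof -
  interpret M: rmod S M using assms unfolding hom_onto_def by blast
  have "N \<subseteq> carrier M" using N unfolding M.submodule_iff by auto
  then have "\<And>x. x \<in> N \<Longrightarrow> x \<in> carrier M" by auto
  then show ?thesis using f submodule_rmod[OF M.rmod_axioms N] unfolding hom_onto_def by simp
qed

lemma quotient_module_hom_onto:
  assumes M: "rmod S M" and N: "is_submodule S M N"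
  shows "hom_onto S M (quotient_module M N) (\<lambda>x. N +>\<^bsub>M\<^esub> x)"
    and "hom_kernel M (quotient_module M N) (\<lambda>x. N +>\<^bsub>M\<^esub> x) = N"
proof -
  interpret M: rmod S M by fact
  interpret N: abelian_subgroup N M
    using N by (intro abelian_subgroupI3 additive_subgroupI) (auto simp: Module.submodule_def M.M.abelian_group_axioms)
  have z: "N +>\<^bsub>M\<^esub> \<zero>\<^bsub>M\<^esub> = N" using M.M.a_coset_add_zero N.a_subset by blast
  \<comment> \<open>The union in the scalar action ranges over all representatives; they differ by
    elements of \<open>N\<close>, which \<open>s\<close> maps into \<open>N\<close>, so the union is
    a single coset.\<close>
  have s: "(\<Union>y\<in>N +>\<^bsub>M\<^esub> x. N +>\<^bsub>M\<^esub> (s \<odot>\<^bsub>M\<^esub> y)) = N +>\<^bsub>M\<^esub> (s \<odot>\<^bsub>M\<^esub> x)"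
    if x: "x \<in> carrier M" and s: "s \<in> carrier S" for s x
  proof -
    have "N +>\<^bsub>M\<^esub> (s \<odot>\<^bsub>M\<^esub> y) = N +>\<^bsub>M\<^esub> (s \<odot>\<^bsub>M\<^esub> x)" if y: "y \<in> N +>\<^bsub>M\<^esub> x" for y
    proof -
      obtain h where h: "h \<in> N" "y = h \<oplus>\<^bsub>M\<^esub> x" using y unfolding a_r_coset_def' by auto
      have hc: "h \<in> carrier M" using h N.a_subset by auto
      have "s \<odot>\<^bsub>M\<^esub> y = s \<odot>\<^bsub>M\<^esub> h \<oplus>\<^bsub>M\<^esub> s \<odot>\<^bsub>M\<^esub> x" using h hc x s M.act_radd by simp
      moreover have "s \<odot>\<^bsub>M\<^esub> h \<in> N" using N h s unfolding M.submodule_iff by auto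
      ultimately have "s \<odot>\<^bsub>M\<^esub> y \<in> N +>\<^bsub>M\<^esub> (s \<odot>\<^bsub>M\<^esub> x)" unfolding a_r_coset_def' by auto
      then show ?thesis using x s M.M.a_repr_independence N.a_subgroup by auto
    qed
    moreover have "x \<in> N +>\<^bsub>M\<^esub> x" using x N.a_rcos_self by blast
    ultimately show ?thesis by blast
  qed
  show "hom_onto S M (quotient_module M N) (\<lambda>x. N +>\<^bsub>M\<^esub> x)"
    unfolding hom_onto_def quotient_module_def
    using M.rmod_axioms z s by (auto simp: A_RCOSETS_def' N.a_rcos_sum)
  show "hom_kernel M (quotient_module M N) (\<lambda>x. N +>\<^bsub>M\<^esub> x) = N"
    unfolding hom_kernel_def quotient_module_def using N.a_subset N.a_rcos_const N.a_rcos_self by auto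
qed

text \<open>The inclusion of kernels makes the choice of preimage in the definition of
  \<open>\<phi>\<close> harmless. Factoring through a surjection replaces all explicit computations
  with cosets later on.\<close>

lemma hom_onto_factor:
  assumes f: "hom_onto S M P f" and h: "hom_onto S M Q h" and le: "hom_kernel M P f \<subseteq> hom_kernel M Q h"
  obtains \<phi> where "hom_onto S P Q \<phi>" "\<And>x. x \<in> carrier M \<Longrightarrow> \<phi> (f x) = h x"
proof -
  interpret M: rmod S M using assms unfolding hom_onto_def by blast
  define \<phi> where "\<phi> p = h (inv_into (carrier M) f p)" for p
  have e: "\<phi> (f x) = h x" if x: "x \<in> carrier M" for x
  proof -
    let ?y = "inv_into (carrier M) f (f x)"
    have y: "?y \<in> carrier M" "f ?y = f x" using x by (auto intro: inv_into_into f_inv_into_f)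
    then have "?y \<ominus>\<^bsub>M\<^esub> x \<in> hom_kernel M P f"
      unfolding hom_kernel_def using x hom_onto_eq_iff[OF f y(1) x] by auto
    then have "?y \<ominus>\<^bsub>M\<^esub> x \<in> hom_kernel M Q h" using le by auto
    then show ?thesis unfolding \<phi>_def hom_kernel_def using hom_onto_eq_iff[OF h y(1) x] by auto
  qed
  have im: "f ` carrier M = carrier P" using f unfolding hom_onto_def by auto
  have "hom_onto S P Q \<phi>"
    unfolding hom_onto_def
  proof (intro conjI ballI)
    show "rmod S P" by (rule hom_onto_rmod[OF f])
    show "\<phi> ` carrier P = carrier Q" unfolding im[symmetric] image_image using e h unfolding hom_onto_def by auto
    show "\<phi> \<zero>\<^bsub>P\<^esub> = \<zero>\<^bsub>Q\<^esub>" using e[of "\<zero>\<^bsub>M\<^esub>"] f h unfolding hom_onto_def by auto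
  next
    fix x y assume "x \<in> carrier P" "y \<in> carrier P"
    then obtain u v where uv: "u \<in> carrier M" "v \<in> carrier M" "x = f u" "y = f v" unfolding im[symmetric] by auto
    then have "x \<oplus>\<^bsub>P\<^esub> y = f (u \<oplus>\<^bsub>M\<^esub> v)" using f unfolding hom_onto_def by auto
    then show "\<phi> (x \<oplus>\<^bsub>P\<^esub> y) = \<phi> x \<oplus>\<^bsub>Q\<^esub> \<phi> y" using uv e h unfolding hom_onto_def by auto
  next
    fix s x assume "s \<in> carrier S" "x \<in> carrier P"
    then obtain u where uv: "u \<in> carrier M" "x = f u" "s \<in> carrier S" unfolding im[symmetric] by auto
    then have "s \<odot>\<^bsub>P\<^esub> x = f (s \<odot>\<^bsub>M\<^esub> u)" using f unfolding hom_onto_def by auto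
    then show "\<phi> (s \<odot>\<^bsub>P\<^esub> x) = s \<odot>\<^bsub>Q\<^esub> \<phi> x" using uv e h unfolding hom_onto_def by auto
  qed
  then show thesis using e that by blast
qed

lemma hom_onto_factor_iso:
  assumes f: "hom_onto S M P f" and h: "hom_onto S M Q h" and eq: "hom_kernel M P f = hom_kernel M Q h"
  obtains \<phi> where "hom_onto S P Q \<phi>" "inj_on \<phi> (carrier P)"
proof -
  obtain \<phi> where \<phi>: "hom_onto S P Q \<phi>" "\<And>x. x \<in> carrier M \<Longrightarrow> \<phi> (f x) = h x"
    using hom_onto_factor[OF f h] eq by blast
  interpret M: rmod S M using assms unfolding hom_onto_def by blast
  have "inj_on \<phi> (carrier P)"
  proof
    fix x y assume xy: "x \<in> carrier P" "y \<in> carrier P" "\<phi> x = \<phi> y"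
    then obtain u v where uv: "u \<in> carrier M" "v \<in> carrier M" "x = f u" "y = f v"
      using f unfolding hom_onto_def by (metis imageE)
    then have "h (u \<ominus>\<^bsub>M\<^esub> v) = \<zero>\<^bsub>Q\<^esub>" using xy \<phi>(2) hom_onto_eq_iff[OF h] by auto
    then have "u \<ominus>\<^bsub>M\<^esub> v \<in> hom_kernel M Q h" unfolding hom_kernel_def using uv by auto
    then show "x = y" using uv hom_onto_eq_iff[OF f] unfolding eq[symmetric] unfolding hom_kernel_def by auto
  qed
  then show thesis using \<phi> that by blast
qed

text \<open>Transport of structure along an injection. It moves a quotient of right ideals into the
  element type over which hypotheses (i) and (ii) quantify.\<close>

lemma hom_onto_copy:
  fixes M :: "('s, 'm, 'd) module_scheme" and j :: "'m \<Rightarrow> 'n"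
  assumes M: "rmod S M" and j: "inj_on j (carrier M)"
  obtains Q :: "('s, 'n) module" where "hom_onto S M Q j"
proof
  interpret M: rmod S M by fact
  let ?i = "inv_into (carrier M) j"
  show "hom_onto S M \<lparr>carrier = j ` carrier M, mult = undefined, one = undefined, ring.zero = j \<zero>\<^bsub>M\<^esub>,
     add = (\<lambda>x y. j (?i x \<oplus>\<^bsub>M\<^esub> ?i y)), smult = (\<lambda>s x. j (s \<odot>\<^bsub>M\<^esub> ?i x))\<rparr> j"
    unfolding hom_onto_def using M j by auto
qed

section \<open>Right ideals\<close>

definition right_ideal :: "('s, 'c) ring_scheme \<Rightarrow> 's set \<Rightarrow> bool" where
  "right_ideal S I \<longleftrightarrow> I \<subseteq> carrier S \<and> \<zero>\<^bsub>S\<^esub> \<in> I \<and> (\<forall>x\<in>I. \<forall>y\<in>I. x \<oplus>\<^bsub>S\<^esub> y \<in> I) \<and>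
     (\<forall>s\<in>carrier S. \<forall>x\<in>I. x \<otimes>\<^bsub>S\<^esub> s \<in> I)"

definition ideal_module :: "('s, 'c) ring_scheme \<Rightarrow> 's set \<Rightarrow> ('s, 's) module" where
  "ideal_module S I = (regular_module S)\<lparr>carrier := I\<rparr>"

lemma carrier_ideal_module [simp]: "carrier (ideal_module S I) = I"
  by (simp add: ideal_module_def)

lemma ideal_module_ops [simp]:
  "\<zero>\<^bsub>ideal_module S I\<^esub> = \<zero>\<^bsub>S\<^esub>" "x \<oplus>\<^bsub>ideal_module S I\<^esub> y = x \<oplus>\<^bsub>S\<^esub> y"
  "s \<odot>\<^bsub>ideal_module S I\<^esub> x = x \<otimes>\<^bsub>S\<^esub> s"
  by (simp_all add: ideal_module_def regular_module_def)

lemma ideal_module_carrier: "ideal_module S (carrier S) = regular_module S"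
  by (simp add: ideal_module_def regular_module_def)

lemma ideal_module_restrict: "(ideal_module S I)\<lparr>carrier := J\<rparr> = ideal_module S J"
  by (simp add: ideal_module_def)

context ring
begin

lemma regular_rmod: "rmod R (regular_module R)"
proof -
  have "abelian_group (regular_module R)"
    by (rule abelian_groupI) (auto simp: regular_module_def a_ac intro: l_neg)
  then show ?thesis unfolding rmod_def rmod_axioms_def
    by (auto simp: regular_module_def ring_axioms l_distr r_distr m_assoc)
qed

lemma right_ideal_iff: "is_submodule R (regular_module R) I \<longleftrightarrow> right_ideal R I"
proof -
  interpret rmod R "regular_module R" by (rule regular_rmod)
  show ?thesis unfolding submodule_iff right_ideal_def by (simp add: regular_module_def)
qed

lemma ideal_module_rmod: "right_ideal R I \<Longrightarrow> rmod R (ideal_module R I)"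
  unfolding ideal_module_def right_ideal_iff[symmetric] by (rule submodule_rmod[OF regular_rmod])

lemma submodule_ideal_module_iff:
  "right_ideal R I \<Longrightarrow> is_submodule R (ideal_module R I) J \<longleftrightarrow> right_ideal R J \<and> J \<subseteq> I"
  using submodule_restrict_iff[OF regular_rmod] unfolding ideal_module_def right_ideal_iff by blast

lemma right_ideal_carrier: "right_ideal R (carrier R)"
  unfolding right_ideal_def by auto

lemma right_ideal_minus: "right_ideal R I \<Longrightarrow> x \<in> I \<Longrightarrow> \<ominus> x \<in> I"
  unfolding right_ideal_def by (metis add.inv_closed minus_equality one_closed r_minus r_one subset_eq)

lemma right_ideal_diff: "right_ideal R I \<Longrightarrow> x \<in> I \<Longrightarrow> y \<in> I \<Longrightarrow> x \<ominus> y \<in> I"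
  using right_ideal_minus unfolding right_ideal_def minus_eq by blast

lemma right_ideal_Int: "right_ideal R I \<Longrightarrow> right_ideal R J \<Longrightarrow> right_ideal R (I \<inter> J)"
  unfolding right_ideal_def by auto

lemma right_ideal_sum:
  assumes I: "right_ideal R I" and J: "right_ideal R J"
  shows "right_ideal R (I <+>\<^bsub>R\<^esub> J)"
proof -
  have c: "I \<subseteq> carrier R" "J \<subseteq> carrier R" using assms unfolding right_ideal_def by auto
  have "I <+>\<^bsub>R\<^esub> J \<subseteq> carrier R" using c unfolding set_add_def' by auto
  moreover have "\<zero> \<in> I <+>\<^bsub>R\<^esub> J" using assms unfolding right_ideal_def set_add_def' by force
  moreover have "x \<oplus> y \<in> I <+>\<^bsub>R\<^esub> J" if xy: "x \<in> I <+>\<^bsub>R\<^esub> J" "y \<in> I <+>\<^bsub>R\<^esub> J" for x y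
  proof -
    obtain a b a' b' where *: "x = a \<oplus> b" "y = a' \<oplus> b'" "a \<in> I" "a' \<in> I" "b \<in> J" "b' \<in> J"
      using xy unfolding set_add_def' by auto
    then have "x \<oplus> y = (a \<oplus> a') \<oplus> (b \<oplus> b')" using c a_ac by (simp add: subset_eq)
    then show ?thesis using * assms unfolding right_ideal_def set_add_def' by blast
  qed
  moreover have "x \<otimes> s \<in> I <+>\<^bsub>R\<^esub> J" if xs: "x \<in> I <+>\<^bsub>R\<^esub> J" "s \<in> carrier R" for x s
  proof -
    obtain a b where *: "x = a \<oplus> b" "a \<in> I" "b \<in> J" using xs unfolding set_add_def' by auto
    then have "x \<otimes> s = a \<otimes> s \<oplus> b \<otimes> s" using c xs l_distr by (simp add: subset_eq)
    then show ?thesis using * assms xs unfolding right_ideal_def set_add_def' by blast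
  qed
  ultimately show ?thesis unfolding right_ideal_def by auto
qed

lemma right_ideal_sum_upper:
  assumes I: "right_ideal R I" and J: "right_ideal R J"
  shows "I \<subseteq> I <+>\<^bsub>R\<^esub> J" "J \<subseteq> I <+>\<^bsub>R\<^esub> J"
proof -
  have c: "I \<subseteq> carrier R" "J \<subseteq> carrier R" "\<zero> \<in> I" "\<zero> \<in> J" using assms unfolding right_ideal_def by auto
  show "I \<subseteq> I <+>\<^bsub>R\<^esub> J"
    unfolding set_add_def' using c(1,4) r_zero by (force simp: subset_eq)
  show "J \<subseteq> I <+>\<^bsub>R\<^esub> J"
    unfolding set_add_def' using c(2,3) l_zero by (force simp: subset_eq)
qed

lemma right_ideal_sum_least:
  "right_ideal R C \<Longrightarrow> I \<subseteq> C \<Longrightarrow> J \<subseteq> C \<Longrightarrow> I <+>\<^bsub>R\<^esub> J \<subseteq> C"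
  unfolding set_add_def' right_ideal_def by blast

text \<open>The nontrivial half of Dedekind's modular law: if \<open>x = b + n\<close> lies in
  \<open>A\<close>, so does \<open>n = x - b\<close>, because \<open>B\<close> is contained in
  \<open>A\<close>.\<close>

lemma right_ideal_modular:
  assumes "right_ideal R A" "right_ideal R B" "right_ideal R N" "B \<subseteq> A"
  shows "A \<inter> (B <+>\<^bsub>R\<^esub> N) \<subseteq> B <+>\<^bsub>R\<^esub> (A \<inter> N)"
proof
  fix x assume x: "x \<in> A \<inter> (B <+>\<^bsub>R\<^esub> N)"
  then obtain b n where bn: "x = b \<oplus> n" "b \<in> B" "n \<in> N" unfolding set_add_def' by auto
  have c: "b \<in> carrier R" "n \<in> carrier R" using bn assms unfolding right_ideal_def by auto
  have "n = \<ominus> b \<oplus> x" using bn c by (simp add: r_neg1 a_assoc[symmetric] l_neg)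
  moreover have "\<ominus> b \<in> A" using right_ideal_minus[OF assms(2)] bn assms(4) by auto
  ultimately have "n \<in> A" using x assms(1) unfolding right_ideal_def by auto
  then show "x \<in> B <+>\<^bsub>R\<^esub> (A \<inter> N)" using bn unfolding set_add_def' by blast
qed

definition right_ideal_gen :: "'a set \<Rightarrow> 'a set" where
  "right_ideal_gen X = \<Inter>{I. right_ideal R I \<and> X \<subseteq> I}"

lemma right_ideal_gen:
  assumes "X \<subseteq> carrier R"
  shows "right_ideal R (right_ideal_gen X)" "X \<subseteq> right_ideal_gen X"
    "\<And>I. right_ideal R I \<Longrightarrow> X \<subseteq> I \<Longrightarrow> right_ideal_gen X \<subseteq> I"
proof -
  have "carrier R \<in> {I. right_ideal R I \<and> X \<subseteq> I}" using right_ideal_carrier assms by auto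
  then have sub: "right_ideal_gen X \<subseteq> carrier R" unfolding right_ideal_gen_def by blast
  show "X \<subseteq> right_ideal_gen X" "\<And>I. right_ideal R I \<Longrightarrow> X \<subseteq> I \<Longrightarrow> right_ideal_gen X \<subseteq> I"
    unfolding right_ideal_gen_def by auto
  have *: "\<And>I. right_ideal R I \<Longrightarrow> X \<subseteq> I \<Longrightarrow> \<zero> \<in> I \<and> (\<forall>x\<in>I. \<forall>y\<in>I. x \<oplus> y \<in> I) \<and> (\<forall>s\<in>carrier R. \<forall>x\<in>I. x \<otimes> s \<in> I)"
    unfolding right_ideal_def by simp
  show "right_ideal R (right_ideal_gen X)"
    unfolding right_ideal_def using sub
    by (intro conjI ballI) (auto simp: right_ideal_gen_def *)
qed

definition fg_ideal :: "'a set \<Rightarrow> bool" where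
  "fg_ideal I \<longleftrightarrow> (\<exists>X. finite X \<and> X \<subseteq> I \<and> (\<forall>J. right_ideal R J \<and> X \<subseteq> J \<longrightarrow> I \<subseteq> J))"

lemma right_noetherian_iff:
  "right_noetherian R \<longleftrightarrow> (\<forall>I. right_ideal R I \<longrightarrow> fg_ideal I)"
proof -
  have "fg_right_module R ((regular_module R)\<lparr>carrier := I\<rparr>) \<longleftrightarrow> fg_ideal I" if I: "right_ideal R I" for I
  proof -
    have "right_module R (ideal_module R I)" using ideal_module_rmod[OF I] right_module_iff_rmod by blast
    \<comment> \<open>Generation inside \<open>I\<close> and generation tested against arbitrary
      right ideals \<open>J\<close> agree, since \<open>J\<close> may be replaced by its
      intersection with \<open>I\<close>.\<close>
    moreover have "(\<forall>N. right_ideal R N \<and> N \<subseteq> I \<and> X \<subseteq> N \<longrightarrow> N = I) \<longleftrightarrow> (\<forall>J. right_ideal R J \<and> X \<subseteq> J \<longrightarrow> I \<subseteq> J)"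
      if "X \<subseteq> I" for X
      using right_ideal_Int[OF I] that by blast
    ultimately show ?thesis
      unfolding fg_right_module_def fg_ideal_def ideal_module_def[symmetric] submodule_ideal_module_iff[OF I]
      by (simp add: conj_assoc cong: conj_cong)
  qed
  then show ?thesis unfolding right_noetherian_def right_ideal_iff by (simp add: ring_axioms)
qed

lemma fg_right_module_hom_onto:
  assumes I: "right_ideal R I" and fg: "fg_ideal I" and f: "hom_onto R (ideal_module R I) Q f"
  shows "fg_right_module R Q"
proof -
  interpret Q: rmod R Q using hom_onto_rmod[OF f] .
  obtain X where X: "finite X" "X \<subseteq> I" "\<forall>J. right_ideal R J \<and> X \<subseteq> J \<longrightarrow> I \<subseteq> J"
    using fg unfolding fg_ideal_def by (elim exE conjE)
  have im: "f ` I = carrier Q" using f unfolding hom_onto_def by auto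
  have "N = carrier Q" if N: "is_submodule R Q N" "f ` X \<subseteq> N" for N
  proof -
    have "right_ideal R {x \<in> I. f x \<in> N}"
      using hom_onto_submodule_preimage[OF f N(1)] submodule_ideal_module_iff[OF I] by simp
    moreover have "X \<subseteq> {x \<in> I. f x \<in> N}" using X(2) N(2) by auto
    ultimately have "I \<subseteq> {x \<in> I. f x \<in> N}" using X(3) by simp
    then have "carrier Q \<subseteq> N" unfolding im[symmetric] by auto
    moreover have "N \<subseteq> carrier Q" using N(1) unfolding Q.submodule_iff by (elim conjE)
    ultimately show ?thesis by simp
  qed
  then show ?thesis unfolding fg_right_module_def right_module_iff_rmod
    using Q.rmod_axioms X(1) image_mono[OF X(2), of f] im by (intro conjI exI[of _ "f ` X"]) auto
qed

text \<open>Zorn's lemma: the union of a nonempty chain is finitely generated, its generators lie in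
  one member, and so the union equals that member and is an upper bound in \<open>F\<close>.\<close>

lemma noetherian_maximal:
  assumes noeth: "right_noetherian R" and ne: "F \<noteq> {}" and F: "\<And>I. I \<in> F \<Longrightarrow> right_ideal R I"
  obtains M where "M \<in> F" "\<And>I. I \<in> F \<Longrightarrow> M \<subseteq> I \<Longrightarrow> I = M"
proof -
  have "\<exists>U\<in>F. \<forall>X\<in>C. X \<subseteq> U" if C: "C \<in> chains F" for C
  proof (cases "C = {}")
    case True then show ?thesis using ne by auto
  next
    case False
    have CF: "C \<subseteq> F" and lin: "\<And>A B. A \<in> C \<Longrightarrow> B \<in> C \<Longrightarrow> A \<subseteq> B \<or> B \<subseteq> A"
      using C unfolding chains_def chain_subset_def by auto
    have rC: "\<And>A. A \<in> C \<Longrightarrow> right_ideal R A" using CF F by auto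
    have "right_ideal R (\<Union>C)"
      unfolding right_ideal_def
    proof (intro conjI ballI)
      show "\<Union>C \<subseteq> carrier R" using rC unfolding right_ideal_def by blast
      show "\<zero> \<in> \<Union>C" using rC False unfolding right_ideal_def by blast
      fix x y assume "x \<in> \<Union>C" "y \<in> \<Union>C"
      then obtain A B where "A \<in> C" "x \<in> A" "B \<in> C" "y \<in> B" by auto
      then show "x \<oplus> y \<in> \<Union>C" using lin[of A B] rC unfolding right_ideal_def by blast
    next
      fix s x assume "s \<in> carrier R" "x \<in> \<Union>C"
      then show "x \<otimes> s \<in> \<Union>C" using rC unfolding right_ideal_def by blast
    qed
    then have "fg_ideal (\<Union>C)" using noeth unfolding right_noetherian_iff by blast
    then obtain X where X: "finite X" "X \<subseteq> \<Union>C" "\<forall>J. right_ideal R J \<and> X \<subseteq> J \<longrightarrow> \<Union>C \<subseteq> J"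
      unfolding fg_ideal_def by (elim exE conjE)
    \<comment> \<open>A finite subset of the union of a chain lies in one member, by induction on
      the subset and comparability of members.\<close>
    obtain A where A: "A \<in> C" "X \<subseteq> A"
      using X(1,2)
    proof (induction arbitrary: thesis)
      case empty then show ?case using False by auto
    next
      case (insert x X)
      obtain A where A: "A \<in> C" "X \<subseteq> A" using insert by auto
      obtain B where B: "B \<in> C" "x \<in> B" using insert by auto
      show ?case using lin[OF A(1) B(1)] A B insert.prems(1)[of A] insert.prems(1)[of B] by auto
    qed
    then have "\<Union>C \<subseteq> A" using X rC by auto
    then show ?thesis using A CF by (intro bexI[of _ A]) auto
  qed
  then have "\<forall>C\<in>chains F. \<exists>U\<in>F. \<forall>X\<in>C. X \<subseteq> U" by blast
  from Zorn_Lemma2[OF this] obtain M where M: "M \<in> F" "\<forall>X\<in>F. M \<subseteq> X \<longrightarrow> X = M" by (elim bexE)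
  show thesis by (rule that[OF M(1)]) (use M(2) in simp)
qed

end

section \<open>Spans and dimensions\<close>

text \<open>From here on, unqualified \<open>submodule\<close> is closure under scalars of the base
  field; submodules over the algebra are always written \<open>is_submodule\<close>.\<close>

lemma vs_submoduleI:
  assumes "vectorspace K A" "N \<subseteq> carrier A" "\<zero>\<^bsub>A\<^esub> \<in> N" "\<And>x y. x \<in> N \<Longrightarrow> y \<in> N \<Longrightarrow> x \<oplus>\<^bsub>A\<^esub> y \<in> N"
    "\<And>c x. c \<in> carrier K \<Longrightarrow> x \<in> N \<Longrightarrow> c \<odot>\<^bsub>A\<^esub> x \<in> N"
  shows "submodule K N A"
  using assms unfolding submodule_def vectorspace_def by auto

lemma vs_submoduleD:
  assumes "submodule K N A"
  shows "N \<subseteq> carrier A" "\<zero>\<^bsub>A\<^esub> \<in> N" "\<And>x y. x \<in> N \<Longrightarrow> y \<in> N \<Longrightarrow> x \<oplus>\<^bsub>A\<^esub> y \<in> N"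
    "\<And>c x. c \<in> carrier K \<Longrightarrow> x \<in> N \<Longrightarrow> c \<odot>\<^bsub>A\<^esub> x \<in> N"
  using assms unfolding submodule_def by auto

lemma span_facts:
  assumes "vectorspace K A" "X \<subseteq> carrier A"
  shows "submodule K (module.span K A X) A" "X \<subseteq> module.span K A X"
    "\<And>N. submodule K N A \<Longrightarrow> X \<subseteq> N \<Longrightarrow> module.span K A X \<subseteq> N"
    "subspace K (module.span K A X) A"
proof -
  interpret vectorspace K A by fact
  show "submodule K (span X) A" "X \<subseteq> span X" "\<And>N. submodule K N A \<Longrightarrow> X \<subseteq> N \<Longrightarrow> span X \<subseteq> N"
    "subspace K (span X) A"
    using span_is_submodule[OF assms(2)] in_own_span[OF assms(2)] span_is_subset span_is_subspace[OF assms(2)] by auto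
qed

lemma vs_submodule_preimage:
  assumes A: "vectorspace K A" and B: "vectorspace K B" and N: "submodule K N B"
    and f: "\<And>x. x \<in> carrier A \<Longrightarrow> f x \<in> carrier B"
      "\<And>x y. x \<in> carrier A \<Longrightarrow> y \<in> carrier A \<Longrightarrow> f (x \<oplus>\<^bsub>A\<^esub> y) = f x \<oplus>\<^bsub>B\<^esub> f y"
      "\<And>c x. c \<in> carrier K \<Longrightarrow> x \<in> carrier A \<Longrightarrow> f (c \<odot>\<^bsub>A\<^esub> x) = c \<odot>\<^bsub>B\<^esub> f x"
  shows "submodule K {x \<in> carrier A. f x \<in> N} A"
proof -
  interpret A: vectorspace K A by fact
  interpret B: vectorspace K B by fact
  have "f \<zero>\<^bsub>A\<^esub> = \<zero>\<^bsub>B\<^esub>"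
  proof -
    have "f (\<zero>\<^bsub>K\<^esub> \<odot>\<^bsub>A\<^esub> \<zero>\<^bsub>A\<^esub>) = \<zero>\<^bsub>K\<^esub> \<odot>\<^bsub>B\<^esub> f \<zero>\<^bsub>A\<^esub>" using f(3)[of "\<zero>\<^bsub>K\<^esub>" "\<zero>\<^bsub>A\<^esub>"] by simp
    then show ?thesis using f(1)[of "\<zero>\<^bsub>A\<^esub>"] by simp
  qed
  then show ?thesis
    by (intro vs_submoduleI A) (auto simp: f vs_submoduleD[OF N])
qed

lemma vs_submodule_image:
  assumes A: "vectorspace K A" and B: "vectorspace K B" and N: "submodule K N A"
    and f: "\<And>x. x \<in> carrier A \<Longrightarrow> f x \<in> carrier B"
      "\<And>x y. x \<in> carrier A \<Longrightarrow> y \<in> carrier A \<Longrightarrow> f (x \<oplus>\<^bsub>A\<^esub> y) = f x \<oplus>\<^bsub>B\<^esub> f y"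
      "\<And>c x. c \<in> carrier K \<Longrightarrow> x \<in> carrier A \<Longrightarrow> f (c \<odot>\<^bsub>A\<^esub> x) = c \<odot>\<^bsub>B\<^esub> f x"
  shows "submodule K (f ` N) B"
proof -
  interpret A: vectorspace K A by fact
  interpret B: vectorspace K B by fact
  have c: "\<And>x. x \<in> N \<Longrightarrow> x \<in> carrier A" using vs_submoduleD(1)[OF N] by auto
  have z: "f \<zero>\<^bsub>A\<^esub> = \<zero>\<^bsub>B\<^esub>"
  proof -
    have "f (\<zero>\<^bsub>K\<^esub> \<odot>\<^bsub>A\<^esub> \<zero>\<^bsub>A\<^esub>) = \<zero>\<^bsub>K\<^esub> \<odot>\<^bsub>B\<^esub> f \<zero>\<^bsub>A\<^esub>" using f(3)[of "\<zero>\<^bsub>K\<^esub>" "\<zero>\<^bsub>A\<^esub>"] by simp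
    then show ?thesis using f(1)[of "\<zero>\<^bsub>A\<^esub>"] by simp
  qed
  show ?thesis
  proof (rule vs_submoduleI[OF B])
    show "f ` N \<subseteq> carrier B" using c f by auto
    show "\<zero>\<^bsub>B\<^esub> \<in> f ` N" using z vs_submoduleD(2)[OF N] by (metis imageI)
    show "x \<oplus>\<^bsub>B\<^esub> y \<in> f ` N" if "x \<in> f ` N" "y \<in> f ` N" for x y
      using that f(2)[symmetric] c vs_submoduleD(3)[OF N] by auto
    show "a \<odot>\<^bsub>B\<^esub> x \<in> f ` N" if "a \<in> carrier K" "x \<in> f ` N" for a x
      using that f(3)[symmetric] c vs_submoduleD(4)[OF N] by auto
  qed
qed

lemma span_image:
  assumes A: "vectorspace K A" and B: "vectorspace K B" and X: "X \<subseteq> carrier A"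
    and f: "\<And>x. x \<in> carrier A \<Longrightarrow> f x \<in> carrier B"
      "\<And>x y. x \<in> carrier A \<Longrightarrow> y \<in> carrier A \<Longrightarrow> f (x \<oplus>\<^bsub>A\<^esub> y) = f x \<oplus>\<^bsub>B\<^esub> f y"
      "\<And>c x. c \<in> carrier K \<Longrightarrow> x \<in> carrier A \<Longrightarrow> f (c \<odot>\<^bsub>A\<^esub> x) = c \<odot>\<^bsub>B\<^esub> f x"
  shows "f ` module.span K A X = module.span K B (f ` X)"
proof
  have fX: "f ` X \<subseteq> carrier B" using X f by auto
  show "module.span K B (f ` X) \<subseteq> f ` module.span K A X"
    using span_facts[OF A X] vs_submodule_image[OF A B _ f, of "module.span K A X"]
    by (intro span_facts(3)[OF B fX]) auto
  have "module.span K A X \<subseteq> {x \<in> carrier A. f x \<in> module.span K B (f ` X)}"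
    using X span_facts(1,2)[OF B fX] vs_submodule_preimage[OF A B _ f, of "module.span K B (f ` X)"]
    by (intro span_facts(3)[OF A X]) auto
  then show "f ` module.span K A X \<subseteq> module.span K B (f ` X)" by auto
qed

lemma subspace_gen_set_iff:
  assumes A: "vectorspace K A" and U: "subspace K U A" and X: "X \<subseteq> U"
  shows "module.span K (A\<lparr>carrier := U\<rparr>) X = module.span K A X"
proof -
  interpret vectorspace K A by fact
  show ?thesis using span_li_not_depend(1)[OF X is_module[OF U]] by simp
qed

lemma fd_subspace_iff:
  assumes A: "vectorspace K A"
  shows "fd_subspace K A U \<longleftrightarrow> subspace K U A \<and> (\<exists>X. finite X \<and> X \<subseteq> U \<and> module.span K A X = U)"
proof -
  interpret A: vectorspace K A by fact
  have "vectorspace.fin_dim K (A\<lparr>carrier := U\<rparr>) \<longleftrightarrow> (\<exists>X. finite X \<and> X \<subseteq> U \<and> module.span K A X = U)" if U: "subspace K U A"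
  proof -
    interpret U: vectorspace K "A\<lparr>carrier := U\<rparr>" using A.subspace_is_vs[OF U] .
    show ?thesis unfolding U.fin_dim_def using subspace_gen_set_iff[OF A U] by auto
  qed
  then show ?thesis unfolding fd_subspace_def by auto
qed

text \<open>Expressing the dimension by spans in the ambient space lets it be compared along an
  isomorphism, by matching generating sets.\<close>

lemma subspace_dim_eq:
  assumes A: "vectorspace K A" and U: "subspace K U A"
  shows "subspace_dim K A U = (LEAST n. \<exists>X. finite X \<and> card X = n \<and> X \<subseteq> U \<and> module.span K A X = U)"
proof -
  interpret A: vectorspace K A by fact
  interpret U: vectorspace K "A\<lparr>carrier := U\<rparr>" using A.subspace_is_vs[OF U] .
  have "(finite X \<and> card X = n \<and> X \<subseteq> carrier (A\<lparr>carrier := U\<rparr>) \<and> U.span X = carrier (A\<lparr>carrier := U\<rparr>)) \<longleftrightarrow>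
    (finite X \<and> card X = n \<and> X \<subseteq> U \<and> module.span K A X = U)" for X n
    using subspace_gen_set_iff[OF A U] by auto
  then show ?thesis unfolding subspace_dim_def U.dim_def by simp
qed

text \<open>Steinitz exchange inside the span of \<open>X\<close>: independent subsets of
  \<open>U\<close> have at most \<open>card X\<close> elements, so a maximal one exists and is a
  basis. That \<open>U\<close> is finite dimensional is part of the conclusion.\<close>

lemma fd_subspace_within:
  assumes A: "vectorspace K A" and U: "subspace K U A" and X: "finite X" "X \<subseteq> carrier A" "U \<subseteq> module.span K A X"
  shows "fd_subspace K A U" "subspace_dim K A U \<le> card X"
proof -
  interpret A: vectorspace K A by fact
  interpret U: vectorspace K "A\<lparr>carrier := U\<rparr>" using A.subspace_is_vs[OF U] .
  let ?P = "\<lambda>S. S \<subseteq> carrier (A\<lparr>carrier := U\<rparr>) \<and> U.lin_indpt S"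
  have fin: "finite S \<and> card S \<le> card X" if S: "?P S" for S
  proof -
    have bd: "card T \<le> card X" if T: "finite T" "T \<subseteq> S" for T
    proof -
      have "T \<subseteq> U" using T S by auto
      have li: "A.lin_indpt T"
        using U.subset_li_is_li[of S T] S T A.span_li_not_depend(2)[OF \<open>T \<subseteq> U\<close> A.is_module[OF U]] by auto
      have ts: "T \<subseteq> A.span X" using \<open>T \<subseteq> U\<close> X by auto
      obtain C where "C \<subseteq> carrier A" "int (card C) \<le> int (card X) - int (card T)"
        using A.replacement[OF T(1) X(1,2) li ts] by auto
      then show ?thesis by linarith
    qed
    \<comment> \<open>An infinite independent set would contain an independent set with one element
      more than \<open>X\<close>.\<close>
    have "finite S"
    proof (rule ccontr)
      assume "infinite S"
      then obtain T where "finite T" "T \<subseteq> S" "card T = Suc (card X)" by (meson infinite_arbitrarily_large)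
      then show False using bd[of T] by auto
    qed
    then show ?thesis using bd by auto
  qed
  have "?P {}" using U.finite_lin_indpt2[of "{}"] by auto
  from maximal_exists[of ?P, OF fin this] obtain \<beta> where \<beta>: "finite \<beta>" "maximal \<beta> ?P" by blast
  then have bas: "U.basis \<beta>" using U.max_li_is_basis by blast
  have "?P \<beta>" using \<beta> unfolding maximal_def by blast
  then have card: "card \<beta> \<le> card X" using fin by auto
  have "U.fin_dim" using bas \<beta> unfolding U.fin_dim_def U.basis_def by blast
  then show "fd_subspace K A U" using U unfolding fd_subspace_def by auto
  show "subspace_dim K A U \<le> card X"
    using U.dim_basis[OF \<beta>(1) bas] card unfolding subspace_dim_def by simp
qed

lemma subspace_dim_attained:
  assumes A: "vectorspace K A" and U: "fd_subspace K A U"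
  obtains X where "finite X" "X \<subseteq> U" "module.span K A X = U" "card X = subspace_dim K A U"
proof -
  have sub: "subspace K U A" and "\<exists>n X. finite X \<and> card X = n \<and> X \<subseteq> U \<and> module.span K A X = U"
    using U fd_subspace_iff[OF A] by auto
  from LeastI_ex[OF this(2)] show thesis using that unfolding subspace_dim_eq[OF A sub] by blast
qed

lemma subspace_dim_pos:
  assumes A: "vectorspace K A" and U: "fd_subspace K A U" and x: "x \<in> U" "x \<noteq> \<zero>\<^bsub>A\<^esub>"
  shows "0 < subspace_dim K A U"
proof (rule ccontr)
  interpret A: vectorspace K A by fact
  obtain X where X: "finite X" "X \<subseteq> U" "module.span K A X = U" "card X = subspace_dim K A U"
    using subspace_dim_attained[OF A U] .
  assume "\<not> 0 < subspace_dim K A U"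
  then have "X = {}" using X by auto
  moreover have "submodule K {\<zero>\<^bsub>A\<^esub>} A" by (intro vs_submoduleI A) auto
  ultimately have "U \<subseteq> {\<zero>\<^bsub>A\<^esub>}" using span_facts(3)[OF A, of "{}" "{\<zero>\<^bsub>A\<^esub>}"] X by auto
  then show False using x by auto
qed

section \<open>Gelfand-Kirillov dimension of modules\<close>

lemma restrict_scalars_vectorspace:
  assumes "assoc_algebra L S" "rmod S Q"
  shows "vectorspace L (restrict_scalars S Q)"
proof -
  interpret S: vectorspace L S using assms unfolding assoc_algebra_def by auto
  interpret Q: rmod S Q by fact
  have sm: "\<And>c x y. c \<in> carrier L \<Longrightarrow> x \<in> carrier S \<Longrightarrow> y \<in> carrier S \<Longrightarrow> (c \<odot>\<^bsub>S\<^esub> x) \<otimes>\<^bsub>S\<^esub> y = c \<odot>\<^bsub>S\<^esub> (x \<otimes>\<^bsub>S\<^esub> y)"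
    "\<And>c x y. c \<in> carrier L \<Longrightarrow> x \<in> carrier S \<Longrightarrow> y \<in> carrier S \<Longrightarrow> x \<otimes>\<^bsub>S\<^esub> (c \<odot>\<^bsub>S\<^esub> y) = c \<odot>\<^bsub>S\<^esub> (x \<otimes>\<^bsub>S\<^esub> y)"
    using assms unfolding assoc_algebra_def by auto
  have c: "\<And>a. a \<in> carrier L \<Longrightarrow> a \<odot>\<^bsub>S\<^esub> \<one>\<^bsub>S\<^esub> \<in> carrier S" by simp
  show ?thesis
  proof (rule vs_criteria)
    show "field L" by unfold_locales
    \<comment> \<open>The right action reverses products, so compatibility with the multiplication
      of \<open>L\<close> needs that scalars commute.\<close>
    have "(a \<otimes>\<^bsub>L\<^esub> b) \<odot>\<^bsub>S\<^esub> \<one>\<^bsub>S\<^esub> = (b \<odot>\<^bsub>S\<^esub> \<one>\<^bsub>S\<^esub>) \<otimes>\<^bsub>S\<^esub> (a \<odot>\<^bsub>S\<^esub> \<one>\<^bsub>S\<^esub>)" if "a \<in> carrier L" "b \<in> carrier L" for a b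
      using that sm(1)[of b "\<one>\<^bsub>S\<^esub>" "a \<odot>\<^bsub>S\<^esub> \<one>\<^bsub>S\<^esub>"] S.smult_assoc1[of b a "\<one>\<^bsub>S\<^esub>"] by (simp add: S.R.m_comm)
    then show "\<forall>a b v. a \<in> carrier L \<and> b \<in> carrier L \<and> v \<in> carrier (restrict_scalars S Q) \<longrightarrow>
       (a \<otimes>\<^bsub>L\<^esub> b) \<odot>\<^bsub>restrict_scalars S Q\<^esub> v = a \<odot>\<^bsub>restrict_scalars S Q\<^esub> (b \<odot>\<^bsub>restrict_scalars S Q\<^esub> v)"
      by (auto simp: restrict_scalars_def Q.act_mult c)
    show "\<forall>v\<in>carrier (restrict_scalars S Q). \<exists>neg_v\<in>carrier (restrict_scalars S Q).
      v \<oplus>\<^bsub>restrict_scalars S Q\<^esub> neg_v = \<zero>\<^bsub>restrict_scalars S Q\<^esub>"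
      using Q.M.r_neg Q.M.a_inv_closed by (auto simp: restrict_scalars_def)
  qed (auto simp: restrict_scalars_def Q.M.a_ac Q.act_radd Q.act_ladd[symmetric] S.smult_l_distr c)
qed

lemma restrict_scalars_simps [simp]:
  "carrier (restrict_scalars S M) = carrier M" "\<zero>\<^bsub>restrict_scalars S M\<^esub> = \<zero>\<^bsub>M\<^esub>"
  "x \<oplus>\<^bsub>restrict_scalars S M\<^esub> y = x \<oplus>\<^bsub>M\<^esub> y"
  by (simp_all add: restrict_scalars_def)

lemma hom_onto_restrict_scalars:
  assumes S: "assoc_algebra L S" and f: "hom_onto S M Q f"
  shows "\<And>x. x \<in> carrier (restrict_scalars S M) \<Longrightarrow> f x \<in> carrier (restrict_scalars S Q)"
    "\<And>x y. x \<in> carrier (restrict_scalars S M) \<Longrightarrow> y \<in> carrier (restrict_scalars S M) \<Longrightarrow>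
      f (x \<oplus>\<^bsub>restrict_scalars S M\<^esub> y) = f x \<oplus>\<^bsub>restrict_scalars S Q\<^esub> f y"
    "\<And>c x. c \<in> carrier L \<Longrightarrow> x \<in> carrier (restrict_scalars S M) \<Longrightarrow>
      f (c \<odot>\<^bsub>restrict_scalars S M\<^esub> x) = c \<odot>\<^bsub>restrict_scalars S Q\<^esub> f x"
proof -
  interpret S: vectorspace L S using S unfolding assoc_algebra_def by auto
  interpret M: rmod S M using f unfolding hom_onto_def by auto
  have "\<And>a. a \<in> carrier L \<Longrightarrow> a \<odot>\<^bsub>S\<^esub> \<one>\<^bsub>S\<^esub> \<in> carrier S" by simp
  then show "\<And>x. x \<in> carrier (restrict_scalars S M) \<Longrightarrow> f x \<in> carrier (restrict_scalars S Q)"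
    "\<And>x y. x \<in> carrier (restrict_scalars S M) \<Longrightarrow> y \<in> carrier (restrict_scalars S M) \<Longrightarrow>
      f (x \<oplus>\<^bsub>restrict_scalars S M\<^esub> y) = f x \<oplus>\<^bsub>restrict_scalars S Q\<^esub> f y"
    "\<And>c x. c \<in> carrier L \<Longrightarrow> x \<in> carrier (restrict_scalars S M) \<Longrightarrow>
      f (c \<odot>\<^bsub>restrict_scalars S M\<^esub> x) = c \<odot>\<^bsub>restrict_scalars S Q\<^esub> f x"
    using f unfolding hom_onto_def by (auto simp: restrict_scalars_def)
qed

text \<open>This is the subspace usually written \<open>W V^n\<close>.\<close>

definition module_growth ::
  "('a, 'c) ring_scheme \<Rightarrow> ('a, 's, 'd) module_scheme \<Rightarrow> ('s, 'm, 'e) module_scheme \<Rightarrow> 'm set \<Rightarrow> 's set \<Rightarrow> nat \<Rightarrow> 'm set" where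
  "module_growth L S M W V n = module.span L (restrict_scalars S M) {v \<odot>\<^bsub>M\<^esub> w | v w. v \<in> subspace_power L S V n \<and> w \<in> W}"

lemma GKdim_alt:
  "GKdim L S M = (if carrier M = {\<zero>\<^bsub>M\<^esub>} then - 1 else
     (SUP (W, V) \<in> {W. fd_subspace L (restrict_scalars S M) W} \<times> {V. fd_subspace L S V}.
        growth_exponent (\<lambda>n. subspace_dim L (restrict_scalars S M) (module_growth L S M W V n))))"
  unfolding GKdim_def module_growth_def ..

lemma subspace_power_submodule:
  assumes S: "assoc_algebra L S" and V: "V \<subseteq> carrier S"
  shows "submodule L (subspace_power L S V n) S"
proof (induction n)
  interpret S: vectorspace L S using S unfolding assoc_algebra_def by auto
  interpret SR: ring S using S unfolding assoc_algebra_def by auto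
  case 0 show ?case using span_facts(1)[OF S.vectorspace_axioms, of "{\<one>\<^bsub>S\<^esub>}"] by simp
next
  interpret S: vectorspace L S using S unfolding assoc_algebra_def by auto
  interpret SR: ring S using S unfolding assoc_algebra_def by auto
  case (Suc n)
  have "{x \<otimes>\<^bsub>S\<^esub> v |x v. x \<in> subspace_power L S V n \<and> v \<in> V} \<subseteq> carrier S"
    using vs_submoduleD(1)[OF Suc] V by auto
  then show ?case using span_facts(1)[OF S.vectorspace_axioms] by simp
qed

lemma module_growth_products:
  assumes S: "assoc_algebra L S" and M: "rmod S M" and V: "V \<subseteq> carrier S" and W: "W \<subseteq> carrier M"
  shows "{v \<odot>\<^bsub>M\<^esub> w | v w. v \<in> subspace_power L S V n \<and> w \<in> W} \<subseteq> carrier (restrict_scalars S M)"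
proof -
  interpret M: rmod S M by fact
  show ?thesis using vs_submoduleD(1)[OF subspace_power_submodule[OF S V]] W by auto
qed

lemma GKdim_iso_le:
  assumes S: "assoc_algebra L S" and f: "hom_onto S M Q f" and inj: "inj_on f (carrier M)"
  shows "GKdim L S M \<le> GKdim L S Q"
proof -
  interpret M: rmod S M using f unfolding hom_onto_def by auto
  interpret Q: rmod S Q using hom_onto_rmod[OF f] .
  note hom = hom_onto_restrict_scalars[OF S f]
  let ?A = "restrict_scalars S M" and ?B = "restrict_scalars S Q"
  have A: "vectorspace L ?A" and B: "vectorspace L ?B"
    using restrict_scalars_vectorspace[OF S] M.rmod_axioms Q.rmod_axioms by auto
  have im: "f ` carrier M = carrier Q" and z: "f \<zero>\<^bsub>M\<^esub> = \<zero>\<^bsub>Q\<^esub>" using f unfolding hom_onto_def by auto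
  have span: "f ` module.span L ?A X = module.span L ?B (f ` X)" if "X \<subseteq> carrier M" for X
    by (rule span_image[OF A B]) (use that hom in auto)
  have sub: "subspace L (f ` U) ?B" if "subspace L U ?A" for U
    using vs_submodule_image[OF A B _ hom, of U] that B unfolding subspace_def by auto
  have subc: "U \<subseteq> carrier M" if "subspace L U ?A" for U
    using that vs_submoduleD(1)[of L U ?A] unfolding subspace_def by auto
  \<comment> \<open>Generating sets of given size correspond under \<open>f\<close>. This yields
    both that dimensions agree and that finite dimensionality is preserved.\<close>
  have gen: "(\<exists>X. finite X \<and> card X = n \<and> X \<subseteq> U \<and> module.span L ?A X = U) \<longleftrightarrow>
     (\<exists>Y. finite Y \<and> card Y = n \<and> Y \<subseteq> f ` U \<and> module.span L ?B Y = f ` U)" if U: "subspace L U ?A" for U n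
  proof
    assume "\<exists>X. finite X \<and> card X = n \<and> X \<subseteq> U \<and> module.span L ?A X = U"
    then obtain X where X: "finite X" "card X = n" "X \<subseteq> U" "module.span L ?A X = U" by auto
    have "inj_on f X" using inj subc[OF U] X by (meson inj_on_subset)
    then have "card (f ` X) = n" using X card_image by auto
    moreover have "module.span L ?B (f ` X) = f ` U" using span[of X] X subc[OF U] by auto
    ultimately show "\<exists>Y. finite Y \<and> card Y = n \<and> Y \<subseteq> f ` U \<and> module.span L ?B Y = f ` U"
      using X by (intro exI[of _ "f ` X"]) auto
  next
    assume "\<exists>Y. finite Y \<and> card Y = n \<and> Y \<subseteq> f ` U \<and> module.span L ?B Y = f ` U"
    then obtain Y where Y: "finite Y" "card Y = n" "Y \<subseteq> f ` U" "module.span L ?B Y = f ` U" by auto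
    then obtain X where X: "X \<subseteq> U" "finite X" "Y = f ` X" by (metis finite_subset_image)
    have injX: "inj_on f X" using inj subc[OF U] X by (meson inj_on_subset order_trans)
    have sp: "module.span L ?A X \<subseteq> carrier M" using span_facts(1)[OF A, of X] X subc[OF U] vs_submoduleD(1) by fastforce
    have "f ` module.span L ?A X = f ` U" using span[of X] X Y subc[OF U] by auto
    then have "module.span L ?A X = U" using inj_on_image_eq_iff[OF inj sp subc[OF U]] by auto
    then show "\<exists>X. finite X \<and> card X = n \<and> X \<subseteq> U \<and> module.span L ?A X = U"
      using X Y card_image[OF injX] by auto
  qed
  have dim: "subspace_dim L ?A U = subspace_dim L ?B (f ` U)" if U: "subspace L U ?A" for U
    unfolding subspace_dim_eq[OF A U] subspace_dim_eq[OF B sub[OF U]] gen[OF U] ..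
  have fd: "fd_subspace L ?B (f ` U)" if "fd_subspace L ?A U" for U
  proof -
    obtain X where U: "subspace L U ?A" and "finite X" "X \<subseteq> U" "module.span L ?A X = U"
      using \<open>fd_subspace L ?A U\<close> unfolding fd_subspace_iff[OF A] by (elim conjE exE)
    then have "\<exists>X. finite X \<and> card X = card X \<and> X \<subseteq> U \<and> module.span L ?A X = U" by auto
    then obtain n where "\<exists>X. finite X \<and> card X = n \<and> X \<subseteq> U \<and> module.span L ?A X = U" by auto
    then obtain Y where "finite Y \<and> card Y = n \<and> Y \<subseteq> f ` U \<and> module.span L ?B Y = f ` U"
      unfolding gen[OF U] by (elim exE)
    then show ?thesis unfolding fd_subspace_iff[OF B] using sub[OF U] by auto
  qed
  have gr: "subspace_dim L ?A (module_growth L S M W V n) = subspace_dim L ?B (module_growth L S Q (f ` W) V n)"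
    if V: "V \<subseteq> carrier S" and W: "W \<subseteq> carrier M" for V W n
  proof -
    let ?X = "{v \<odot>\<^bsub>M\<^esub> w | v w. v \<in> subspace_power L S V n \<and> w \<in> W}"
    have X: "?X \<subseteq> carrier ?A" using module_growth_products[OF S M.rmod_axioms V W] .
    have fv: "f (v \<odot>\<^bsub>M\<^esub> w) = v \<odot>\<^bsub>Q\<^esub> f w" if "v \<in> subspace_power L S V n" "w \<in> W" for v w
    proof -
      have "v \<in> carrier S" "w \<in> carrier M" using that W vs_submoduleD(1)[OF subspace_power_submodule[OF S V, of n]] by auto
      then show ?thesis using f unfolding hom_onto_def by auto
    qed
    have "f ` ?X = {v \<odot>\<^bsub>Q\<^esub> w | v w. v \<in> subspace_power L S V n \<and> w \<in> f ` W}"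
    proof (intro equalityI subsetI)
      fix y assume "y \<in> {v \<odot>\<^bsub>Q\<^esub> w | v w. v \<in> subspace_power L S V n \<and> w \<in> f ` W}"
      then obtain v w where vw: "y = v \<odot>\<^bsub>Q\<^esub> f w" "v \<in> subspace_power L S V n" "w \<in> W" by blast
      then have "y = f (v \<odot>\<^bsub>M\<^esub> w)" "v \<odot>\<^bsub>M\<^esub> w \<in> ?X" using fv by auto
      then show "y \<in> f ` ?X" by (rule image_eqI)
    next
      fix y assume "y \<in> f ` ?X"
      then obtain v w where vw: "y = f (v \<odot>\<^bsub>M\<^esub> w)" "v \<in> subspace_power L S V n" "w \<in> W" by blast
      then have "y = v \<odot>\<^bsub>Q\<^esub> f w" "f w \<in> f ` W" using fv by auto
      then show "y \<in> {v \<odot>\<^bsub>Q\<^esub> w | v w. v \<in> subspace_power L S V n \<and> w \<in> f ` W}" using vw(2) by blast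
    qed
    then have "f ` module_growth L S M W V n = module_growth L S Q (f ` W) V n"
      unfolding module_growth_def using span[of ?X] X by simp
    then show ?thesis using dim[of "module_growth L S M W V n"] span_facts(4)[OF A X] unfolding module_growth_def by simp
  qed
  have triv: "carrier M = {\<zero>\<^bsub>M\<^esub>} \<longleftrightarrow> carrier Q = {\<zero>\<^bsub>Q\<^esub>}"
  proof
    assume "carrier Q = {\<zero>\<^bsub>Q\<^esub>}"
    then have "\<And>x. x \<in> carrier M \<Longrightarrow> f x = f \<zero>\<^bsub>M\<^esub>" using im z by auto
    then show "carrier M = {\<zero>\<^bsub>M\<^esub>}" using inj_onD[OF inj] M.M.zero_closed by blast
  qed (use im z in auto)
  show ?thesis
  proof (cases "carrier M = {\<zero>\<^bsub>M\<^esub>}")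
    case False
    have "\<exists>WV'\<in>{W. fd_subspace L ?B W} \<times> {V. fd_subspace L S V}.
       (case WV of (W, V) \<Rightarrow> growth_exponent (\<lambda>n. subspace_dim L ?A (module_growth L S M W V n)))
       \<le> (case WV' of (W, V) \<Rightarrow> growth_exponent (\<lambda>n. subspace_dim L ?B (module_growth L S Q W V n)))"
      if WV: "WV \<in> {W. fd_subspace L ?A W} \<times> {V. fd_subspace L S V}" for WV
    proof -
      obtain W V where *: "WV = (W, V)" "fd_subspace L ?A W" "fd_subspace L S V" using WV by auto
      have "V \<subseteq> carrier S" "W \<subseteq> carrier M"
        using * vs_submoduleD(1)[of L V S] subc unfolding fd_subspace_def subspace_def by auto
      then show ?thesis using * fd gr by (intro bexI[of _ "(f ` W, V)"]) auto
    qed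
    from SUP_mono[OF this] show ?thesis using False triv unfolding GKdim_alt by simp
  qed (use triv in \<open>simp add: GKdim_def\<close>)
qed

lemma hom_onto_cong:
  assumes f: "hom_onto S M Q f" and eq: "\<And>x. x \<in> carrier M \<Longrightarrow> f x = h x"
  shows "hom_onto S M Q h"
proof -
  interpret rmod S M using f unfolding hom_onto_def by auto
  have "h ` carrier M = f ` carrier M" using eq by (intro image_cong) auto
  then show ?thesis using f unfolding hom_onto_def by (simp add: eq[symmetric])
qed

lemma hom_onto_inverse:
  assumes f: "hom_onto S M Q f" and inj: "inj_on f (carrier M)"
  shows "hom_onto S Q M (inv_into (carrier M) f)" "inj_on (inv_into (carrier M) f) (carrier Q)"
proof -
  have im: "f ` carrier M = carrier Q" and rm: "rmod S M" using f unfolding hom_onto_def by auto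
  interpret M: rmod S M by fact
  have z: "f \<zero>\<^bsub>M\<^esub> = \<zero>\<^bsub>Q\<^esub>" using f unfolding hom_onto_def by auto
  have "hom_kernel M Q f \<subseteq> {\<zero>\<^bsub>M\<^esub>}"
  proof
    fix x assume "x \<in> hom_kernel M Q f"
    then have "x \<in> carrier M" "f x = f \<zero>\<^bsub>M\<^esub>" using z unfolding hom_kernel_def by auto
    then show "x \<in> {\<zero>\<^bsub>M\<^esub>}" using inj_onD[OF inj] by auto
  qed
  then have "hom_kernel M Q f = {\<zero>\<^bsub>M\<^esub>}" using z unfolding hom_kernel_def by auto
  then have k: "hom_kernel M Q f \<subseteq> hom_kernel M M (\<lambda>x. x)" unfolding hom_kernel_def by auto
  have "hom_onto S M M (\<lambda>x. x)" using rm unfolding hom_onto_def by auto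
  from hom_onto_factor[OF f this k] obtain \<phi> where \<phi>: "hom_onto S Q M \<phi>" "\<And>x. x \<in> carrier M \<Longrightarrow> \<phi> (f x) = x" by blast
  have eq: "\<phi> y = inv_into (carrier M) f y" if "y \<in> carrier Q" for y
    using \<phi>(2)[OF inv_into_into[of y f "carrier M"]] f_inv_into_f[of y f "carrier M"] that im by simp
  interpret Q: rmod S Q using hom_onto_rmod[OF f] .
  show "hom_onto S Q M (inv_into (carrier M) f)"
    using hom_onto_cong[OF \<phi>(1) eq] .
  show "inj_on (inv_into (carrier M) f) (carrier Q)" using inj_on_inv_into im by (metis order_refl)
qed

lemma GKdim_iso:
  assumes "assoc_algebra L S" "hom_onto S M Q f" "inj_on f (carrier M)"
  shows "GKdim L S M = GKdim L S Q"
  using GKdim_iso_le[OF assms] GKdim_iso_le[OF assms(1) hom_onto_inverse[OF assms(2,3)]] by (rule antisym)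

definition GKdim_factor :: "('a, 'c) ring_scheme \<Rightarrow> ('a, 's, 'd) module_scheme \<Rightarrow> 's set \<Rightarrow> 's set \<Rightarrow> ereal" where
  "GKdim_factor L S X Y = GKdim L S (quotient_module (ideal_module S X) Y)"

text \<open>Surjections from \<open>X\<close> with equal kernels have isomorphic targets, so the
  dimension depends only on a pair of right ideals. From here on modules can be forgotten in favour
  of such pairs.\<close>

lemma GKdim_factor_eq:
  assumes S: "assoc_algebra L S" and X: "right_ideal S X" and f: "hom_onto S (ideal_module S X) Q f"
  shows "GKdim L S Q = GKdim_factor L S X (hom_kernel (ideal_module S X) Q f)"
proof -
  interpret S: ring S using S unfolding assoc_algebra_def by auto
  note q = quotient_module_hom_onto[OF S.ideal_module_rmod[OF X] hom_kernel_submodule[OF f]]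
  obtain \<phi> where "hom_onto S Q (quotient_module (ideal_module S X) (hom_kernel (ideal_module S X) Q f)) \<phi>"
    "inj_on \<phi> (carrier Q)"
    using hom_onto_factor_iso[OF f q(1)] q(2) by metis
  then show ?thesis unfolding GKdim_factor_def using GKdim_iso[OF S] by blast
qed

lemma GKdim_zero: "carrier M = {\<zero>\<^bsub>M\<^esub>} \<Longrightarrow> GKdim L S M = -1"
  unfolding GKdim_def by simp

lemma growth_exponent_nonneg:
  assumes "\<And>n. 0 < d n" shows "0 \<le> growth_exponent d"
  unfolding growth_exponent_def
proof -
  have "\<forall>\<^sub>F n in sequentially. 0 \<le> (if d n = 0 then - \<infinity> else ereal (log (real n) (real (d n))))"
    using eventually_ge_at_top[of 2]
  proof eventually_elim
    case (elim n)
    have "1 \<le> d n" using assms[of n] by linarith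
    then show ?case using elim by simp
  qed
  then have "0 \<le> liminf (\<lambda>n. if d n = 0 then - \<infinity> else ereal (log (real n) (real (d n))))"
    by (rule Liminf_bounded)
  also have "\<dots> \<le> limsup (\<lambda>n. if d n = 0 then - \<infinity> else ereal (log (real n) (real (d n))))"
    by (rule Liminf_le_Limsup) simp
  finally show "0 \<le> limsup (\<lambda>n. if d n = 0 then - \<infinity> else ereal (log (real n) (real (d n))))" .
qed

text \<open>For a nonzero vector \<open>q\<close>, the choice \<open>V = L 1\<close> and
  \<open>W = L q\<close> keeps \<open>W V^n\<close> equal to the line \<open>L q\<close>. A positive
  dimension for all \<open>n\<close> gives a nonnegative growth exponent.\<close>

lemma GKdim_nonneg:
  assumes S: "assoc_algebra L S" and Q: "rmod S Q" and nz: "carrier Q \<noteq> {\<zero>\<^bsub>Q\<^esub>}"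
  shows "0 \<le> GKdim L S Q"
proof -
  interpret S: vectorspace L S using S unfolding assoc_algebra_def by auto
  interpret Q: rmod S Q by fact
  let ?A = "restrict_scalars S Q"
  have A: "vectorspace L ?A" using restrict_scalars_vectorspace[OF S Q] .
  have SV: "vectorspace L S" by unfold_locales
  obtain q where q: "q \<in> carrier Q" "q \<noteq> \<zero>\<^bsub>Q\<^esub>" using nz Q.M.zero_closed by blast
  define V where "V = module.span L S {\<one>\<^bsub>S\<^esub>}"
  define W where "W = module.span L ?A {q}"
  have fV: "fd_subspace L S V" unfolding V_def
    by (rule fd_subspace_within(1)[OF SV span_facts(4)[OF SV], of "{\<one>\<^bsub>S\<^esub>}" "{\<one>\<^bsub>S\<^esub>}"]) auto
  have fW: "fd_subspace L ?A W" unfolding W_def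
    by (rule fd_subspace_within(1)[OF A span_facts(4)[OF A], of "{q}" "{q}"]) (use q in auto)
  have Vc: "V \<subseteq> carrier S" "submodule L V S" and Wc: "W \<subseteq> carrier Q" "submodule L W ?A"
    using fV fW vs_submoduleD(1)[of L V S] vs_submoduleD(1)[of L W ?A] unfolding fd_subspace_def subspace_def by auto
  have one: "\<one>\<^bsub>S\<^esub> \<in> V" unfolding V_def using span_facts(2)[OF SV, of "{\<one>\<^bsub>S\<^esub>}"] by auto
  have qW: "q \<in> W" unfolding W_def using span_facts(2)[OF A, of "{q}"] q by auto
  have smul: "\<And>c x y. c \<in> carrier L \<Longrightarrow> x \<in> carrier S \<Longrightarrow> y \<in> carrier S \<Longrightarrow> x \<otimes>\<^bsub>S\<^esub> (c \<odot>\<^bsub>S\<^esub> y) = c \<odot>\<^bsub>S\<^esub> (x \<otimes>\<^bsub>S\<^esub> y)"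
    using S unfolding assoc_algebra_def by auto
  have VV: "x \<otimes>\<^bsub>S\<^esub> v \<in> V" if x: "x \<in> V" and v: "v \<in> V" for x v
  proof -
    have xc: "x \<in> carrier S" using x Vc by auto
    have "submodule L {v \<in> carrier S. x \<otimes>\<^bsub>S\<^esub> v \<in> V} S"
      by (rule vs_submodule_preimage[OF SV SV Vc(2)]) (auto simp: xc Q.S.r_distr smul)
    then have "V \<subseteq> {v \<in> carrier S. x \<otimes>\<^bsub>S\<^esub> v \<in> V}"
      unfolding V_def using span_facts(3)[OF SV, of "{\<one>\<^bsub>S\<^esub>}"] x xc unfolding V_def by simp
    then show ?thesis using v by auto
  qed
  \<comment> \<open>Containment in \<open>V\<close> keeps the growth inside the line
    \<open>W\<close>, hence finite dimensional, which positivity of \<open>subspace_dim\<close>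
    presupposes; membership of one keeps \<open>q\<close> inside it.\<close>
  have pow: "subspace_power L S V n \<subseteq> V \<and> \<one>\<^bsub>S\<^esub> \<in> subspace_power L S V n" for n
  proof (induction n)
    case 0 show ?case using one by (simp add: V_def)
  next
    case (Suc n)
    have sub: "{x \<otimes>\<^bsub>S\<^esub> v |x v. x \<in> subspace_power L S V n \<and> v \<in> V} \<subseteq> V" using Suc VV by auto
    then have subc: "{x \<otimes>\<^bsub>S\<^esub> v |x v. x \<in> subspace_power L S V n \<and> v \<in> V} \<subseteq> carrier S" using Vc by auto
    have "\<one>\<^bsub>S\<^esub> \<otimes>\<^bsub>S\<^esub> \<one>\<^bsub>S\<^esub> \<in> {x \<otimes>\<^bsub>S\<^esub> v |x v. x \<in> subspace_power L S V n \<and> v \<in> V}" using Suc one by blast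
    then show ?case using span_facts(2,3)[OF SV subc] Vc(2) sub by auto
  qed
  have VW: "v \<odot>\<^bsub>Q\<^esub> w \<in> W" if v: "v \<in> V" and w: "w \<in> W" for v w
  proof -
    have wc: "w \<in> carrier Q" using w Wc by auto
    have "submodule L {v \<in> carrier S. v \<odot>\<^bsub>Q\<^esub> w \<in> W} S"
    proof (rule vs_submodule_preimage[OF SV A Wc(2)])
      fix c x assume cx: "c \<in> carrier L" "x \<in> carrier S"
      have "c \<odot>\<^bsub>S\<^esub> x = x \<otimes>\<^bsub>S\<^esub> (c \<odot>\<^bsub>S\<^esub> \<one>\<^bsub>S\<^esub>)" using smul[of c x "\<one>\<^bsub>S\<^esub>"] cx by simp
      then show "(c \<odot>\<^bsub>S\<^esub> x) \<odot>\<^bsub>Q\<^esub> w = c \<odot>\<^bsub>?A\<^esub> (x \<odot>\<^bsub>Q\<^esub> w)"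
        using cx wc by (simp add: restrict_scalars_def Q.act_mult)
    qed (auto simp: wc Q.act_ladd)
    then have "V \<subseteq> {v \<in> carrier S. v \<odot>\<^bsub>Q\<^esub> w \<in> W}"
      unfolding V_def using span_facts(3)[OF SV, of "{\<one>\<^bsub>S\<^esub>}"] w wc by simp
    then show ?thesis using v by auto
  qed
  have pos: "0 < subspace_dim L ?A (module_growth L S Q W V n)" for n
  proof (rule subspace_dim_pos[OF A _ _, of _ q])
    let ?X = "{v \<odot>\<^bsub>Q\<^esub> w | v w. v \<in> subspace_power L S V n \<and> w \<in> W}"
    have X: "?X \<subseteq> carrier ?A" using module_growth_products[OF S Q Vc(1) Wc(1)] .
    have "?X \<subseteq> W" using VW pow[of n] by auto
    then have "module_growth L S Q W V n \<subseteq> module.span L ?A {q}"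
      unfolding module_growth_def using span_facts(3)[OF A X Wc(2)] unfolding W_def by auto
    then show "fd_subspace L ?A (module_growth L S Q W V n)"
      using fd_subspace_within(1)[OF A, of "module_growth L S Q W V n" "{q}"] span_facts(4)[OF A X] q
      unfolding module_growth_def by auto
    have "\<one>\<^bsub>S\<^esub> \<odot>\<^bsub>Q\<^esub> q \<in> ?X" using pow[of n] qW by blast
    then show "q \<in> module_growth L S Q W V n"
      unfolding module_growth_def using span_facts(2)[OF A X] q by auto
    show "q \<noteq> \<zero>\<^bsub>?A\<^esub>" using q by simp
  qed
  have "0 \<le> growth_exponent (\<lambda>n. subspace_dim L ?A (module_growth L S Q W V n))"
    using growth_exponent_nonneg pos by auto
  also have "\<dots> \<le> GKdim L S Q"
    unfolding GKdim_alt using nz fV fW by (auto intro!: SUP_upper2[of "(W, V)"])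
  finally show ?thesis .
qed

text \<open>The summand 1 in \<open>D + 1\<close> turns the bound on the limit superior into a
  strict bound for all large \<open>n\<close>. The factor 2 absorbs the shift, since
  \<open>n + 1 \<le> n^2\<close> for \<open>n \<ge> 2\<close>. A crude constant suffices, as only
  its independence of the field matters.\<close>

lemma growth_exponent_shift_bound:
  assumes D: "growth_exponent d \<le> ereal D" "0 \<le> D" and le: "\<And>n. d' n \<le> d (Suc n)"
  shows "growth_exponent d' \<le> ereal (2 * (D + 1))"
proof -
  let ?l = "\<lambda>d n. if d n = 0 then - \<infinity> else ereal (log (real n) (real (d n :: nat)))"
  have "limsup (?l d) < ereal (D + 1)" using D unfolding growth_exponent_def by (auto intro: le_less_trans)
  then have "\<forall>\<^sub>F n in sequentially. ?l d n < ereal (D + 1)"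
    using Limsup_lessD by blast
  then have "\<forall>\<^sub>F n in sequentially. ?l d (Suc n) < ereal (D + 1)"
    by (subst eventually_sequentially_Suc)
  then have "\<forall>\<^sub>F n in sequentially. ?l d' n \<le> ereal (2 * (D + 1))"
    using eventually_ge_at_top[of 2]
  proof eventually_elim
    case (elim n)
    show ?case
    proof (cases "d' n = 0")
      case False
      then have pos: "0 < d (Suc n)" "0 < d' n" using le[of n] by auto
      then have "log (real (Suc n)) (real (d (Suc n))) < D + 1" using elim by auto
      then have "real (d (Suc n)) < real (Suc n) powr (D + 1)" using pos elim by (subst (asm) log_less_iff) auto
      also have "\<dots> \<le> (real n ^ 2) powr (D + 1)"
      proof (intro powr_mono2)
        have "Suc n \<le> n ^ 2" using elim(2) by (auto simp: power2_eq_square) (metis Suc_le_mono add_Suc_right le_add1 le_trans mult_2 mult_le_mono1 nat_1_add_1 plus_1_eq_Suc add.commute add_le_mono1 one_le_numeral)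
        then show "real (Suc n) \<le> real n ^ 2" by (metis of_nat_le_iff of_nat_power)
      qed (use D in auto)
      also have "\<dots> = real n powr (2 * (D + 1))"
        proof -
          have "real n ^ 2 = real n powr 2" using elim(2) by (subst powr_numeral) auto
          then show ?thesis by (simp only: powr_powr)
        qed
      finally have "real (d' n) \<le> real n powr (2 * (D + 1))" using le[of n] by linarith
      then have "log (real n) (real (d' n)) \<le> 2 * (D + 1)" using pos elim by (subst log_le_iff) auto
      then show ?thesis using False by simp
    qed simp
  qed
  then show ?thesis unfolding growth_exponent_def by (rule Limsup_bounded)
qed

section \<open>A bound for cyclic modules that is uniform in the extension field\<close>

lemma assoc_algebraD:
  assumes "assoc_algebra L S"
  shows "vectorspace L S" "ring S"
    "\<And>c x y. c \<in> carrier L \<Longrightarrow> x \<in> carrier S \<Longrightarrow> y \<in> carrier S \<Longrightarrow> (c \<odot>\<^bsub>S\<^esub> x) \<otimes>\<^bsub>S\<^esub> y = c \<odot>\<^bsub>S\<^esub> (x \<otimes>\<^bsub>S\<^esub> y)"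
    "\<And>c x y. c \<in> carrier L \<Longrightarrow> x \<in> carrier S \<Longrightarrow> y \<in> carrier S \<Longrightarrow> x \<otimes>\<^bsub>S\<^esub> (c \<odot>\<^bsub>S\<^esub> y) = c \<odot>\<^bsub>S\<^esub> (x \<otimes>\<^bsub>S\<^esub> y)"
  using assms unfolding assoc_algebra_def by auto

lemma span_finite_subset:
  assumes A: "vectorspace K A" and X: "X \<subseteq> carrier A" and F: "finite F" "F \<subseteq> module.span K A X"
  obtains Y where "finite Y" "Y \<subseteq> X" "F \<subseteq> module.span K A Y"
  using F
proof (induction F arbitrary: thesis)
  case empty then show ?case by auto
next
  interpret A: vectorspace K A by fact
  case (insert v F)
  obtain Y where Y: "finite Y" "Y \<subseteq> X" "F \<subseteq> A.span Y" using insert by auto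
  have "v \<in> A.span X" using insert by auto
  then obtain a Z where Z: "finite Z" "Z \<subseteq> X" "a \<in> Z \<rightarrow> carrier K" "v = A.lincomb a Z"
    unfolding A.span_def by auto
  then have "v \<in> A.span Z" unfolding A.span_def by auto
  then have "insert v F \<subseteq> A.span (Y \<union> Z)"
    using Y(3) A.span_is_monotone[of Y "Y \<union> Z"] A.span_is_monotone[of Z "Y \<union> Z"] by auto
  then show ?case using insert.prems(1)[of "Y \<union> Z"] Y Z by auto
qed

text \<open>Let \<open>V\<^sub>0\<close> be a finite dimensional subspace of \<open>R\<close> containing 1 whose extension contains both \<open>V\<close> and
  lifts of generators of \<open>W\<close>. Then \<open>W V\<^sup>n\<close> is spanned by the image of a basis of \<open>V\<^sub>0\<^sup>n\<^sup>+\<^sup>1\<close>.\<close>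

lemma GKdim_cyclic_bound:
  assumes R: "assoc_algebra k R" and S: "assoc_algebra L S"
    and kL: "carrier k \<subseteq> carrier L"
    and \<iota>: "\<iota> \<in> ring_hom R S" and \<iota>k: "\<And>c r. c \<in> carrier k \<Longrightarrow> r \<in> carrier R \<Longrightarrow> \<iota> (c \<odot>\<^bsub>R\<^esub> r) = c \<odot>\<^bsub>S\<^esub> \<iota> r"
    and gen: "carrier S \<subseteq> module.span L S (\<iota> ` carrier R)"
    and D: "GKdim_algebra k R \<le> ereal D" "0 \<le> D"
    and f: "hom_onto S (regular_module S) Q f"
  shows "GKdim L S Q \<le> ereal (2 * (D + 1))"
proof -
  note kR = assoc_algebraD[OF R] and LS = assoc_algebraD[OF S]
  interpret kR: vectorspace k R by (rule kR(1))
  interpret RR: ring R by (rule kR(2))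
  interpret LS: vectorspace L S by (rule LS(1))
  interpret SR: ring S by (rule LS(2))
  interpret Q: rmod S Q using hom_onto_rmod[OF f] .
  let ?A = "restrict_scalars S Q"
  have A: "vectorspace L ?A" using restrict_scalars_vectorspace[OF S Q.rmod_axioms] .
  have \<iota>s: "\<And>r. r \<in> carrier R \<Longrightarrow> \<iota> r \<in> carrier S" "\<iota> \<one>\<^bsub>R\<^esub> = \<one>\<^bsub>S\<^esub>"
    "\<And>x y. x \<in> carrier R \<Longrightarrow> y \<in> carrier R \<Longrightarrow> \<iota> (x \<oplus>\<^bsub>R\<^esub> y) = \<iota> x \<oplus>\<^bsub>S\<^esub> \<iota> y"
    "\<And>x y. x \<in> carrier R \<Longrightarrow> y \<in> carrier R \<Longrightarrow> \<iota> (x \<otimes>\<^bsub>R\<^esub> y) = \<iota> x \<otimes>\<^bsub>S\<^esub> \<iota> y"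
    "\<iota> \<zero>\<^bsub>R\<^esub> = \<zero>\<^bsub>S\<^esub>"
    using \<iota> ring_hom_zero[OF \<iota> kR(2) LS(2)] unfolding ring_hom_def by auto
  have fs: "f ` carrier S = carrier Q" "\<And>x. x \<in> carrier S \<Longrightarrow> f x \<in> carrier Q"
     "\<And>x y. x \<in> carrier S \<Longrightarrow> y \<in> carrier S \<Longrightarrow> f (x \<oplus>\<^bsub>S\<^esub> y) = f x \<oplus>\<^bsub>Q\<^esub> f y"
     "\<And>x y. x \<in> carrier S \<Longrightarrow> y \<in> carrier S \<Longrightarrow> f (y \<otimes>\<^bsub>S\<^esub> x) = x \<odot>\<^bsub>Q\<^esub> f y"
    using f unfolding hom_onto_def by (auto simp: regular_module_def)
  have fl: "f (c \<odot>\<^bsub>S\<^esub> x) = c \<odot>\<^bsub>?A\<^esub> f x" if "c \<in> carrier L" "x \<in> carrier S" for c x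
  proof -
    have "c \<odot>\<^bsub>S\<^esub> x = x \<otimes>\<^bsub>S\<^esub> (c \<odot>\<^bsub>S\<^esub> \<one>\<^bsub>S\<^esub>)" using LS(4)[of c x "\<one>\<^bsub>S\<^esub>"] that by simp
    then show ?thesis using that fs(4)[of "c \<odot>\<^bsub>S\<^esub> \<one>\<^bsub>S\<^esub>" x] by (simp add: restrict_scalars_def)
  qed
  \<comment> \<open>\<open>E U\<close> is the extension of the \<open>k\<close>-subspace
    \<open>U\<close> to an \<open>L\<close>-subspace of \<open>S\<close>.\<close>
  define E where "E U = module.span L S (\<iota> ` U)" for U
  have E: "submodule L (E U) S" "\<iota> ` U \<subseteq> E U" "\<And>N. submodule L N S \<Longrightarrow> \<iota> ` U \<subseteq> N \<Longrightarrow> E U \<subseteq> N"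
    if "U \<subseteq> carrier R" for U
  proof -
    have c: "\<iota> ` U \<subseteq> carrier S" using that \<iota>s(1) by auto
    show "submodule L (E U) S" "\<iota> ` U \<subseteq> E U" "\<And>N. submodule L N S \<Longrightarrow> \<iota> ` U \<subseteq> N \<Longrightarrow> E U \<subseteq> N"
      unfolding E_def using span_facts[OF LS(1) c] by auto
  qed
  have Emult: "x \<otimes>\<^bsub>S\<^esub> y \<in> E W" if U: "U \<subseteq> carrier R" "U' \<subseteq> carrier R" "W \<subseteq> carrier R"
    and W: "\<And>u u'. u \<in> U \<Longrightarrow> u' \<in> U' \<Longrightarrow> u \<otimes>\<^bsub>R\<^esub> u' \<in> W" and xy: "x \<in> E U" "y \<in> E U'" for U U' W x y
  proof -
    have 1: "x \<otimes>\<^bsub>S\<^esub> \<iota> u' \<in> E W" if u': "u' \<in> U'" for u'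
    proof -
      have c: "\<iota> u' \<in> carrier S" using U u' \<iota>s(1) by auto
      have "submodule L {x \<in> carrier S. x \<otimes>\<^bsub>S\<^esub> \<iota> u' \<in> E W} S"
        by (rule vs_submodule_preimage[OF LS(1) LS(1) E(1)[OF U(3)]]) (auto simp: c SR.l_distr LS(3))
      moreover have "\<iota> ` U \<subseteq> {x \<in> carrier S. x \<otimes>\<^bsub>S\<^esub> \<iota> u' \<in> E W}"
        using U u' W E(2)[OF U(3)] \<iota>s(1,4) by (auto simp: subset_eq) (metis imageI)
      ultimately show ?thesis using E(3)[OF U(1)] xy(1) by auto
    qed
    have xc: "x \<in> carrier S" using vs_submoduleD(1)[OF E(1)[OF U(1)]] xy by auto
    have "submodule L {y \<in> carrier S. x \<otimes>\<^bsub>S\<^esub> y \<in> E W} S"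
      by (rule vs_submodule_preimage[OF LS(1) LS(1) E(1)[OF U(3)]]) (auto simp: xc SR.r_distr LS(4))
    moreover have "\<iota> ` U' \<subseteq> {y \<in> carrier S. x \<otimes>\<^bsub>S\<^esub> y \<in> E W}" using 1 U \<iota>s(1) by auto
    ultimately show ?thesis using E(3)[OF U(2)] xy(2) by auto
  qed
  have bound: "growth_exponent (\<lambda>n. subspace_dim L ?A (module_growth L S Q W V n)) \<le> ereal (2 * (D + 1))"
    if W: "fd_subspace L ?A W" and V: "fd_subspace L S V" for W V
  proof -
    obtain FV where FV: "finite FV" "FV \<subseteq> V" "module.span L S FV = V" and Vs: "submodule L V S"
      using V unfolding fd_subspace_iff[OF LS(1)] subspace_def by blast
    obtain FW where FW: "finite FW" "FW \<subseteq> W" "module.span L ?A FW = W" and Ws: "submodule L W ?A"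
      using W unfolding fd_subspace_iff[OF A] subspace_def by blast
    have Vc: "V \<subseteq> carrier S" and Wc: "W \<subseteq> carrier Q" using vs_submoduleD(1)[OF Vs] vs_submoduleD(1)[OF Ws] by auto
    have "FW \<subseteq> f ` carrier S" unfolding fs(1) using FW(2) Wc by (rule order_trans)
    from finite_subset_image[OF FW(1) this] obtain G where G: "finite G" "G \<subseteq> carrier S" "FW = f ` G" by auto
    have "FV \<union> G \<subseteq> module.span L S (\<iota> ` carrier R)" using gen FV Vc G by auto
    then obtain Y' where Y': "finite Y'" "Y' \<subseteq> \<iota> ` carrier R" "FV \<union> G \<subseteq> module.span L S Y'"
      using span_finite_subset[OF LS(1), of "\<iota> ` carrier R" "FV \<union> G"] FV(1) G(1) \<iota>s(1) by auto
    then obtain Y where Y: "finite Y" "Y \<subseteq> carrier R" "Y' = \<iota> ` Y" by (metis finite_subset_image)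
    let ?Y1 = "insert \<one>\<^bsub>R\<^esub> Y"
    define V0 where "V0 = module.span k R ?Y1"
    have Y1: "?Y1 \<subseteq> carrier R" using Y by auto
    note V0 = span_facts[OF kR(1) Y1, folded V0_def]
    have V0c: "V0 \<subseteq> carrier R" using vs_submoduleD(1)[OF V0(1)] .
    have fdV0: "fd_subspace k R V0"
      using fd_subspace_within(1)[OF kR(1) V0(4), of ?Y1] Y1 Y V0_def by auto
    have FVG: "FV \<union> G \<subseteq> E V0"
    proof -
      have "module.span L S Y' \<subseteq> E V0"
        using V0(2) E(1,2)[OF V0c] Y by (intro span_facts(3)[OF LS(1)]) (auto simp: \<iota>s)
      then show ?thesis using Y' by auto
    qed
    have VE: "V \<subseteq> E V0" using FV FVG span_facts(3)[OF LS(1), of FV "E V0"] E(1)[OF V0c] Vc by auto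
    define P where "P n = subspace_power k R V0 n" for n
    have P: "submodule k (P n) R" "P n \<subseteq> carrier R" for n
      unfolding P_def using subspace_power_submodule[OF R V0c] vs_submoduleD(1) by blast+
    have PS: "{x \<otimes>\<^bsub>R\<^esub> v |x v. x \<in> P n \<and> v \<in> V0} \<subseteq> carrier R" for n using P(2) V0c by auto
    have PSuc: "x \<otimes>\<^bsub>R\<^esub> v \<in> P (Suc n)" if "x \<in> P n" "v \<in> V0" for x v n
      using that span_facts(2)[OF kR(1) PS[of n]] unfolding P_def by auto
    have PSucE: "P (Suc n) \<subseteq> N" if "submodule k N R" "\<And>x v. x \<in> P n \<Longrightarrow> v \<in> V0 \<Longrightarrow> x \<otimes>\<^bsub>R\<^esub> v \<in> N" for n N
      using that(2) span_facts(3)[OF kR(1) PS[of n] that(1)] unfolding P_def by auto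
    \<comment> \<open>Powers grow on the right by definition, but the lift \<open>s\<close> of a
      vector \<open>w = f s\<close> enters on the left, since \<open>f s\<close> acted on by
      \<open>v\<close> is \<open>f (s v)\<close>. Hence powers must also absorb a factor from the
      left.\<close>
    have V0P: "v \<otimes>\<^bsub>R\<^esub> p \<in> P (Suc n)" if v: "v \<in> V0" and p: "p \<in> P n" for v p n
    proof -
      have vc: "v \<in> carrier R" using v V0c by auto
      have sub: "submodule k {p \<in> carrier R. v \<otimes>\<^bsub>R\<^esub> p \<in> P (Suc n)} R" for n
        by (rule vs_submodule_preimage[OF kR(1) kR(1) P(1)]) (auto simp: vc RR.r_distr kR(4))
      have "P n \<subseteq> {p \<in> carrier R. v \<otimes>\<^bsub>R\<^esub> p \<in> P (Suc n)}"
      proof (induction n)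
        case 0
        have "\<one>\<^bsub>R\<^esub> \<in> P 0" unfolding P_def using span_facts(2)[OF kR(1), of "{\<one>\<^bsub>R\<^esub>}"] by auto
        then have "\<one>\<^bsub>R\<^esub> \<otimes>\<^bsub>R\<^esub> v \<in> P (Suc 0)" using PSuc v by blast
        then have "v \<in> P (Suc 0)" using vc by simp
        then have "{\<one>\<^bsub>R\<^esub>} \<subseteq> {p \<in> carrier R. v \<otimes>\<^bsub>R\<^esub> p \<in> P (Suc 0)}" using vc by auto
        from span_facts(3)[OF kR(1) _ sub[of 0] this] show ?case unfolding P_def by auto
      next
        case (Suc n)
        show ?case
        proof (rule PSucE[OF sub])
          fix x w assume xw: "x \<in> P n" "w \<in> V0"
          have c: "x \<in> carrier R" "w \<in> carrier R" using xw P V0c by auto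
          have "v \<otimes>\<^bsub>R\<^esub> x \<in> P (Suc n)" using Suc xw by auto
          then have "v \<otimes>\<^bsub>R\<^esub> x \<otimes>\<^bsub>R\<^esub> w \<in> P (Suc (Suc n))" using PSuc xw by blast
          then show "x \<otimes>\<^bsub>R\<^esub> w \<in> {p \<in> carrier R. v \<otimes>\<^bsub>R\<^esub> p \<in> P (Suc (Suc n))}"
            using c vc by (simp add: RR.m_assoc)
        qed
      qed
      then show ?thesis using p by auto
    qed
    have fdP: "fd_subspace k R (P n)" for n
    proof (induction n)
      case 0
      show ?case unfolding P_def
        using fd_subspace_within(1)[OF kR(1) span_facts(4)[OF kR(1)], of "{\<one>\<^bsub>R\<^esub>}" "{\<one>\<^bsub>R\<^esub>}"] by auto
    next
      case (Suc n)
      obtain X where X: "finite X" "X \<subseteq> P n" "module.span k R X = P n"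
        using Suc unfolding fd_subspace_iff[OF kR(1)] by blast
      have Xc: "X \<subseteq> carrier R" using X(2) P(2)[of n] by (rule order_trans)
      let ?Z = "(\<lambda>(x, y). x \<otimes>\<^bsub>R\<^esub> y) ` (X \<times> ?Y1)"
      have Zc: "?Z \<subseteq> carrier R" using Xc Y1 by auto
      note Z = span_facts[OF kR(1) Zc]
      have "x \<otimes>\<^bsub>R\<^esub> v \<in> module.span k R ?Z" if xv: "x \<in> P n" "v \<in> V0" for x v
      proof -
        have 1: "x \<otimes>\<^bsub>R\<^esub> y \<in> module.span k R ?Z" if y: "y \<in> ?Y1" for y
        proof -
          have yc: "y \<in> carrier R" using y Y1 by auto
          have "submodule k {x \<in> carrier R. x \<otimes>\<^bsub>R\<^esub> y \<in> module.span k R ?Z} R"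
            by (rule vs_submodule_preimage[OF kR(1) kR(1) Z(1)]) (auto simp: yc RR.l_distr kR(3))
          moreover have "X \<subseteq> {x \<in> carrier R. x \<otimes>\<^bsub>R\<^esub> y \<in> module.span k R ?Z}" using Xc y Z(2) by auto
          ultimately show ?thesis using span_facts(3)[OF kR(1) Xc] X(3) xv by blast
        qed
        have xc: "x \<in> carrier R" using xv P(2)[of n] by auto
        have "submodule k {v \<in> carrier R. x \<otimes>\<^bsub>R\<^esub> v \<in> module.span k R ?Z} R"
          by (rule vs_submodule_preimage[OF kR(1) kR(1) Z(1)]) (auto simp: xc RR.r_distr kR(4))
        moreover have "?Y1 \<subseteq> {v \<in> carrier R. x \<otimes>\<^bsub>R\<^esub> v \<in> module.span k R ?Z}" using Y1 1 by auto
        ultimately show ?thesis using V0(3) xv by blast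
      qed
      then have "P (Suc n) \<subseteq> module.span k R ?Z" using PSucE[OF Z(1)] by auto
      moreover have "subspace k (P (Suc n)) R" using P(1) kR(1) unfolding subspace_def by auto
      ultimately show ?case using fd_subspace_within(1)[OF kR(1) _ _ Zc] X(1) Y(1) by auto
    qed
    have VnE: "subspace_power L S V n \<subseteq> E (P n)" for n
    proof (induction n)
      case 0
      have "\<one>\<^bsub>R\<^esub> \<in> P 0" unfolding P_def using span_facts(2)[OF kR(1), of "{\<one>\<^bsub>R\<^esub>}"] by auto
      then have "\<one>\<^bsub>S\<^esub> \<in> E (P 0)" using E(2)[OF P(2)] \<iota>s(2) by (metis imageI subsetD)
      then show ?case using span_facts(3)[OF LS(1), of "{\<one>\<^bsub>S\<^esub>}"] E(1)[OF P(2)] by auto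
    next
      case (Suc n)
      have "x \<otimes>\<^bsub>S\<^esub> v \<in> E (P (Suc n))" if "x \<in> subspace_power L S V n" "v \<in> V" for x v
        by (rule Emult[OF P(2) V0c P(2) PSuc]) (use that Suc VE in auto)
      then have "{x \<otimes>\<^bsub>S\<^esub> v |x v. x \<in> subspace_power L S V n \<and> v \<in> V} \<subseteq> E (P (Suc n))" by blast
      moreover have "{x \<otimes>\<^bsub>S\<^esub> v |x v. x \<in> subspace_power L S V n \<and> v \<in> V} \<subseteq> carrier S"
        using Vc vs_submoduleD(1)[OF subspace_power_submodule[OF S Vc, of n]] by auto
      ultimately show ?case using span_facts(3)[OF LS(1) _ E(1)[OF P(2)]] by simp
    qed
    have le: "subspace_dim L ?A (module_growth L S Q W V n) \<le> subspace_dim k R (P (Suc n))" for n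
    proof -
      obtain Z where Z: "finite Z" "Z \<subseteq> P (Suc n)" "module.span k R Z = P (Suc n)" "card Z = subspace_dim k R (P (Suc n))"
        using subspace_dim_attained[OF kR(1) fdP] .
      have Zc: "Z \<subseteq> carrier R" using Z(2) P(2)[of "Suc n"] by (rule order_trans)
      \<comment> \<open>A set spanning the power over \<open>k\<close> also spans its extension over
        \<open>L\<close>; so the dimension over \<open>L\<close> is at most the one over
        \<open>k\<close>.\<close>
      have "P (Suc n) \<subseteq> {r \<in> carrier R. \<iota> r \<in> E Z}"
      proof -
        have "submodule k {r \<in> carrier R. \<iota> r \<in> E Z} R"
          by (rule vs_submoduleI[OF kR(1)]) (use vs_submoduleD[OF E(1)[OF Zc]] \<iota>s \<iota>k kL in auto)
        moreover have "Z \<subseteq> {r \<in> carrier R. \<iota> r \<in> E Z}" using Zc E(2)[OF Zc] by auto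
        ultimately show ?thesis using span_facts(3)[OF kR(1) Zc] Z(3) by auto
      qed
      then have EP: "E (P (Suc n)) \<subseteq> E Z" using E(3)[OF P(2) E(1)[OF Zc]] by auto
      have \<iota>Z: "\<iota> ` Z \<subseteq> carrier S" using Zc \<iota>s by auto
      have fE: "f ` E Z = module.span L ?A (f ` \<iota> ` Z)"
        unfolding E_def by (rule span_image[OF LS(1) A \<iota>Z]) (use fs fl in auto)
      have sW: "submodule L (f ` E V0) ?A"
        by (rule vs_submodule_image[OF LS(1) A E(1)[OF V0c]]) (use fs fl in auto)
      have "FW \<subseteq> f ` E V0" using G FVG by auto
      then have WE: "W \<subseteq> f ` E V0" using span_facts(3)[OF A _ sW, of FW] FW Wc by auto
      let ?X = "{v \<odot>\<^bsub>Q\<^esub> w | v w. v \<in> subspace_power L S V n \<and> w \<in> W}"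
      have Xc: "?X \<subseteq> carrier ?A" using module_growth_products[OF S Q.rmod_axioms Vc Wc] .
      have "v \<odot>\<^bsub>Q\<^esub> w \<in> f ` E Z" if vw: "v \<in> subspace_power L S V n" "w \<in> W" for v w
      proof -
        obtain s where s: "s \<in> E V0" "w = f s" using vw WE by auto
        have vE: "v \<in> E (P n)" using vw VnE by auto
        have "s \<otimes>\<^bsub>S\<^esub> v \<in> E (P (Suc n))" by (rule Emult[OF V0c P(2) P(2) V0P s(1) vE])
        moreover have "s \<in> carrier S" "v \<in> carrier S"
          using s vE vs_submoduleD(1)[OF E(1)[OF V0c]] vs_submoduleD(1)[OF E(1)[OF P(2)]] by auto
        ultimately show ?thesis using fs(4)[of v s] s EP by (metis imageI subsetD)
      qed
      then have "?X \<subseteq> module.span L ?A (f ` \<iota> ` Z)" using fE by auto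
      moreover have fZ: "f ` \<iota> ` Z \<subseteq> carrier ?A" using \<iota>Z fs(2) by auto
      ultimately have "module_growth L S Q W V n \<subseteq> module.span L ?A (f ` \<iota> ` Z)"
        unfolding module_growth_def using span_facts(3)[OF A Xc span_facts(1)[OF A fZ]] by auto
      then have "subspace_dim L ?A (module_growth L S Q W V n) \<le> card (f ` \<iota> ` Z)"
        using Z(1) fZ span_facts(4)[OF A Xc] unfolding module_growth_def
        by (intro fd_subspace_within(2)[OF A]) auto
      also have "\<dots> \<le> card Z" using Z(1) by (metis card_image_le finite_imageI order_trans)
      finally show ?thesis using Z by simp
    qed
    have ge: "growth_exponent (\<lambda>n. subspace_dim k R (P n)) \<le> ereal D"
    proof -
      have "growth_exponent (\<lambda>n. subspace_dim k R (P n)) \<le> GKdim_algebra k R"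
        unfolding GKdim_algebra_def P_def using fdV0 by (intro SUP_upper) auto
      then show ?thesis using D by auto
    qed
    show ?thesis by (rule growth_exponent_shift_bound[OF ge D(2) le])
  qed
  show ?thesis
  proof (cases "carrier Q = {\<zero>\<^bsub>Q\<^esub>}")
    case True
    have "ereal (-1) \<le> ereal (2 * (D + 1))" using D(2) by simp
    then have "(-1 :: ereal) \<le> ereal (2 * (D + 1))" by (simp add: one_ereal_def)
    then show ?thesis using True by (simp add: GKdim_zero)
  next
    case False
    then show ?thesis unfolding GKdim_alt using bound by (auto intro!: SUP_least)
  qed
qed

section \<open>Dimension functions on modular lattices\<close>

text \<open>The lattice of right ideals, with \<open>g A B\<close> in the role of the GK dimension
  of \<open>A/B\<close> for \<open>B\<close> below \<open>A\<close>. Noetherianity, exactness,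
  partitivity and the second isomorphism theorem appear as axioms, so that chains can be handled
  without modules and the results reused over each small field. The value -1 belongs to the zero
  quotient.\<close>

locale dimension_lattice =
  fixes \<L> :: "'s set set" and pl :: "'s set \<Rightarrow> 's set \<Rightarrow> 's set" and g :: "'s set \<Rightarrow> 's set \<Rightarrow> int"
  assumes Int_closed: "\<lbrakk>A \<in> \<L>; B \<in> \<L>\<rbrakk> \<Longrightarrow> A \<inter> B \<in> \<L>"
    and pl_closed: "\<lbrakk>A \<in> \<L>; B \<in> \<L>\<rbrakk> \<Longrightarrow> pl A B \<in> \<L>"
    and pl_upper: "\<lbrakk>A \<in> \<L>; B \<in> \<L>\<rbrakk> \<Longrightarrow> A \<subseteq> pl A B" "\<lbrakk>A \<in> \<L>; B \<in> \<L>\<rbrakk> \<Longrightarrow> B \<subseteq> pl A B"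
    and pl_least: "\<lbrakk>A \<in> \<L>; B \<in> \<L>; C \<in> \<L>; A \<subseteq> C; B \<subseteq> C\<rbrakk> \<Longrightarrow> pl A B \<subseteq> C"
    and modular: "\<lbrakk>A \<in> \<L>; B \<in> \<L>; N \<in> \<L>; B \<subseteq> A\<rbrakk> \<Longrightarrow> A \<inter> pl B N \<subseteq> pl B (A \<inter> N)"
    and g_refl: "A \<in> \<L> \<Longrightarrow> g A A = -1"
    and g_nonneg: "\<lbrakk>A \<in> \<L>; B \<in> \<L>; B \<subset> A\<rbrakk> \<Longrightarrow> 0 \<le> g A B"
    and g_exact: "\<lbrakk>A \<in> \<L>; B \<in> \<L>; C \<in> \<L>; C \<subseteq> B; B \<subseteq> A\<rbrakk> \<Longrightarrow> g A C = max (g B C) (g A B)"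
    and g_diamond: "\<lbrakk>A \<in> \<L>; B \<in> \<L>\<rbrakk> \<Longrightarrow> g (pl A B) B = g A (A \<inter> B)"
    and partitive: "\<lbrakk>X \<in> \<L>; Y \<in> \<L>; Y \<subseteq> X\<rbrakk> \<Longrightarrow> \<exists>b. \<forall>n C. C 0 = X \<and> (\<forall>i\<le>n. C i \<in> \<L> \<and> Y \<subseteq> C i) \<and>
        (\<forall>i<n. C (Suc i) \<subset> C i \<and> g (C i) (C (Suc i)) = g X Y) \<longrightarrow> n \<le> b"
    and maximal: "\<lbrakk>F \<subseteq> \<L>; F \<noteq> {}\<rbrakk> \<Longrightarrow> \<exists>M\<in>F. \<forall>I\<in>F. M \<subseteq> I \<longrightarrow> I = M"
begin

text \<open>A critical composition series of \<open>X/I\<close>, built from the bottom. The integer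
  is the dimension of the top factor and, by exactness, also that of \<open>X/I\<close>. The empty
  series carries -1, which leaves the first factor unconstrained.\<close>

inductive critical_series :: "'s set \<Rightarrow> 's set \<Rightarrow> int \<Rightarrow> nat \<Rightarrow> bool" for I where
  refl: "I \<in> \<L> \<Longrightarrow> critical_series I I (-1) 0"
| step: "critical_series I N d' n \<Longrightarrow> X \<in> \<L> \<Longrightarrow> N \<subset> X \<Longrightarrow> d' \<le> d \<Longrightarrow> g X N = d \<Longrightarrow>
    (\<And>Q. Q \<in> \<L> \<Longrightarrow> N \<subset> Q \<Longrightarrow> Q \<subseteq> X \<Longrightarrow> g X Q < d) \<Longrightarrow> critical_series I X d (Suc n)"

lemma critical_seriesD:
  "critical_series I X d n \<Longrightarrow> I \<in> \<L> \<and> X \<in> \<L> \<and> I \<subseteq> X \<and> g X I = d"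
proof (induction rule: critical_series.induct)
  case refl then show ?case by (simp add: g_refl)
next
  case (step N d' n X d)
  then have "g X I = max (g N I) (g X N)" by (intro g_exact) auto
  then show ?case using step by auto
qed

text \<open>Take \<open>N\<close> maximal such that \<open>X/N\<close> still has the dimension of \<open>X/I\<close>; then \<open>X/N\<close> is critical.
  Partitivity makes this descent terminate.\<close>

lemma critical_quotient:
  assumes "I \<in> \<L>" "X \<in> \<L>" "I \<subset> X"
  obtains N where "N \<in> \<L>" "I \<subseteq> N" "N \<subset> X" "g X N = g X I" "g N I \<le> g X I"
    "\<And>Q. Q \<in> \<L> \<Longrightarrow> N \<subset> Q \<Longrightarrow> Q \<subseteq> X \<Longrightarrow> g X Q < g X I"
proof -
  let ?F = "{N \<in> \<L>. I \<subseteq> N \<and> N \<subset> X \<and> g X N = g X I}"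
  have "I \<in> ?F" using assms by auto
  then obtain N where N: "N \<in> ?F" "\<And>J. J \<in> ?F \<Longrightarrow> N \<subseteq> J \<Longrightarrow> J = N"
    using maximal[of ?F] by auto
  have ex: "g X I = max (g N I) (g X N)" using N assms by (intro g_exact) auto
  show thesis
  proof (rule that)
    show "N \<in> \<L>" "I \<subseteq> N" "N \<subset> X" "g X N = g X I" "g N I \<le> g X I" using N ex by auto
    fix Q assume Q: "Q \<in> \<L>" "N \<subset> Q" "Q \<subseteq> X"
    show "g X Q < g X I"
    proof (cases "Q = X")
      case True then show ?thesis using g_refl g_nonneg[of X I] assms by force
    next
      case False
      have "g X N = max (g Q N) (g X Q)" using N Q assms by (intro g_exact) auto
      moreover have "g X Q \<noteq> g X I" using N(2)[of Q] Q False N(1) by auto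
      ultimately show ?thesis using N(1) by auto
    qed
  qed
qed

text \<open>Split off a critical top factor of full dimension. If the remaining part has smaller
  dimension, the outer induction applies. Otherwise a chain in it, prolonged by the old top, is one
  step longer, so the bound from partitivity drops and the inner induction applies.\<close>

lemma critical_series_exists:
  assumes I: "I \<in> \<L>" and "X \<in> \<L>" "I \<subseteq> X"
  shows "\<exists>d n. critical_series I X d n"
  using assms(2,3)
\<comment> \<open>The summand 1 lets \<open>nat\<close> distinguish the dimension -1 of the zero
  quotient from 0.\<close>
proof (induction "nat (g X I + 1)" arbitrary: X rule: less_induct)
  case less
  define bdd where "bdd X b \<longleftrightarrow> (\<forall>n C. C 0 = X \<and> (\<forall>i\<le>n. C i \<in> \<L> \<and> I \<subseteq> C i) \<and>
        (\<forall>i<n. C (Suc i) \<subset> C i \<and> g (C i) (C (Suc i)) = g X I) \<longrightarrow> n \<le> b)" for X b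
  have "\<exists>d n. critical_series I Z d n" if "Z \<in> \<L>" "I \<subseteq> Z" "g Z I = g X I" "bdd Z b" for Z b
    using that
  proof (induction b arbitrary: Z rule: less_induct)
    case (less b Z)
    show ?case
    proof (cases "Z = I")
      case True then show ?thesis using critical_series.refl[OF I] by auto
    next
      case False
      then have "I \<subset> Z" using less by auto
      from critical_quotient[OF I \<open>Z \<in> \<L>\<close> this]
      obtain N where N: "N \<in> \<L>" "I \<subseteq> N" "N \<subset> Z" "g Z N = g Z I" "g N I \<le> g Z I"
        "\<And>Q. Q \<in> \<L> \<Longrightarrow> N \<subset> Q \<Longrightarrow> Q \<subseteq> Z \<Longrightarrow> g Z Q < g Z I" by metis
      have "\<exists>d n. critical_series I N d n"
      proof (cases "g N I < g X I")
        case True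
        have "0 \<le> g Z I" using g_nonneg[OF \<open>Z \<in> \<L>\<close> I \<open>I \<subset> Z\<close>] .
        then show ?thesis using True N less.prems \<open>\<And>Xa. \<lbrakk>nat (g Xa I + 1) < nat (g X I + 1); Xa \<in> \<L>; I \<subseteq> Xa\<rbrakk> \<Longrightarrow> \<exists>d n. critical_series I Xa d n\<close>[of N]
          by auto
      next
        case False
        then have eq: "g N I = g X I" using N less.prems by auto
        have Suc_le: "Suc n \<le> b"
          if C: "C 0 = N" "\<forall>i\<le>n. C i \<in> \<L> \<and> I \<subseteq> C i"
            "\<forall>i<n. C (Suc i) \<subset> C i \<and> g (C i) (C (Suc i)) = g N I" for n C
        proof -
          \<comment> \<open>The chain below \<open>N\<close> prolonged at the top by
            \<open>Z\<close>; its new factor \<open>Z/N\<close> has full dimension.\<close>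
          define C' where "C' i = (case i of 0 \<Rightarrow> Z | Suc j \<Rightarrow> C j)" for i
          have "\<forall>i\<le>Suc n. C' i \<in> \<L> \<and> I \<subseteq> C' i"
            using C less.prems unfolding C'_def by (auto split: nat.split)
          moreover have "\<forall>i<Suc n. C' (Suc i) \<subset> C' i \<and> g (C' i) (C' (Suc i)) = g Z I"
            using C less.prems N eq unfolding C'_def by (auto split: nat.split)
          moreover have "C' 0 = Z" unfolding C'_def by simp
          ultimately show ?thesis using less.prems(4) unfolding bdd_def by blast
        qed
        \<comment> \<open>The chain of length zero at \<open>N\<close> already shows that
          \<open>b\<close> is positive, so that \<open>b - 1\<close> is a genuine decrease.\<close>
        have "Suc 0 \<le> b" by (rule Suc_le[of "\<lambda>_. N" 0]) (use N in auto)
        then have "b - 1 < b" by auto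
        moreover have "bdd N (b - 1)" unfolding bdd_def using Suc_le by (metis Suc_leD Suc_pred' diff_Suc_1 diff_le_mono)
        ultimately show ?thesis using less.IH[of "b - 1" N] N eq by auto
      qed
      then obtain d n where dn: "critical_series I N d n" by auto
      have "d \<le> g Z I" using critical_seriesD[OF dn] N by auto
      then have "critical_series I Z (g Z I) (Suc n)"
        using critical_series.step[OF dn, of Z "g Z I"] N less.prems by auto
      then show ?thesis by auto
    qed
  qed
  moreover obtain b where "bdd X b" using partitive[of X I] less I unfolding bdd_def by blast
  ultimately show ?case using less.prems by blast
qed

text \<open>\<open>m\<close> counts factors of dimension exactly \<open>e\<close> above a base of
  dimension at most \<open>e\<close> over \<open>I\<close>. The slack in the base allows
  \<open>I\<close> to be replaced by a smaller ideal without touching the rest of the chain.\<close>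

inductive dim_chain :: "int \<Rightarrow> 's set \<Rightarrow> 's set \<Rightarrow> nat \<Rightarrow> bool" for e I where
  base: "A \<in> \<L> \<Longrightarrow> I \<subseteq> A \<Longrightarrow> g A I \<le> e \<Longrightarrow> dim_chain e I A 0"
| step: "dim_chain e I A' m \<Longrightarrow> A \<in> \<L> \<Longrightarrow> A' \<subset> A \<Longrightarrow> g A A' = e \<Longrightarrow> dim_chain e I A (Suc m)"

lemma dim_chainD:
  assumes "I \<in> \<L>" "dim_chain e I A m" shows "A \<in> \<L> \<and> I \<subseteq> A \<and> g A I \<le> e"
  using assms(2)
proof (induction rule: dim_chain.induct)
  case (step A' m A)
  then have "g A I = max (g A' I) (g A A')" using assms(1) by (intro g_exact) auto
  then show ?case using step by auto
qed auto

text \<open>Enlarging the top member only thickens the last factor, and exactness keeps its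
  dimension at \<open>e\<close>; for a chain of length zero the slack in the base absorbs the
  change.\<close>

lemma dim_chain_mono:
  assumes I: "I \<in> \<L>" and c: "dim_chain e I A m" and B: "B \<in> \<L>" "A \<subseteq> B" "g B A \<le> e"
  shows "dim_chain e I B m"
  using c
proof cases
  case base
  have "g B I = max (g A I) (g B A)" using B I base by (intro g_exact) auto
  then show ?thesis using base B by (auto intro!: dim_chain.base)
next
  case (step A' n)
  have "A' \<in> \<L>" using dim_chainD[OF I step(2)] by auto
  then have "g B A' = max (g A A') (g B A)" using B I step by (intro g_exact) auto
  then have "g B A' = e" using step B by auto
  moreover have "A' \<subset> B" using step B by auto
  ultimately show ?thesis using step(1,2) B(1) by (auto intro: dim_chain.step)
qed

lemma dim_chain_bottom:
  assumes I: "I \<in> \<L>" and J: "J \<in> \<L>" "I \<subseteq> J" "g J I \<le> e" and c: "dim_chain e J A m"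
  shows "dim_chain e I A m"
  using c
proof (induction rule: dim_chain.induct)
  case (base A)
  have "g A I = max (g J I) (g A J)" using I J base by (intro g_exact) auto
  then show ?case using base J by (intro dim_chain.base) auto
qed (auto intro: dim_chain.step)

text \<open>The base of the chain contains \<open>J\<close>, so over \<open>I\<close> it has
  dimension exactly \<open>e\<close> and becomes a factor of its own, with \<open>I\<close> as new
  base. This is the strict decrease that drives the main induction.\<close>

lemma dim_chain_bottom_strict:
  assumes I: "I \<in> \<L>" and J: "J \<in> \<L>" "I \<subset> J" "g J I = e" and c: "dim_chain e J A m"
  shows "dim_chain e I A (Suc m)"
  using c
proof (induction rule: dim_chain.induct)
  case (base A)
  have "0 \<le> e" using g_nonneg[of J I] I J by auto
  then have "dim_chain e I I 0" using I by (auto intro!: dim_chain.base simp: g_refl)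
  moreover have "g A I = max (g J I) (g A J)" using I J base by (intro g_exact) auto
  then have "g A I = e" using base J by auto
  moreover have "I \<subset> A" using base J by auto
  ultimately show ?case using base J by (auto intro: dim_chain.step)
qed (auto intro: dim_chain.step)

text \<open>Intersecting with \<open>N\<close> costs at most one step of the chain when \<open>X/N\<close> is critical.\<close>

lemma dim_chain_Int:
  assumes I: "I \<in> \<L>" and e: "0 \<le> e" and N: "N \<in> \<L>" "I \<subseteq> N" and X: "X \<in> \<L>" "N \<subset> X"
    and crit: "\<And>Q. Q \<in> \<L> \<Longrightarrow> N \<subset> Q \<Longrightarrow> Q \<subseteq> X \<Longrightarrow> g X Q < g X N"
    and c: "dim_chain e I A m" and AX: "A \<subseteq> X"
  shows "dim_chain e I (A \<inter> N) m \<or> (\<not> A \<subseteq> N \<and> (\<exists>m'. m = Suc m' \<and> dim_chain e I (A \<inter> N) m'))"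
  using c AX
proof (induction rule: dim_chain.induct)
  case (base A)
  have "g A I = max (g (A \<inter> N) I) (g A (A \<inter> N))" using base I N by (intro g_exact Int_closed) auto
  then have "dim_chain e I (A \<inter> N) 0" using base N by (intro dim_chain.base Int_closed) auto
  then show ?case by auto
next
  case (step A' m A)
  have A': "A' \<in> \<L>" "I \<subseteq> A'" "g A' I \<le> e" using dim_chainD[OF I step.hyps(1)] by auto
  \<comment> \<open>\<open>A' + (A \<inter> N)\<close> cuts the factor \<open>A/A'\<close> in two.
    The lower piece is isomorphic to \<open>(A \<inter> N)/(A' \<inter> N)\<close>, the part visible
    inside \<open>N\<close>; by exactness at least one piece has dimension \<open>e\<close>.\<close>
  let ?P = "pl A' (A \<inter> N)"
  have AN: "A \<inter> N \<in> \<L>" using step N by (intro Int_closed) auto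
  have A'N: "A' \<inter> N \<in> \<L>" using A' N by (intro Int_closed) auto
  have P: "?P \<in> \<L>" "A' \<subseteq> ?P" "A \<inter> N \<subseteq> ?P" using A' AN pl_closed pl_upper by auto
  have PA: "?P \<subseteq> A" using A' AN step by (intro pl_least) auto
  have ex: "g A A' = max (g ?P A') (g A ?P)" using A' P PA step by (intro g_exact) auto
  have comm: "pl (A \<inter> N) A' = ?P"
    using A' AN pl_closed pl_upper by (intro equalityI pl_least) auto
  have dia: "g ?P A' = g (A \<inter> N) (A' \<inter> N)"
  proof -
    have "A \<inter> N \<inter> A' = A' \<inter> N" using step by auto
    then show ?thesis using g_diamond[OF AN A'(1)] comm by simp
  qed
  show ?case
  proof (cases "g A ?P < e")
    case True
    \<comment> \<open>The lower piece carries the dimension \<open>e\<close>, so the step survives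
      the intersection with \<open>N\<close>.\<close>
    then have ge: "g (A \<inter> N) (A' \<inter> N) = e" using ex dia step by auto
    then have "A' \<inter> N \<noteq> A \<inter> N" using g_refl[OF AN] e by auto
    then have lt: "A' \<inter> N \<subset> A \<inter> N" using step by auto
    have up: "dim_chain e I (A \<inter> N) (Suc m')" if "dim_chain e I (A' \<inter> N) m'" for m'
      using dim_chain.step[OF that AN lt ge] .
    have "A' \<subseteq> X" using step by auto
    from step.IH[OF this] show ?thesis
    proof
      assume *: "\<not> A' \<subseteq> N \<and> (\<exists>m'. m = Suc m' \<and> dim_chain e I (A' \<inter> N) m')"
      then have "\<not> A \<subseteq> N" using step by auto
      then show ?thesis using * up by auto
    qed (use up in auto)
  next
    case False
    then have eqe: "g A ?P = e" using ex step by auto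
    have nAN: "\<not> A \<subseteq> N"
    proof
      assume "A \<subseteq> N"
      then have "A \<inter> N = A" by auto
      then have "?P = A" using P PA by auto
      then show False using eqe g_refl[of A] step e by auto
    qed
    show ?thesis
    proof (cases "A' \<subseteq> N")
      case True
      \<comment> \<open>The chain leaves \<open>N\<close> at this step: \<open>A'\<close> lies in
        \<open>N\<close> and \<open>A\<close> does not. The step is lost, but the chain below it can
        be enlarged to end in \<open>A \<inter> N\<close>.\<close>
      then have "A' \<subseteq> A \<inter> N" "A' \<inter> N = A'" using step by auto
      then have "g (A \<inter> N) A' \<le> e" using dia ex step by auto
      then have "dim_chain e I (A \<inter> N) m" using dim_chain_mono[OF I step.hyps(1) AN] \<open>A' \<subseteq> A \<inter> N\<close> by auto
      then show ?thesis using nAN by auto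
    next
      case False
      \<comment> \<open>If the chain had left \<open>N\<close> earlier, criticality would make
        \<open>X/T\<close> of smaller dimension than \<open>X/N\<close>, which is at most
        \<open>e\<close> since it is the dimension of \<open>A'/(A' \<inter> N)\<close>. The upper
        piece embeds in \<open>X/T\<close>, so it could not have dimension \<open>e\<close>.\<close>
      let ?T = "pl A' N"
      have A'X: "A' \<subseteq> X" using step by auto
      have T: "?T \<in> \<L>" "A' \<subseteq> ?T" "N \<subseteq> ?T" "?T \<subseteq> X" using A' N A'X X pl_closed pl_upper pl_least[of A' N X] by auto
      then have "N \<subset> ?T" using False by auto
      then have lt: "g X ?T < g X N" using crit T by auto
      have "g X N = max (g ?T N) (g X ?T)" using T N X by (intro g_exact) auto
      then have "g X N = g A' (A' \<inter> N)" using lt g_diamond[OF A'(1) N(1)] by auto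
      moreover have "g A' I = max (g (A' \<inter> N) I) (g A' (A' \<inter> N))" using A' A'N N I by (intro g_exact) auto
      ultimately have le: "g X N \<le> e" using A' by auto
      have AT: "A \<inter> ?T = ?P"
      proof
        show "A \<inter> ?T \<subseteq> ?P" using modular[of A A' N] A' N step by auto
        have "?P \<subseteq> ?T" using T AN A' by (intro pl_least) auto
        then show "?P \<subseteq> A \<inter> ?T" using PA by auto
      qed
      let ?Q = "pl A ?T"
      have Q: "?Q \<in> \<L>" "?T \<subseteq> ?Q" "?Q \<subseteq> X" using T step X pl_closed pl_upper pl_least[of A ?T X] by auto
      have "g X ?T = max (g ?Q ?T) (g X ?Q)" using Q T X by (intro g_exact) auto
      moreover have "g ?Q ?T = g A ?P" using g_diamond[of A ?T] T step AT by auto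
      ultimately have "g A ?P < e" using lt le by auto
      then show ?thesis using \<open>\<not> g A ?P < e\<close> by auto
    qed
  qed
qed

text \<open>Descending through the series, each critical factor uses up at most one step of the
  chain, whatever the dimension of that factor is.\<close>

lemma dim_chain_le_critical_series:
  assumes "critical_series I X d n" and e: "0 \<le> e" and "dim_chain e I A m" "A \<subseteq> X"
  shows "m \<le> n"
  using assms(1,3,4)
proof (induction arbitrary: A m rule: critical_series.induct)
  case refl
  from refl.prems show ?case
  proof cases
    case (step A' m')
    have "I \<subseteq> A'" using dim_chainD[OF refl(1) step(2)] by auto
    then show ?thesis using step refl by auto
  qed auto
next
  case (step N d' n X d)
  have N: "I \<in> \<L>" "N \<in> \<L>" "I \<subseteq> N" using critical_seriesD[OF step.hyps(1)] by auto
  have "dim_chain e I (A \<inter> N) m \<or> (\<not> A \<subseteq> N \<and> (\<exists>m'. m = Suc m' \<and> dim_chain e I (A \<inter> N) m'))"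
    using N step e by (intro dim_chain_Int) auto
  then show ?case using step.IH[of "A \<inter> N"] by force
qed

text \<open>The number \<open>\<lambda>\<^sub>e(I)\<close> of the overview. \<open>Max\<close> is
  applied to a finite nonempty set by \<open>dim_chain_bounded\<close>, once the lattice has a
  top.\<close>

definition chain_length :: "'s set \<Rightarrow> int \<Rightarrow> nat" where
  "chain_length I e = Max {m. \<exists>A. dim_chain e I A m}"

text \<open>Reversed, so that the lexicographic order inspects large dimensions first. These entries
  cannot rise when \<open>I\<close> grows, whereas the entries below the dimension of the
  enlargement may.\<close>

definition length_vector :: "nat \<Rightarrow> 's set \<Rightarrow> nat list" where
  "length_vector b I = map (\<lambda>e. chain_length I (int e)) (rev [0..<b])"

section \<open>Chain lengths in a lattice with largest element\<close>

context
  fixes X assumes X: "X \<in> \<L>" and top: "\<And>A. A \<in> \<L> \<Longrightarrow> A \<subseteq> X"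
begin

lemma dim_chain_bounded:
  assumes "I \<in> \<L>" "0 \<le> e"
  shows "finite {m. \<exists>A. dim_chain e I A m}" "{m. \<exists>A. dim_chain e I A m} \<noteq> {}"
proof -
  obtain d n where dn: "critical_series I X d n" using critical_series_exists[OF assms(1) X top[OF assms(1)]] by auto
  have "{m. \<exists>A. dim_chain e I A m} \<subseteq> {..n}"
    using dim_chain_le_critical_series[OF dn assms(2)] dim_chainD[OF assms(1)] top by auto
  then show "finite {m. \<exists>A. dim_chain e I A m}" by (rule finite_subset) auto
  have "dim_chain e I I 0" using assms by (auto intro!: dim_chain.base simp: g_refl)
  then show "{m. \<exists>A. dim_chain e I A m} \<noteq> {}" by auto
qed

lemma chain_length_attained:
  assumes "I \<in> \<L>" "0 \<le> e" obtains A where "dim_chain e I A (chain_length I e)"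
  using Max_in[OF dim_chain_bounded[OF assms]] unfolding chain_length_def by auto

lemma chain_length_ge:
  assumes "I \<in> \<L>" "0 \<le> e" "dim_chain e I A m" shows "m \<le> chain_length I e"
  unfolding chain_length_def using assms(3) by (intro Max_ge dim_chain_bounded assms) auto

text \<open>The point where a bound on critical series turns into a bound on every entry of the
  length vector.\<close>

lemma chain_length_le:
  assumes "critical_series I X d n" "0 \<le> e" shows "chain_length I e \<le> n"
proof -
  have I: "I \<in> \<L>" using critical_seriesD[OF assms(1)] by auto
  obtain A where A: "dim_chain e I A (chain_length I e)" using chain_length_attained[OF I assms(2)] .
  then show ?thesis using dim_chain_le_critical_series[OF assms A] dim_chainD[OF I A] top by auto
qed

lemma chain_length_mono:
  assumes "I \<in> \<L>" "J \<in> \<L>" "I \<subseteq> J" "g J I \<le> e" "0 \<le> e"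
  shows "chain_length J e \<le> chain_length I e"
proof -
  obtain A where A: "dim_chain e J A (chain_length J e)" using chain_length_attained assms by blast
  then show ?thesis using dim_chain_bottom[OF assms(1-4) A] chain_length_ge assms by blast
qed

lemma chain_length_strict:
  assumes "I \<in> \<L>" "J \<in> \<L>" "I \<subset> J" "g J I = e"
  shows "chain_length J e < chain_length I e"
proof -
  have e: "0 \<le> e" using assms g_nonneg by blast
  obtain A where A: "dim_chain e J A (chain_length J e)" using chain_length_attained assms e by blast
  then show ?thesis using dim_chain_bottom_strict[OF assms A] chain_length_ge assms e Suc_le_lessD by blast
qed

end

end

section \<open>Lexicographic comparison of length vectors\<close>

lemma lex_less_than_pointwise:
  assumes "length xs = length ys" "i < length xs" "\<And>j. j < i \<Longrightarrow> xs ! j \<le> ys ! j" "xs ! i < ys ! i"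
  shows "(xs, ys) \<in> lex (less_than)"
  using assms
proof (induction xs arbitrary: ys i)
  case (Cons x xs)
  then obtain y ys' where ys: "ys = y # ys'" by (cases ys) auto
  show ?case
  proof (cases "x < y")
    case True then show ?thesis using Cons ys by auto
  next
    case False
    then have i: "i \<noteq> 0" using Cons.prems(4) ys by (cases i) auto
    then have "x = y" using Cons.prems(3)[of 0] ys False by auto
    moreover have "(xs, ys') \<in> lex less_than"
      using Cons.prems ys i Cons.prems(3)[of "Suc _"] by (intro Cons.IH[of ys' "i - 1"]) (auto simp: nth_Cons')
    ultimately show ?thesis using ys by auto
  qed
qed auto

text \<open>The order \<open>lexord\<close> is total and so yields a maximum, but it is not
  well-founded on lists of varying length. For lists of one length it coincides with
  \<open>lex\<close>, which is well-founded.\<close>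

lemma finite_lex_maximum:
  fixes V :: "nat list set"
  assumes "finite V" "V \<noteq> {}" "\<And>v. v \<in> V \<Longrightarrow> length v = b"
  obtains m where "m \<in> V" "\<And>v. v \<in> V \<Longrightarrow> v = m \<or> (v, m) \<in> lex less_than"
proof -
  have "\<exists>m\<in>V. \<forall>v\<in>V. v = m \<or> (v, m) \<in> lexord less_than"
    using assms(1,2)
  proof (induction rule: finite_ne_induct)
    case (insert x F)
    then obtain m where m: "m \<in> F" "\<forall>v\<in>F. v = m \<or> (v, m) \<in> lexord less_than" by auto
    consider "(x, m) \<in> lexord less_than" | "x = m" | "(m, x) \<in> lexord less_than"
      using lexord_linear[of less_than x m] by fastforce
    then show ?case
    proof cases
      case 3
      have "v = x \<or> (v, x) \<in> lexord less_than" if "v \<in> F" for v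
        using m(2) that 3 lexord_trans[of v m less_than x] by auto
      then show ?thesis by auto
    qed (use m in auto)
  qed auto
  then show thesis using that assms(3) by (auto simp: lexord_lex)
qed

lemma (in dimension_lattice) length_vector_less:
  assumes X: "X \<in> \<L>" and top: "\<And>A. A \<in> \<L> \<Longrightarrow> A \<subseteq> X"
    and IJ: "I \<in> \<L>" "J \<in> \<L>" "I \<subset> J" and b: "g J I < int b"
  shows "(length_vector b J, length_vector b I) \<in> lex less_than"
proof -
  have e: "0 \<le> g J I" using IJ g_nonneg by blast
  \<comment> \<open>The position of the entry for dimension \<open>g J I\<close> in the reversed
    list; the positions before it belong to larger dimensions.\<close>
  define i where "i = b - 1 - nat (g J I)"
  have i: "i < b" "int (b - 1 - i) = g J I" using e b unfolding i_def by auto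
  have nth: "length_vector b K ! j = chain_length K (int (b - 1 - j))" if "j < b" for j K
    using that unfolding length_vector_def by (simp add: rev_nth)
  show ?thesis
  proof (rule lex_less_than_pointwise[of _ _ i])
    show "length (length_vector b J) = length (length_vector b I)" "i < length (length_vector b J)"
      using i by (auto simp: length_vector_def)
    show "length_vector b J ! i < length_vector b I ! i"
      using nth[OF i(1)] i(2) chain_length_strict[OF X top IJ] by simp
    fix j assume "j < i"
    then have "g J I \<le> int (b - 1 - j)" "j < b" using i by auto
    then show "length_vector b J ! j \<le> length_vector b I ! j"
      using nth chain_length_mono[OF X top IJ(1,2)] IJ(3) by (simp add: psubset_imp_subset)
  qed
qed

section \<open>The Hilbert basis theorem for a central extension element\<close>

text \<open>The polynomial ring over \<open>S\<close> is never formed; everything happens in its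
  image in \<open>T\<close> under evaluation at the central element \<open>x\<close>. Algebraic and
  transcendental \<open>x\<close> are thereby treated alike.\<close>

locale central_extension = S: ring S + T: ring T
  for S :: "('s, 'c) ring_scheme" and T :: "('t, 'd) ring_scheme" +
  fixes h and x
  assumes h: "h \<in> ring_hom S T" and x: "x \<in> carrier T"
    and x_comm: "t \<in> carrier T \<Longrightarrow> t \<otimes>\<^bsub>T\<^esub> x = x \<otimes>\<^bsub>T\<^esub> t"
begin

lemma h_simps [simp]:
  "s \<in> carrier S \<Longrightarrow> h s \<in> carrier T"
  "\<lbrakk>s \<in> carrier S; s' \<in> carrier S\<rbrakk> \<Longrightarrow> h (s \<oplus>\<^bsub>S\<^esub> s') = h s \<oplus>\<^bsub>T\<^esub> h s'"
  "\<lbrakk>s \<in> carrier S; s' \<in> carrier S\<rbrakk> \<Longrightarrow> h (s \<otimes>\<^bsub>S\<^esub> s') = h s \<otimes>\<^bsub>T\<^esub> h s'"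
  "h \<one>\<^bsub>S\<^esub> = \<one>\<^bsub>T\<^esub>" "h \<zero>\<^bsub>S\<^esub> = \<zero>\<^bsub>T\<^esub>"
  using h ring_hom_zero[OF h S.ring_axioms T.ring_axioms] by (auto simp: ring_hom_def)

lemma pow_closed [simp]: "x [^]\<^bsub>T\<^esub> (n::nat) \<in> carrier T"
  using x by simp

lemma pow_comm: "t \<in> carrier T \<Longrightarrow> t \<otimes>\<^bsub>T\<^esub> x [^]\<^bsub>T\<^esub> (n::nat) = x [^]\<^bsub>T\<^esub> n \<otimes>\<^bsub>T\<^esub> t"
proof (induction n)
  case (Suc n)
  have "t \<otimes>\<^bsub>T\<^esub> x [^]\<^bsub>T\<^esub> Suc n = (t \<otimes>\<^bsub>T\<^esub> x [^]\<^bsub>T\<^esub> n) \<otimes>\<^bsub>T\<^esub> x"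
    using Suc.prems x by (simp add: T.m_assoc)
  also have "\<dots> = x [^]\<^bsub>T\<^esub> n \<otimes>\<^bsub>T\<^esub> (t \<otimes>\<^bsub>T\<^esub> x)"
    unfolding Suc.IH[OF Suc.prems] using Suc.prems x by (simp add: T.m_assoc)
  also have "\<dots> = x [^]\<^bsub>T\<^esub> Suc n \<otimes>\<^bsub>T\<^esub> t"
    using Suc.prems x by (simp add: T.m_assoc x_comm[OF Suc.prems])
  finally show ?case .
qed simp

text \<open>Values at \<open>x\<close> of polynomials of degree strictly less than \<open>n\<close>,
  with coefficients from the image of \<open>S\<close>. The strict bound makes
  \<open>polys n\<close> the lower order terms of a polynomial of degree \<open>n\<close>.\<close>

primrec polys :: "nat \<Rightarrow> 't set" where
  "polys 0 = {\<zero>\<^bsub>T\<^esub>}"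
| "polys (Suc n) = {h s \<otimes>\<^bsub>T\<^esub> x [^]\<^bsub>T\<^esub> n \<oplus>\<^bsub>T\<^esub> p | s p. s \<in> carrier S \<and> p \<in> polys n}"

lemma polys_closed: "p \<in> polys n \<Longrightarrow> p \<in> carrier T"
  by (induction n arbitrary: p) auto

lemma polys_zero: "\<zero>\<^bsub>T\<^esub> \<in> polys n"
proof (induction n)
  case (Suc n)
  then show ?case by (auto intro!: exI[of _ "\<zero>\<^bsub>S\<^esub>"] exI[of _ "\<zero>\<^bsub>T\<^esub>"])
qed simp

lemma polys_Suc: "polys n \<subseteq> polys (Suc n)"
proof
  fix p assume p: "p \<in> polys n"
  then have "p = h \<zero>\<^bsub>S\<^esub> \<otimes>\<^bsub>T\<^esub> x [^]\<^bsub>T\<^esub> n \<oplus>\<^bsub>T\<^esub> p" using polys_closed by simp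
  then show "p \<in> polys (Suc n)" using p S.zero_closed by (subst polys.simps) blast
qed

lemma polys_mono: "n \<le> m \<Longrightarrow> polys n \<subseteq> polys m"
  using lift_Suc_mono_le[of polys, OF polys_Suc] by auto

lemma polys_add: "p \<in> polys n \<Longrightarrow> q \<in> polys n \<Longrightarrow> p \<oplus>\<^bsub>T\<^esub> q \<in> polys n"
proof (induction n arbitrary: p q)
  case (Suc n)
  then obtain s p' s' q' where *: "p = h s \<otimes>\<^bsub>T\<^esub> x [^]\<^bsub>T\<^esub> n \<oplus>\<^bsub>T\<^esub> p'" "s \<in> carrier S" "p' \<in> polys n"
    "q = h s' \<otimes>\<^bsub>T\<^esub> x [^]\<^bsub>T\<^esub> n \<oplus>\<^bsub>T\<^esub> q'" "s' \<in> carrier S" "q' \<in> polys n" by auto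
  then have "p \<oplus>\<^bsub>T\<^esub> q = h (s \<oplus>\<^bsub>S\<^esub> s') \<otimes>\<^bsub>T\<^esub> x [^]\<^bsub>T\<^esub> n \<oplus>\<^bsub>T\<^esub> (p' \<oplus>\<^bsub>T\<^esub> q')"
    using polys_closed[of p' n] polys_closed[of q' n] by (simp add: T.l_distr T.a_ac)
  then show ?case using Suc.IH[of p' q'] * S.a_closed by (subst polys.simps) blast
qed simp

lemma polys_mult: "p \<in> polys n \<Longrightarrow> s \<in> carrier S \<Longrightarrow> p \<otimes>\<^bsub>T\<^esub> h s \<in> polys n"
proof (induction n arbitrary: p)
  case (Suc n)
  then obtain s' p' where *: "p = h s' \<otimes>\<^bsub>T\<^esub> x [^]\<^bsub>T\<^esub> n \<oplus>\<^bsub>T\<^esub> p'" "s' \<in> carrier S" "p' \<in> polys n" by auto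
  then have "p \<otimes>\<^bsub>T\<^esub> h s = h (s' \<otimes>\<^bsub>S\<^esub> s) \<otimes>\<^bsub>T\<^esub> x [^]\<^bsub>T\<^esub> n \<oplus>\<^bsub>T\<^esub> p' \<otimes>\<^bsub>T\<^esub> h s"
    using polys_closed[of p' n] Suc.prems pow_comm[of "h s" n] by (simp add: T.l_distr T.m_assoc)
  then show ?case using Suc.IH[of p'] * Suc.prems S.m_closed by (subst polys.simps) blast
qed simp

lemma polys_shift: "p \<in> polys n \<Longrightarrow> p \<otimes>\<^bsub>T\<^esub> x \<in> polys (Suc n)"
proof (induction n arbitrary: p)
  case 0 then show ?case using polys_zero[of "Suc 0"] x by auto
next
  case (Suc n)
  then obtain s' p' where *: "p = h s' \<otimes>\<^bsub>T\<^esub> x [^]\<^bsub>T\<^esub> n \<oplus>\<^bsub>T\<^esub> p'" "s' \<in> carrier S" "p' \<in> polys n" by auto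
  then have "p \<otimes>\<^bsub>T\<^esub> x = h s' \<otimes>\<^bsub>T\<^esub> x [^]\<^bsub>T\<^esub> Suc n \<oplus>\<^bsub>T\<^esub> p' \<otimes>\<^bsub>T\<^esub> x"
    using polys_closed[of p' n] x by (simp add: T.l_distr T.m_assoc)
  then show ?case using Suc.IH[of p'] * by (subst polys.simps) blast
qed

lemma polys_minus: "p \<in> polys n \<Longrightarrow> \<ominus>\<^bsub>T\<^esub> p \<in> polys n"
proof -
  assume p: "p \<in> polys n"
  have "h (\<ominus>\<^bsub>S\<^esub> \<one>\<^bsub>S\<^esub>) \<oplus>\<^bsub>T\<^esub> \<one>\<^bsub>T\<^esub> = \<zero>\<^bsub>T\<^esub>"
    using h_simps(2)[of "\<ominus>\<^bsub>S\<^esub> \<one>\<^bsub>S\<^esub>" "\<one>\<^bsub>S\<^esub>"] by (simp add: S.l_neg)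
  then have "h (\<ominus>\<^bsub>S\<^esub> \<one>\<^bsub>S\<^esub>) = \<ominus>\<^bsub>T\<^esub> \<one>\<^bsub>T\<^esub>" by (simp add: T.minus_equality)
  then show ?thesis using polys_mult[OF p, of "\<ominus>\<^bsub>S\<^esub> \<one>\<^bsub>S\<^esub>"] polys_closed[OF p] by (simp add: T.r_minus)
qed

text \<open>The leading coefficient ideals of Hilbert's proof. An element of \<open>T\<close> may be
  a value of several polynomials, so a coefficient counts as soon as one such polynomial has
  it.\<close>

definition leading :: "'t set \<Rightarrow> nat \<Rightarrow> 's set" where
  "leading J n = {s \<in> carrier S. \<exists>p\<in>polys n. h s \<otimes>\<^bsub>T\<^esub> x [^]\<^bsub>T\<^esub> n \<oplus>\<^bsub>T\<^esub> p \<in> J}"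

lemma leading_right_ideal:
  assumes J: "right_ideal T J" shows "right_ideal S (leading J n)"
  unfolding right_ideal_def
proof (intro conjI ballI)
  show "leading J n \<subseteq> carrier S" unfolding leading_def by auto
  show "\<zero>\<^bsub>S\<^esub> \<in> leading J n" unfolding leading_def
    using J polys_zero[of n] unfolding right_ideal_def by (auto intro!: bexI[of _ "\<zero>\<^bsub>T\<^esub>"])
next
  fix s s' assume "s \<in> leading J n" "s' \<in> leading J n"
  then obtain p p' where *: "s \<in> carrier S" "p \<in> polys n" "h s \<otimes>\<^bsub>T\<^esub> x [^]\<^bsub>T\<^esub> n \<oplus>\<^bsub>T\<^esub> p \<in> J"
     "s' \<in> carrier S" "p' \<in> polys n" "h s' \<otimes>\<^bsub>T\<^esub> x [^]\<^bsub>T\<^esub> n \<oplus>\<^bsub>T\<^esub> p' \<in> J" unfolding leading_def by auto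
  then have "(h s \<otimes>\<^bsub>T\<^esub> x [^]\<^bsub>T\<^esub> n \<oplus>\<^bsub>T\<^esub> p) \<oplus>\<^bsub>T\<^esub> (h s' \<otimes>\<^bsub>T\<^esub> x [^]\<^bsub>T\<^esub> n \<oplus>\<^bsub>T\<^esub> p') \<in> J"
    using J unfolding right_ideal_def by blast
  also have "(h s \<otimes>\<^bsub>T\<^esub> x [^]\<^bsub>T\<^esub> n \<oplus>\<^bsub>T\<^esub> p) \<oplus>\<^bsub>T\<^esub> (h s' \<otimes>\<^bsub>T\<^esub> x [^]\<^bsub>T\<^esub> n \<oplus>\<^bsub>T\<^esub> p') =
     h (s \<oplus>\<^bsub>S\<^esub> s') \<otimes>\<^bsub>T\<^esub> x [^]\<^bsub>T\<^esub> n \<oplus>\<^bsub>T\<^esub> (p \<oplus>\<^bsub>T\<^esub> p')"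
    using * polys_closed[of p n] polys_closed[of p' n] by (simp add: T.l_distr T.a_ac)
  finally show "s \<oplus>\<^bsub>S\<^esub> s' \<in> leading J n" unfolding leading_def using * polys_add by auto
next
  fix s' s assume s': "s' \<in> carrier S" and "s \<in> leading J n"
  then obtain p where *: "s \<in> carrier S" "p \<in> polys n" "h s \<otimes>\<^bsub>T\<^esub> x [^]\<^bsub>T\<^esub> n \<oplus>\<^bsub>T\<^esub> p \<in> J"
    unfolding leading_def by auto
  then have "(h s \<otimes>\<^bsub>T\<^esub> x [^]\<^bsub>T\<^esub> n \<oplus>\<^bsub>T\<^esub> p) \<otimes>\<^bsub>T\<^esub> h s' \<in> J"
    using J s' unfolding right_ideal_def by auto
  also have "(h s \<otimes>\<^bsub>T\<^esub> x [^]\<^bsub>T\<^esub> n \<oplus>\<^bsub>T\<^esub> p) \<otimes>\<^bsub>T\<^esub> h s' =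
     h (s \<otimes>\<^bsub>S\<^esub> s') \<otimes>\<^bsub>T\<^esub> x [^]\<^bsub>T\<^esub> n \<oplus>\<^bsub>T\<^esub> p \<otimes>\<^bsub>T\<^esub> h s'"
    using * s' polys_closed[of p n] pow_comm[of "h s'" n] by (simp add: T.l_distr T.m_assoc)
  finally show "s \<otimes>\<^bsub>S\<^esub> s' \<in> leading J n" unfolding leading_def using * polys_mult s' by auto
qed

text \<open>Multiplication by the central element \<open>x\<close> raises the degree and keeps the
  leading coefficient.\<close>

lemma leading_mono:
  assumes J: "right_ideal T J" and "n \<le> m" shows "leading J n \<subseteq> leading J m"
proof -
  have "leading J n \<subseteq> leading J (Suc n)" for n
  proof
    fix s assume "s \<in> leading J n"
    then obtain p where *: "s \<in> carrier S" "p \<in> polys n" "h s \<otimes>\<^bsub>T\<^esub> x [^]\<^bsub>T\<^esub> n \<oplus>\<^bsub>T\<^esub> p \<in> J"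
      unfolding leading_def by auto
    then have "(h s \<otimes>\<^bsub>T\<^esub> x [^]\<^bsub>T\<^esub> n \<oplus>\<^bsub>T\<^esub> p) \<otimes>\<^bsub>T\<^esub> x \<in> J" using J x unfolding right_ideal_def by auto
    also have "(h s \<otimes>\<^bsub>T\<^esub> x [^]\<^bsub>T\<^esub> n \<oplus>\<^bsub>T\<^esub> p) \<otimes>\<^bsub>T\<^esub> x = h s \<otimes>\<^bsub>T\<^esub> x [^]\<^bsub>T\<^esub> Suc n \<oplus>\<^bsub>T\<^esub> p \<otimes>\<^bsub>T\<^esub> x"
      using * polys_closed[of p n] x by (simp add: T.l_distr T.m_assoc)
    finally show "s \<in> leading J (Suc n)" unfolding leading_def using polys_shift[OF *(2)] *(1) by blast
  qed
  then show ?thesis using lift_Suc_mono_le[of "leading J"] assms(2) by auto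
qed

text \<open>Hilbert's argument controls only those elements of \<open>J\<close> that are polynomial
  in \<open>x\<close>. By \<open>loc\<close> each \<open>z\<close> in \<open>J\<close> becomes
  polynomial after multiplication by some \<open>u\<close>, and multiplying by \<open>v\<close>
  recovers \<open>z\<close>. This includes the localization needed for fields in place of polynomial
  rings.\<close>

lemma right_noetherian_extension:
  assumes noeth: "right_noetherian S"
    and loc: "\<And>z. z \<in> carrier T \<Longrightarrow> \<exists>u\<in>carrier T. \<exists>v\<in>carrier T. \<exists>n. u \<otimes>\<^bsub>T\<^esub> v = \<one>\<^bsub>T\<^esub> \<and> z \<otimes>\<^bsub>T\<^esub> u \<in> polys n"
  shows "right_noetherian T"
  unfolding T.right_noetherian_iff
proof (intro allI impI)
  fix J assume J: "right_ideal T J"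
  have fg: "\<exists>X. finite X \<and> X \<subseteq> K \<and> (\<forall>J. right_ideal S J \<and> X \<subseteq> J \<longrightarrow> K \<subseteq> J)" if "right_ideal S K" for K
    using noeth that unfolding S.right_noetherian_iff S.fg_ideal_def by simp
  obtain N where N: "\<And>n. leading J n \<subseteq> leading J N"
  proof -
    have "range (leading J) \<noteq> {}" by auto
    from S.noetherian_maximal[OF noeth this] leading_right_ideal[OF J]
    obtain M where M: "M \<in> range (leading J)" "\<And>I. I \<in> range (leading J) \<Longrightarrow> M \<subseteq> I \<Longrightarrow> I = M" by blast
    then obtain N where N: "M = leading J N" by auto
    have "leading J n \<subseteq> leading J N" for n
      using M(2)[of "leading J (max n N)"] N leading_mono[OF J, of n "max n N"] leading_mono[OF J, of N "max n N"] by auto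
    then show thesis using that by auto
  qed
  obtain X where X: "\<And>n. finite (X n)" "\<And>n. X n \<subseteq> leading J n"
    "\<And>n K. right_ideal S K \<Longrightarrow> X n \<subseteq> K \<Longrightarrow> leading J n \<subseteq> K"
    using fg[OF leading_right_ideal[OF J]] by metis
  have "\<exists>t\<in>J. \<exists>p\<in>polys n. t = h s \<otimes>\<^bsub>T\<^esub> x [^]\<^bsub>T\<^esub> n \<oplus>\<^bsub>T\<^esub> p" if "s \<in> leading J n" for s n
    using that unfolding leading_def by auto
  then obtain t where t: "\<And>s n. s \<in> leading J n \<Longrightarrow> t s n \<in> J"
    "\<And>s n. s \<in> leading J n \<Longrightarrow> \<exists>p\<in>polys n. t s n = h s \<otimes>\<^bsub>T\<^esub> x [^]\<^bsub>T\<^esub> n \<oplus>\<^bsub>T\<^esub> p" by metis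
  \<comment> \<open>Beyond degree \<open>N\<close> the leading ideals are constant, so generators
    for degrees up to \<open>N\<close> suffice.\<close>
  define Y where "Y = (\<Union>n\<in>{..N}. (\<lambda>s. t s n) ` X n)"
  have YJ: "Y \<subseteq> J" unfolding Y_def using t(1) X(2) by fastforce
  have "J \<subseteq> G" if G: "right_ideal T G" "Y \<subseteq> G" for G
  proof -
    have GJ: "right_ideal T (G \<inter> J)" using T.right_ideal_Int G J by auto
    have "leading J n \<subseteq> leading (G \<inter> J) n" if "n \<le> N" for n
    proof (rule X(3)[OF leading_right_ideal[OF GJ]])
      show "X n \<subseteq> leading (G \<inter> J) n"
      proof
        fix s assume s: "s \<in> X n"
        then have sJ: "s \<in> leading J n" using X(2) by auto
        have "t s n \<in> G \<inter> J" using s that YJ G(2) unfolding Y_def by auto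
        then show "s \<in> leading (G \<inter> J) n" using t(2)[OF sJ] sJ unfolding leading_def by auto
      qed
    qed
    then have lead: "leading J n \<subseteq> leading (G \<inter> J) n" for n
      using N[of n] leading_mono[OF GJ, of N n] by (cases "n \<le> N") auto
    \<comment> \<open>Induction on the degree: subtracting an element of \<open>G \<inter> J\<close>
      with the same leading coefficient leaves an element of \<open>J\<close> of lower degree. Using
      \<open>G \<inter> J\<close> instead of \<open>G\<close> is what keeps the difference in
      \<open>J\<close>.\<close>
    have red: "polys n \<inter> J \<subseteq> G" for n
    proof (induction n)
      case 0 then show ?case using G unfolding right_ideal_def by auto
    next
      case (Suc n)
      show ?case
      proof
        fix z assume z: "z \<in> polys (Suc n) \<inter> J"
        then obtain s p where sp: "z = h s \<otimes>\<^bsub>T\<^esub> x [^]\<^bsub>T\<^esub> n \<oplus>\<^bsub>T\<^esub> p" "s \<in> carrier S" "p \<in> polys n" by auto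
        then have "s \<in> leading J n" using z unfolding leading_def by auto
        then have "s \<in> leading (G \<inter> J) n" using lead by auto
        then obtain q where q: "q \<in> polys n" "h s \<otimes>\<^bsub>T\<^esub> x [^]\<^bsub>T\<^esub> n \<oplus>\<^bsub>T\<^esub> q \<in> G" "h s \<otimes>\<^bsub>T\<^esub> x [^]\<^bsub>T\<^esub> n \<oplus>\<^bsub>T\<^esub> q \<in> J"
          unfolding leading_def by auto
        let ?w = "h s \<otimes>\<^bsub>T\<^esub> x [^]\<^bsub>T\<^esub> n \<oplus>\<^bsub>T\<^esub> q"
        have c: "p \<in> carrier T" "q \<in> carrier T" "?w \<in> carrier T" "h s \<otimes>\<^bsub>T\<^esub> x [^]\<^bsub>T\<^esub> n \<in> carrier T"
          using sp q polys_closed by auto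
        have eq: "z = (p \<oplus>\<^bsub>T\<^esub> \<ominus>\<^bsub>T\<^esub> q) \<oplus>\<^bsub>T\<^esub> ?w"
          using c by (simp add: sp(1) T.a_ac T.r_neg1 T.r_neg2)
        have "p \<oplus>\<^bsub>T\<^esub> \<ominus>\<^bsub>T\<^esub> q = z \<ominus>\<^bsub>T\<^esub> ?w"
          using c unfolding eq by (simp add: T.minus_eq T.a_assoc T.r_neg)
        moreover have "z \<ominus>\<^bsub>T\<^esub> ?w \<in> J" using T.right_ideal_diff[OF J] z q by auto
        moreover have "p \<oplus>\<^bsub>T\<^esub> \<ominus>\<^bsub>T\<^esub> q \<in> polys n" using polys_add polys_minus sp q by auto
        ultimately have "p \<oplus>\<^bsub>T\<^esub> \<ominus>\<^bsub>T\<^esub> q \<in> G" using Suc by auto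
        then show "z \<in> G" using q G(1) unfolding eq right_ideal_def by blast
      qed
    qed
    show "J \<subseteq> G"
    proof
      fix z assume z: "z \<in> J"
      then have zc: "z \<in> carrier T" using J unfolding right_ideal_def by auto
      obtain u v n where uv: "u \<in> carrier T" "v \<in> carrier T" "u \<otimes>\<^bsub>T\<^esub> v = \<one>\<^bsub>T\<^esub>" "z \<otimes>\<^bsub>T\<^esub> u \<in> polys n"
        using loc[OF zc] by auto
      have "z \<otimes>\<^bsub>T\<^esub> u \<in> G" using red[of n] uv z J unfolding right_ideal_def by auto
      then have "z \<otimes>\<^bsub>T\<^esub> u \<otimes>\<^bsub>T\<^esub> v \<in> G" using G(1) uv unfolding right_ideal_def by auto
      then show "z \<in> G" using uv zc by (simp add: T.m_assoc)
    qed
  qed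
  moreover have "finite Y" unfolding Y_def using X(1) by auto
  ultimately show "T.fg_ideal J" unfolding T.fg_ideal_def using YJ by blast
qed

end

section \<open>Tensor products given by generators and relations\<close>

text \<open>The product of a base changed algebra and the action on a base changed module both have
  this shape, so bilinearity and the passage to classes are treated once for both.\<close>

definition frag_bilinear :: "('p \<Rightarrow> 'q \<Rightarrow> ('r \<Rightarrow>\<^sub>0 int)) \<Rightarrow> ('p \<Rightarrow>\<^sub>0 int) \<Rightarrow> ('q \<Rightarrow>\<^sub>0 int) \<Rightarrow> ('r \<Rightarrow>\<^sub>0 int)" where
  "frag_bilinear f x y = frag_extend (\<lambda>p. frag_extend (f p) y) x"

lemma frag_cmul_diff: "frag_cmul c (a - b) = frag_cmul c a - frag_cmul c b"
  by (rule poly_mapping_eqI) (simp add: lookup_minus algebra_simps)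

lemma frag_extend_fun_diff: "frag_extend (\<lambda>p. f p - g p) x = frag_extend f x - frag_extend g x"
  by (simp add: frag_extend_def sum_subtractf frag_cmul_diff)

lemma frag_bilinear_simps [simp]:
  "frag_bilinear f 0 y = 0" "frag_bilinear f x 0 = 0"
  "frag_bilinear f (x - x') y = frag_bilinear f x y - frag_bilinear f x' y"
  "frag_bilinear f x (y - y') = frag_bilinear f x y - frag_bilinear f x y'"
  "frag_bilinear f (x + x') y = frag_bilinear f x y + frag_bilinear f x' y"
  "frag_bilinear f x (y + y') = frag_bilinear f x y + frag_bilinear f x y'"
  "frag_bilinear f (frag_of p) (frag_of q) = f p q"
proof -
  show 1: "frag_bilinear f 0 y = 0" for y unfolding frag_bilinear_def by simp
  show 2: "frag_bilinear f x 0 = 0" for x unfolding frag_bilinear_def by (simp add: frag_extend_def)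
  show 3: "frag_bilinear f (x - x') y = frag_bilinear f x y - frag_bilinear f x' y" for x x' y
    unfolding frag_bilinear_def by (simp add: frag_extend_diff)
  show 4: "frag_bilinear f x (y - y') = frag_bilinear f x y - frag_bilinear f x y'" for x y y'
    unfolding frag_bilinear_def by (simp add: frag_extend_diff frag_extend_fun_diff)
  show "frag_bilinear f (x + x') y = frag_bilinear f x y + frag_bilinear f x' y"
    using 3[of x "- x'" y] 3[of 0 x' y] 1 by simp
  show "frag_bilinear f x (y + y') = frag_bilinear f x y + frag_bilinear f x y'"
    using 4[of x y "- y'"] 4[of x 0 y'] 2 by simp
  show "frag_bilinear f (frag_of p) (frag_of q) = f p q"
    unfolding frag_bilinear_def by simp
qed

lemma field_extensionD:
  assumes "field_extension k L"
  shows "field k" "field L" "carrier k \<subseteq> carrier L" "\<one>\<^bsub>k\<^esub> = \<one>\<^bsub>L\<^esub>" "\<zero>\<^bsub>k\<^esub> = \<zero>\<^bsub>L\<^esub>"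
    "\<And>x y. x \<in> carrier k \<Longrightarrow> y \<in> carrier k \<Longrightarrow> x \<oplus>\<^bsub>k\<^esub> y = x \<oplus>\<^bsub>L\<^esub> y"
    "\<And>x y. x \<in> carrier k \<Longrightarrow> y \<in> carrier k \<Longrightarrow> x \<otimes>\<^bsub>k\<^esub> y = x \<otimes>\<^bsub>L\<^esub> y"
proof -
  have h: "field k" "field L" "(\<lambda>x. x) \<in> ring_hom k L" using assms unfolding field_extension_def by auto
  interpret k: field k by (rule h(1))
  interpret L: field L by (rule h(2))
  show "field k" "field L" by fact+
  show "carrier k \<subseteq> carrier L" "\<one>\<^bsub>k\<^esub> = \<one>\<^bsub>L\<^esub>" "\<zero>\<^bsub>k\<^esub> = \<zero>\<^bsub>L\<^esub>"
    "\<And>x y. x \<in> carrier k \<Longrightarrow> y \<in> carrier k \<Longrightarrow> x \<oplus>\<^bsub>k\<^esub> y = x \<oplus>\<^bsub>L\<^esub> y"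
    "\<And>x y. x \<in> carrier k \<Longrightarrow> y \<in> carrier k \<Longrightarrow> x \<otimes>\<^bsub>k\<^esub> y = x \<otimes>\<^bsub>L\<^esub> y"
    using h(3) ring_hom_zero[OF h(3) k.ring_axioms L.ring_axioms] unfolding ring_hom_def by auto
qed

definition frags :: "('a, 'x, 'c) module_scheme \<Rightarrow> 'a ring \<Rightarrow> ('x \<times> 'a \<Rightarrow>\<^sub>0 int) set" where
  "frags A L = {x. Poly_Mapping.keys x \<subseteq> carrier A \<times> carrier L}"

lemma carrier_tensor_free: "carrier (tensor_free A L) = frags A L"
  unfolding tensor_free_def frags_def by auto

lemma frags_closed [simp]:
  "0 \<in> frags A L" "frag_of (u, a) \<in> frags A L \<longleftrightarrow> u \<in> carrier A \<and> a \<in> carrier L"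
  "x \<in> frags A L \<Longrightarrow> y \<in> frags A L \<Longrightarrow> x + y \<in> frags A L"
  "x \<in> frags A L \<Longrightarrow> y \<in> frags A L \<Longrightarrow> x - y \<in> frags A L"
  "x \<in> frags A L \<Longrightarrow> - x \<in> frags A L"
  for x y :: "('x \<times> 'a \<Rightarrow>\<^sub>0 int)"
  using keys_diff[of x y] Poly_Mapping.keys_add[of x y] unfolding frags_def by auto

lemma frags_induct [consumes 1, case_names zero pure diff]:
  assumes "x \<in> frags A L" "P 0" "\<And>u a. u \<in> carrier A \<Longrightarrow> a \<in> carrier L \<Longrightarrow> P (frag_of (u, a))"
    "\<And>x y. x \<in> frags A L \<Longrightarrow> y \<in> frags A L \<Longrightarrow> P x \<Longrightarrow> P y \<Longrightarrow> P (x - y)"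
  shows "P x"
proof -
  have "Poly_Mapping.keys x \<subseteq> carrier A \<times> carrier L" using assms(1) unfolding frags_def by simp
  then show ?thesis
    by (rule free_Abelian_group_induct) (use assms in \<open>auto simp: frags_def\<close>)
qed

lemma frag_bilinear_frags:
  assumes "x \<in> frags A L" "y \<in> frags B M"
    "\<And>u a v b. u \<in> carrier A \<Longrightarrow> a \<in> carrier L \<Longrightarrow> v \<in> carrier B \<Longrightarrow> b \<in> carrier M \<Longrightarrow> f (u, a) (v, b) \<in> frags C N"
  shows "frag_bilinear f x y \<in> frags C N"
  using assms(1)
proof (induction rule: frags_induct)
  case (pure u a)
  show ?case using assms(2) by (induction rule: frags_induct) (use pure assms(3) in auto)
qed auto

lemma frag_bilinear_cong:
  assumes "x \<in> frags A L" "y \<in> frags B M"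
    "\<And>u a v b. u \<in> carrier A \<Longrightarrow> a \<in> carrier L \<Longrightarrow> v \<in> carrier B \<Longrightarrow> b \<in> carrier M \<Longrightarrow> f (u, a) (v, b) = f' (u, a) (v, b)"
  shows "frag_bilinear f x y = frag_bilinear f' x y"
  using assms(1)
proof (induction rule: frags_induct)
  case (pure u a)
  show ?case using assms(2) by (induction rule: frags_induct) (use pure assms(3) in auto)
qed auto

locale tensor_space =
  fixes k :: "'a ring" and A :: "('a, 'x, 'c) module_scheme" and L :: "'a ring"
  assumes A: "vectorspace k A" and ext: "field_extension k L"
begin

sublocale A: vectorspace k A by (rule A)
sublocale L: field L by (rule field_extensionD(2)[OF ext])

abbreviation null where "null \<equiv> tensor_null k A L"
abbreviation cl where "cl \<equiv> tensor_class k A L"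

lemma kL: "c \<in> carrier k \<Longrightarrow> c \<in> carrier L"
  using field_extensionD(3)[OF ext] by auto

lemma rels_frags: "tensor_rels k A L \<subseteq> frags A L"
  unfolding tensor_rels_def by (auto simp: kL)

lemma null_subgroup: "subgroup null (tensor_free A L)"
  unfolding tensor_null_def tensor_free_def
  by (rule group.generate_is_subgroup) (use rels_frags in \<open>auto simp: frags_def\<close>)

lemma null_frags: "x \<in> null \<Longrightarrow> x \<in> frags A L"
  using subgroup.subset[OF null_subgroup] carrier_tensor_free by auto

lemma null_zero [simp]: "0 \<in> null"
  using subgroup.one_closed[OF null_subgroup] by (simp add: tensor_free_def)

lemma null_minus: "x \<in> null \<Longrightarrow> - x \<in> null"
  using subgroup.m_inv_closed[OF null_subgroup, of x] null_frags[of x] by (simp add: tensor_free_def frags_def)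

lemma null_add: "x \<in> null \<Longrightarrow> y \<in> null \<Longrightarrow> x + y \<in> null"
  using subgroup.m_closed[OF null_subgroup, of x y] by (simp add: tensor_free_def)

lemma null_diff: "x \<in> null \<Longrightarrow> y \<in> null \<Longrightarrow> x - y \<in> null"
  using null_add[of x "- y"] null_minus[of y] by simp

lemma rels_null: "x \<in> tensor_rels k A L \<Longrightarrow> x \<in> null"
  unfolding tensor_null_def by (rule generate.incl)

lemma null_rel:
  "x \<in> carrier A \<Longrightarrow> y \<in> carrier A \<Longrightarrow> a \<in> carrier L \<Longrightarrow> frag_of (x \<oplus>\<^bsub>A\<^esub> y, a) - frag_of (x, a) - frag_of (y, a) \<in> null"
  "x \<in> carrier A \<Longrightarrow> a \<in> carrier L \<Longrightarrow> b \<in> carrier L \<Longrightarrow> frag_of (x, a \<oplus>\<^bsub>L\<^esub> b) - frag_of (x, a) - frag_of (x, b) \<in> null"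
  "c \<in> carrier k \<Longrightarrow> x \<in> carrier A \<Longrightarrow> a \<in> carrier L \<Longrightarrow> frag_of (c \<odot>\<^bsub>A\<^esub> x, a) - frag_of (x, c \<otimes>\<^bsub>L\<^esub> a) \<in> null"
  by (rule rels_null, unfold tensor_rels_def, blast)+

text \<open>The universal property of the relations: the elements sent into \<open>N\<close> form a
  subgroup, so it suffices to test the defining relations.\<close>

lemma null_subset:
  assumes N: "0 \<in> N" "\<And>x y. x \<in> N \<Longrightarrow> y \<in> N \<Longrightarrow> x - y \<in> N"
    and \<phi>: "\<phi> 0 = 0" "\<And>x y. \<phi> (x - y) = \<phi> x - \<phi> y"
    and r: "\<And>x. x \<in> tensor_rels k A L \<Longrightarrow> \<phi> x \<in> N" and x: "x \<in> null"
  shows "\<phi> x \<in> N"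
proof -
  let ?H = "{x \<in> frags A L. \<phi> x \<in> N}"
  have H: "0 \<in> ?H" "\<And>x y. x \<in> ?H \<Longrightarrow> y \<in> ?H \<Longrightarrow> x - y \<in> ?H" using N \<phi> by auto
  have "subgroup ?H (tensor_free A L)"
  proof (rule group.subgroupI)
    show "group (tensor_free A L)" unfolding tensor_free_def by simp
    show "?H \<subseteq> carrier (tensor_free A L)" unfolding carrier_tensor_free by auto
    show "?H \<noteq> {}" using H by blast
    fix a assume a: "a \<in> ?H"
    then have "inv\<^bsub>tensor_free A L\<^esub> a = - a" unfolding tensor_free_def by (simp add: frags_def)
    then show "inv\<^bsub>tensor_free A L\<^esub> a \<in> ?H" using H(2)[OF H(1) a] by simp
    fix b assume b: "b \<in> ?H"
    have "a - (0 - b) \<in> ?H" using H a b by blast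
    then show "a \<otimes>\<^bsub>tensor_free A L\<^esub> b \<in> ?H" unfolding tensor_free_def by simp
  qed
  then have "null \<subseteq> ?H"
    unfolding tensor_null_def using r rels_frags
    by (intro group.generate_subgroup_incl) (auto simp: tensor_free_def)
  then show ?thesis using x by auto
qed

lemma cl_eq: "cl x = {h + x | h. h \<in> null}"
  unfolding tensor_class_def r_coset_def by (auto simp: tensor_free_def)

lemma cl_self: "x \<in> cl x"
  unfolding cl_eq using null_zero by (metis (mono_tags, lifting) add_0 mem_Collect_eq)

lemma cl_eq_iff: "cl x = cl y \<longleftrightarrow> x - y \<in> null"
proof
  assume "cl x = cl y"
  then have "x \<in> cl y" using cl_self by auto
  then show "x - y \<in> null" unfolding cl_eq by auto
next
  have *: "cl x \<subseteq> cl y" if "x - y \<in> null" for x y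
  proof
    fix z assume "z \<in> cl x"
    then obtain h where "z = h + x" "h \<in> null" unfolding cl_eq by auto
    then have "z = (h + (x - y)) + y" "h + (x - y) \<in> null" using that null_add by auto
    then show "z \<in> cl y" unfolding cl_eq by blast
  qed
  assume xy: "x - y \<in> null"
  then have "y - x \<in> null" using null_minus[OF xy] by simp
  then show "cl x = cl y" using * xy by auto
qed

lemma cl_mem: "y \<in> cl x \<Longrightarrow> cl y = cl x"
  unfolding cl_eq_iff by (auto simp: cl_eq)

lemma cl_mem_frags: "y \<in> cl x \<Longrightarrow> x \<in> frags A L \<Longrightarrow> y \<in> frags A L"
  unfolding cl_eq using null_frags by auto

lemma cl_zero: "cl 0 = null"
  unfolding cl_eq by auto

lemma cl_null: "x \<in> null \<Longrightarrow> cl x = null"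
  using cl_eq_iff[of x 0] by (simp add: cl_zero)

lemma cl_add: "cl x <#>\<^bsub>tensor_free A L\<^esub> cl y = cl (x + y)"
proof
  show "cl x <#>\<^bsub>tensor_free A L\<^esub> cl y \<subseteq> cl (x + y)"
  proof
    fix z assume "z \<in> cl x <#>\<^bsub>tensor_free A L\<^esub> cl y"
    then obtain h h' where "z = (h + x) + (h' + y)" "h \<in> null" "h' \<in> null"
      unfolding set_mult_def by (auto simp: cl_eq tensor_free_def)
    then have "z = (h + h') + (x + y)" "h + h' \<in> null" using null_add by (auto simp: algebra_simps)
    then show "z \<in> cl (x + y)" unfolding cl_eq by blast
  qed
  show "cl (x + y) \<subseteq> cl x <#>\<^bsub>tensor_free A L\<^esub> cl y"
  proof
    fix z assume "z \<in> cl (x + y)"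
    then obtain h where h: "z = (h + x) + y" "h \<in> null" unfolding cl_eq by (auto simp: algebra_simps)
    then have "h + x \<in> cl x" "y \<in> cl y" using cl_self unfolding cl_eq by auto
    then show "z \<in> cl x <#>\<^bsub>tensor_free A L\<^esub> cl y" unfolding set_mult_def h(1) by (auto simp: tensor_free_def)
  qed
qed

lemma cosets_eq: "rcosets\<^bsub>tensor_free A L\<^esub> null = cl ` frags A L"
  unfolding RCOSETS_def carrier_tensor_free tensor_class_def by auto

lemma bilinear_null_left:
  assumes N: "0 \<in> N" "\<And>x y. x \<in> N \<Longrightarrow> y \<in> N \<Longrightarrow> x - y \<in> N"
    and r: "\<And>x v b. x \<in> tensor_rels k A L \<Longrightarrow> v \<in> carrier B \<Longrightarrow> b \<in> carrier M \<Longrightarrow> frag_bilinear f x (frag_of (v, b)) \<in> N"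
    and xy: "x \<in> null" "y \<in> frags B M"
  shows "frag_bilinear f x y \<in> N"
  using xy(2)
proof (induction rule: frags_induct)
  case (pure u a)
  show ?case using null_subset[OF N, of "\<lambda>x. frag_bilinear f x (frag_of (u, a))"] r pure xy by auto
qed (use N in auto)

lemma bilinear_null_right:
  assumes N: "0 \<in> N" "\<And>x y. x \<in> N \<Longrightarrow> y \<in> N \<Longrightarrow> x - y \<in> N"
    and r: "\<And>x v b. x \<in> tensor_rels k A L \<Longrightarrow> v \<in> carrier B \<Longrightarrow> b \<in> carrier M \<Longrightarrow> frag_bilinear f (frag_of (v, b)) x \<in> N"
    and xy: "x \<in> null" "y \<in> frags B M"
  shows "frag_bilinear f y x \<in> N"
  using xy(2)
proof (induction rule: frags_induct)
  case (pure u a)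
  show ?case using null_subset[OF N, of "\<lambda>x. frag_bilinear f (frag_of (u, a)) x"] r pure xy by auto
qed (use N in auto)

lemma rels_cases:
  assumes "z \<in> tensor_rels k A L"
  obtains (left) x y a where "x \<in> carrier A" "y \<in> carrier A" "a \<in> carrier L"
      "z = frag_of (x \<oplus>\<^bsub>A\<^esub> y, a) - frag_of (x, a) - frag_of (y, a)"
    | (right) x a b where "x \<in> carrier A" "a \<in> carrier L" "b \<in> carrier L"
      "z = frag_of (x, a \<oplus>\<^bsub>L\<^esub> b) - frag_of (x, a) - frag_of (x, b)"
    | (scalar) c x a where "c \<in> carrier k" "x \<in> carrier A" "a \<in> carrier L"
      "z = frag_of (c \<odot>\<^bsub>A\<^esub> x, a) - frag_of (x, c \<otimes>\<^bsub>L\<^esub> a)"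
  using assms unfolding tensor_rels_def
  by (elim UnE CollectE exE conjE) (metis left, metis right, metis scalar)

end

section \<open>Base change of algebras\<close>

locale base_change =
  fixes k :: "'a ring" and R :: "('a, 'r) module" and L :: "'a ring"
  assumes R: "assoc_algebra k R" and ext: "field_extension k L"
begin

sublocale tensor_space k R L
  using R ext unfolding assoc_algebra_def by (intro tensor_space.intro) auto
sublocale RR: ring R using R unfolding assoc_algebra_def by auto

abbreviation S where "S \<equiv> base_change_algebra k R L"

lemma R_smult:
  "c \<in> carrier k \<Longrightarrow> x \<in> carrier R \<Longrightarrow> y \<in> carrier R \<Longrightarrow> (c \<odot>\<^bsub>R\<^esub> x) \<otimes>\<^bsub>R\<^esub> y = c \<odot>\<^bsub>R\<^esub> (x \<otimes>\<^bsub>R\<^esub> y)"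
  "c \<in> carrier k \<Longrightarrow> x \<in> carrier R \<Longrightarrow> y \<in> carrier R \<Longrightarrow> x \<otimes>\<^bsub>R\<^esub> (c \<odot>\<^bsub>R\<^esub> y) = c \<odot>\<^bsub>R\<^esub> (x \<otimes>\<^bsub>R\<^esub> y)"
  using R unfolding assoc_algebra_def by auto

definition fm :: "'r \<times> 'a \<Rightarrow> 'r \<times> 'a \<Rightarrow> ('r \<times> 'a \<Rightarrow>\<^sub>0 int)" where
  "fm = (\<lambda>(r, a) (s, b). frag_of (r \<otimes>\<^bsub>R\<^esub> s, a \<otimes>\<^bsub>L\<^esub> b))"

lemma fm_simp [simp]: "fm (r, a) (s, b) = frag_of (r \<otimes>\<^bsub>R\<^esub> s, a \<otimes>\<^bsub>L\<^esub> b)"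
  unfolding fm_def by simp

lemma fm_frags: "x \<in> frags R L \<Longrightarrow> y \<in> frags R L \<Longrightarrow> frag_bilinear fm x y \<in> frags R L"
  by (rule frag_bilinear_frags) auto

lemma fm_null_left: "x \<in> null \<Longrightarrow> y \<in> frags R L \<Longrightarrow> frag_bilinear fm x y \<in> null"
proof (rule bilinear_null_left[of null])
  fix x s b assume "x \<in> tensor_rels k R L" and s: "s \<in> carrier R" "b \<in> carrier L"
  then show "frag_bilinear fm x (frag_of (s, b)) \<in> null"
  proof (cases rule: rels_cases)
    case (left x y a)
    then show ?thesis using s null_rel(1)[of "x \<otimes>\<^bsub>R\<^esub> s" "y \<otimes>\<^bsub>R\<^esub> s" "a \<otimes>\<^bsub>L\<^esub> b"] by (simp add: RR.l_distr)
  next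
    case (right x a b')
    then show ?thesis using s null_rel(2)[of "x \<otimes>\<^bsub>R\<^esub> s" "a \<otimes>\<^bsub>L\<^esub> b" "b' \<otimes>\<^bsub>L\<^esub> b"] by (simp add: L.l_distr)
  next
    case (scalar c x a)
    then show ?thesis using s null_rel(3)[of c "x \<otimes>\<^bsub>R\<^esub> s" "a \<otimes>\<^bsub>L\<^esub> b"] by (simp add: R_smult kL L.m_assoc)
  qed
qed (auto intro: null_diff)

lemma fm_null_right: "x \<in> null \<Longrightarrow> y \<in> frags R L \<Longrightarrow> frag_bilinear fm y x \<in> null"
proof (rule bilinear_null_right[of null])
  fix x s b assume "x \<in> tensor_rels k R L" and s: "s \<in> carrier R" "b \<in> carrier L"
  then show "frag_bilinear fm (frag_of (s, b)) x \<in> null"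
  proof (cases rule: rels_cases)
    case (left x y a)
    then show ?thesis using s null_rel(1)[of "s \<otimes>\<^bsub>R\<^esub> x" "s \<otimes>\<^bsub>R\<^esub> y" "b \<otimes>\<^bsub>L\<^esub> a"] by (simp add: RR.r_distr)
  next
    case (right x a b')
    then show ?thesis using s null_rel(2)[of "s \<otimes>\<^bsub>R\<^esub> x" "b \<otimes>\<^bsub>L\<^esub> a" "b \<otimes>\<^bsub>L\<^esub> b'"] by (simp add: L.r_distr)
  next
    case (scalar c x a)
    then show ?thesis using s null_rel(3)[of c "s \<otimes>\<^bsub>R\<^esub> x" "b \<otimes>\<^bsub>L\<^esub> a"] by (simp add: R_smult kL L.m_lcomm)
  qed
qed (auto intro: null_diff)

lemma S_carrier: "carrier S = cl ` frags R L"
  unfolding base_change_algebra_def using cosets_eq by simp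

lemma S_add: "cl x \<oplus>\<^bsub>S\<^esub> cl y = cl (x + y)"
  unfolding base_change_algebra_def using cl_add by simp

lemma S_zero: "\<zero>\<^bsub>S\<^esub> = cl 0"
  unfolding base_change_algebra_def cl_zero by simp

lemma S_one: "\<one>\<^bsub>S\<^esub> = cl (frag_of (\<one>\<^bsub>R\<^esub>, \<one>\<^bsub>L\<^esub>))"
  unfolding base_change_algebra_def by simp

text \<open>The product is defined as a union over all pairs of representatives. Changing either
  representative alters the formal product by a null element, so the union consists of one
  class.\<close>

lemma S_mult:
  assumes "x \<in> frags R L" "y \<in> frags R L"
  shows "cl x \<otimes>\<^bsub>S\<^esub> cl y = cl (frag_bilinear fm x y)"
proof -
  have e: "(\<lambda>(r, a). frag_extend (\<lambda>(s, b). frag_of (r \<otimes>\<^bsub>R\<^esub> s, a \<otimes>\<^bsub>L\<^esub> b)) y) = (\<lambda>p. frag_extend (fm p) y)" for y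
    by (auto simp: fun_eq_iff fm_def)
  have "cl x \<otimes>\<^bsub>S\<^esub> cl y = (\<Union>x'\<in>cl x. \<Union>y'\<in>cl y. cl (frag_bilinear fm x' y'))"
    unfolding base_change_algebra_def frag_bilinear_def by (simp add: e)
  also have "\<dots> = (\<Union>x'\<in>cl x. \<Union>y'\<in>cl y. cl (frag_bilinear fm x y))"
  proof (intro SUP_cong refl)
    fix x' y' assume xy: "x' \<in> cl x" "y' \<in> cl y"
    have f: "x' \<in> frags R L" "y' \<in> frags R L" using xy assms cl_mem_frags by auto
    have n: "x' - x \<in> null" "y' - y \<in> null" using cl_mem[OF xy(1)] cl_mem[OF xy(2)] cl_eq_iff by auto
    have eq: "frag_bilinear fm x' y' - frag_bilinear fm x y = frag_bilinear fm (x' - x) y' + frag_bilinear fm x (y' - y)"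
      by simp
    then show "cl (frag_bilinear fm x' y') = cl (frag_bilinear fm x y)"
      unfolding cl_eq_iff eq by (intro null_add fm_null_left fm_null_right n f assms)
  qed
  also have "\<dots> = cl (frag_bilinear fm x y)" using cl_self[of x] cl_self[of y] by auto
  finally show ?thesis .
qed

lemma fm_assoc:
  assumes "x \<in> frags R L" "y \<in> frags R L" "z \<in> frags R L"
  shows "frag_bilinear fm (frag_bilinear fm x y) z = frag_bilinear fm x (frag_bilinear fm y z)"
  using assms(1)
proof (induction rule: frags_induct)
  case (pure r a)
  show ?case using assms(2)
  proof (induction rule: frags_induct)
    case (pure s b)
    show ?case using assms(3)
    proof (induction rule: frags_induct)
      case (pure t c)
      then show ?case using \<open>r \<in> carrier R\<close> \<open>a \<in> carrier L\<close> \<open>s \<in> carrier R\<close> \<open>b \<in> carrier L\<close>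
        by (simp add: RR.m_assoc L.m_assoc)
    qed auto
  qed auto
qed auto

lemma fm_one:
  assumes "x \<in> frags R L"
  shows "frag_bilinear fm (frag_of (\<one>\<^bsub>R\<^esub>, \<one>\<^bsub>L\<^esub>)) x = x" "frag_bilinear fm x (frag_of (\<one>\<^bsub>R\<^esub>, \<one>\<^bsub>L\<^esub>)) = x"
  using assms by (induction rule: frags_induct) auto

lemma S_ring: "ring S"
proof (rule ringI)
  show "abelian_group S"
  proof (rule abelian_groupI)
    fix x assume "x \<in> carrier S"
    then obtain u where u: "x = cl u" "u \<in> frags R L" unfolding S_carrier by auto
    then show "\<exists>y\<in>carrier S. y \<oplus>\<^bsub>S\<^esub> x = \<zero>\<^bsub>S\<^esub>"
      unfolding S_carrier by (intro bexI[of _ "cl (- u)"]) (auto simp: S_add S_zero)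
  qed (auto simp: S_carrier S_add S_zero algebra_simps)
  show "Group.monoid S"
    by (rule monoidI) (auto simp: S_carrier S_mult S_one fm_frags fm_assoc fm_one)
qed (auto simp: S_carrier S_mult S_add fm_frags)

sublocale SR: ring S by (rule S_ring)

definition unit_scalar :: "'a \<Rightarrow> ('r, 'a) tensor" where
  "unit_scalar a = cl (frag_of (\<one>\<^bsub>R\<^esub>, a))"

definition coeff_map :: "'r \<Rightarrow> ('r, 'a) tensor" where
  "coeff_map r = cl (frag_of (r, \<one>\<^bsub>L\<^esub>))"

lemma pure_eq: "r \<in> carrier R \<Longrightarrow> a \<in> carrier L \<Longrightarrow> cl (frag_of (r, a)) = coeff_map r \<otimes>\<^bsub>S\<^esub> unit_scalar a"
  unfolding unit_scalar_def coeff_map_def by (simp add: S_mult)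

lemma unit_scalar_closed [simp]: "a \<in> carrier L \<Longrightarrow> unit_scalar a \<in> carrier S"
  unfolding unit_scalar_def S_carrier by auto

lemma coeff_map_closed [simp]: "r \<in> carrier R \<Longrightarrow> coeff_map r \<in> carrier S"
  unfolding coeff_map_def S_carrier by auto

lemma unit_scalar_central:
  assumes a: "a \<in> carrier L" and z: "z \<in> carrier S"
  shows "z \<otimes>\<^bsub>S\<^esub> unit_scalar a = unit_scalar a \<otimes>\<^bsub>S\<^esub> z"
proof -
  obtain u where u: "z = cl u" "u \<in> frags R L" using z unfolding S_carrier by auto
  have "frag_bilinear fm u (frag_of (\<one>\<^bsub>R\<^esub>, a)) = frag_bilinear fm (frag_of (\<one>\<^bsub>R\<^esub>, a)) u"
    using u(2) by (induction rule: frags_induct) (use a in \<open>auto simp: L.m_comm\<close>)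
  then show ?thesis unfolding u(1) unit_scalar_def using u(2) a by (simp add: S_mult)
qed

lemma unit_scalar_hom: "unit_scalar \<in> ring_hom L S"
proof (rule ring_hom_memI)
  fix a b assume ab: "a \<in> carrier L" "b \<in> carrier L"
  then show "unit_scalar (a \<otimes>\<^bsub>L\<^esub> b) = unit_scalar a \<otimes>\<^bsub>S\<^esub> unit_scalar b"
    unfolding unit_scalar_def by (simp add: S_mult)
  show "unit_scalar (a \<oplus>\<^bsub>L\<^esub> b) = unit_scalar a \<oplus>\<^bsub>S\<^esub> unit_scalar b"
    unfolding unit_scalar_def S_add cl_eq_iff using null_rel(2)[of "\<one>\<^bsub>R\<^esub>" a b] ab by (simp add: algebra_simps)
qed (auto simp: unit_scalar_def S_one S_carrier)

lemma coeff_map_hom: "coeff_map \<in> ring_hom R S"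
proof (rule ring_hom_memI)
  fix a b assume ab: "a \<in> carrier R" "b \<in> carrier R"
  then show "coeff_map (a \<otimes>\<^bsub>R\<^esub> b) = coeff_map a \<otimes>\<^bsub>S\<^esub> coeff_map b"
    unfolding coeff_map_def by (simp add: S_mult)
  show "coeff_map (a \<oplus>\<^bsub>R\<^esub> b) = coeff_map a \<oplus>\<^bsub>S\<^esub> coeff_map b"
    unfolding coeff_map_def S_add cl_eq_iff using null_rel(1)[of a b "\<one>\<^bsub>L\<^esub>"] ab by (simp add: algebra_simps)
qed (auto simp: coeff_map_def S_one S_carrier)

lemma S_smult:
  assumes a: "a \<in> carrier L" and z: "z \<in> carrier S"
  shows "a \<odot>\<^bsub>S\<^esub> z = unit_scalar a \<otimes>\<^bsub>S\<^esub> z"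
proof -
  obtain u where u: "z = cl u" "u \<in> frags R L" using z unfolding S_carrier by auto
  let ?g = "frag_extend (\<lambda>(r, b). frag_of (r, a \<otimes>\<^bsub>L\<^esub> b))"
  have g: "?g x = frag_bilinear fm (frag_of (\<one>\<^bsub>R\<^esub>, a)) x" if "x \<in> frags R L" for x
    using that by (induction rule: frags_induct) (use a in \<open>auto simp: frag_extend_diff\<close>)
  have "a \<odot>\<^bsub>S\<^esub> z = (\<Union>x\<in>cl u. cl (?g x))"
    unfolding base_change_algebra_def u(1) by simp
  also have "\<dots> = (\<Union>x\<in>cl u. cl (frag_bilinear fm (frag_of (\<one>\<^bsub>R\<^esub>, a)) u))"
  proof (intro SUP_cong refl)
    fix x assume x: "x \<in> cl u"
    have xf: "x \<in> frags R L" using x u cl_mem_frags by auto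
    have "cl x = cl u" using cl_mem[OF x] .
    then have "unit_scalar a \<otimes>\<^bsub>S\<^esub> cl x = unit_scalar a \<otimes>\<^bsub>S\<^esub> cl u" by simp
    then show "cl (?g x) = cl (frag_bilinear fm (frag_of (\<one>\<^bsub>R\<^esub>, a)) u)"
      unfolding unit_scalar_def using xf u a by (simp add: S_mult g)
  qed
  also have "\<dots> = unit_scalar a \<otimes>\<^bsub>S\<^esub> z"
    unfolding unit_scalar_def u(1) using cl_self[of u] u a by (auto simp: S_mult)
  finally show ?thesis .
qed

lemma unit_scalar_simps:
  "a \<in> carrier L \<Longrightarrow> b \<in> carrier L \<Longrightarrow> unit_scalar (a \<otimes>\<^bsub>L\<^esub> b) = unit_scalar a \<otimes>\<^bsub>S\<^esub> unit_scalar b"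
  "a \<in> carrier L \<Longrightarrow> b \<in> carrier L \<Longrightarrow> unit_scalar (a \<oplus>\<^bsub>L\<^esub> b) = unit_scalar a \<oplus>\<^bsub>S\<^esub> unit_scalar b"
  "unit_scalar \<one>\<^bsub>L\<^esub> = \<one>\<^bsub>S\<^esub>"
  using unit_scalar_hom unfolding ring_hom_def by auto

lemma S_algebra: "assoc_algebra L S"
proof -
  have c: "unit_scalar a \<otimes>\<^bsub>S\<^esub> z \<in> carrier S" if "a \<in> carrier L" "z \<in> carrier S" for a z using that by simp
  have "vectorspace L S"
  proof (rule vs_criteria)
    show "field L" by unfold_locales
    show "\<forall>v\<in>carrier S. \<exists>neg_v\<in>carrier S. v \<oplus>\<^bsub>S\<^esub> neg_v = \<zero>\<^bsub>S\<^esub>" using SR.r_neg by blast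
  qed (auto simp: S_smult unit_scalar_simps SR.a_ac SR.l_distr SR.r_distr SR.m_assoc)
  moreover have "x \<otimes>\<^bsub>S\<^esub> (unit_scalar a \<otimes>\<^bsub>S\<^esub> y) = unit_scalar a \<otimes>\<^bsub>S\<^esub> (x \<otimes>\<^bsub>S\<^esub> y)"
    if "a \<in> carrier L" "x \<in> carrier S" "y \<in> carrier S" for a x y
    using that unit_scalar_central[of a x] by (simp add: SR.m_assoc[symmetric])
  ultimately show ?thesis unfolding assoc_algebra_def using S_ring by (auto simp: S_smult SR.m_assoc)
qed

lemma coeff_map_smult:
  assumes "c \<in> carrier k" "r \<in> carrier R" shows "coeff_map (c \<odot>\<^bsub>R\<^esub> r) = c \<odot>\<^bsub>S\<^esub> coeff_map r"
proof -
  have "c \<odot>\<^bsub>S\<^esub> coeff_map r = cl (frag_of (r, c))"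
    using assms kL S_smult unfolding unit_scalar_def coeff_map_def by (simp add: S_mult S_carrier)
  moreover have "coeff_map (c \<odot>\<^bsub>R\<^esub> r) = cl (frag_of (r, c))"
    unfolding coeff_map_def cl_eq_iff using null_rel(3)[of c r "\<one>\<^bsub>L\<^esub>"] assms kL by simp
  ultimately show ?thesis by simp
qed

lemma S_diff:
  assumes "x \<in> frags R L" "y \<in> frags R L"
  shows "cl x \<ominus>\<^bsub>S\<^esub> cl y = cl (x - y)"
proof -
  have c: "cl x \<in> carrier S" "cl y \<in> carrier S" "cl (x - y) \<in> carrier S" using assms unfolding S_carrier by auto
  have "cl (x - y) \<oplus>\<^bsub>S\<^esub> cl y = cl x" by (simp add: S_add)
  then show ?thesis using c by (metis SR.add.inv_solve_right SR.minus_eq)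
qed

text \<open>Pure tensors are treated as products of two commuting kinds of elements, so later
  arguments need not return to formal sums. Zero arises as the difference of a pure tensor with
  itself.\<close>

lemma S_induct [consumes 1, case_names pure diff]:
  assumes "z \<in> carrier S" and pure: "\<And>r a. r \<in> carrier R \<Longrightarrow> a \<in> carrier L \<Longrightarrow> P (coeff_map r \<otimes>\<^bsub>S\<^esub> unit_scalar a)"
    and diff: "\<And>x y. x \<in> carrier S \<Longrightarrow> y \<in> carrier S \<Longrightarrow> P x \<Longrightarrow> P y \<Longrightarrow> P (x \<ominus>\<^bsub>S\<^esub> y)"
  shows "P z"
proof -
  obtain u where u: "z = cl u" "u \<in> frags R L" using assms unfolding S_carrier by auto
  have "P (cl u)" using u(2)
  proof (induction rule: frags_induct)
    case zero
    have p: "P (coeff_map \<one>\<^bsub>R\<^esub> \<otimes>\<^bsub>S\<^esub> unit_scalar \<one>\<^bsub>L\<^esub>)" using pure by simp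
    have "P (cl (frag_of (\<one>\<^bsub>R\<^esub>, \<one>\<^bsub>L\<^esub>)) \<ominus>\<^bsub>S\<^esub> cl (frag_of (\<one>\<^bsub>R\<^esub>, \<one>\<^bsub>L\<^esub>)))"
      using p diff by (simp add: pure_eq)
    then show ?case by (subst (asm) S_diff) auto
  next
    case (pure r a) then show ?case using assms(2) pure_eq by simp
  next
    case (diff x y)
    then show ?case using assms(3)[of "cl x" "cl y"] S_diff S_carrier by auto
  qed
  then show ?thesis using u by simp
qed

lemma S_span: "carrier S \<subseteq> module.span L S (coeff_map ` carrier R)"
proof
  interpret LS: vectorspace L S using S_algebra unfolding assoc_algebra_def by auto
  fix z assume "z \<in> carrier S"
  have c: "coeff_map ` carrier R \<subseteq> carrier S" by auto
  have sub: "submodule L (LS.span (coeff_map ` carrier R)) S" using LS.span_is_submodule[OF c] .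
  have inc: "coeff_map ` carrier R \<subseteq> LS.span (coeff_map ` carrier R)" using LS.in_own_span[OF c] .
  from \<open>z \<in> carrier S\<close> show "z \<in> LS.span (coeff_map ` carrier R)"
  proof (induction rule: S_induct)
    case (pure r a)
    then have "a \<odot>\<^bsub>S\<^esub> coeff_map r \<in> LS.span (coeff_map ` carrier R)"
      using LinearCombinations.submodule.smult_closed[OF sub, of a "coeff_map r"] inc by auto
    then show ?case using pure unit_scalar_central[of a "coeff_map r"] by (simp add: S_smult)
  next
    case (diff x y)
    have "(\<ominus>\<^bsub>L\<^esub> \<one>\<^bsub>L\<^esub>) \<odot>\<^bsub>S\<^esub> y \<in> LS.span (coeff_map ` carrier R)"
      using sub diff unfolding submodule_def by auto
    then have "\<ominus>\<^bsub>S\<^esub> y \<in> LS.span (coeff_map ` carrier R)" using diff LS.smult_minus_1[of y] by simp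
    then show ?case using sub diff unfolding submodule_def SR.minus_eq by blast
  qed
qed

end

section \<open>Functoriality of base change in the larger field\<close>

lemma field_extension_trans:
  assumes "field_extension k L" "field_extension L K" shows "field_extension k K"
  using assms unfolding field_extension_def ring_hom_def by (auto simp: Pi_iff)

text \<open>The canonical map from \<open>R\<^sub>L\<close> to \<open>R\<^sub>L\<^sub>'\<close>. The
  smaller field is not an argument, because a class over it is a set of formal sums that can be read
  directly over \<open>L'\<close>; relations over \<open>L\<close> remain relations over
  \<open>L'\<close>.\<close>

definition base_map :: "'a ring \<Rightarrow> ('a, 'r) module \<Rightarrow> 'a ring \<Rightarrow> ('r, 'a) tensor \<Rightarrow> ('r, 'a) tensor" where
  "base_map k R L X = (\<Union>x\<in>X. tensor_class k R L x)"

locale base_change_pair = src: base_change k R L + tgt: base_change k R L'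
  for k :: "'a ring" and R :: "('a, 'r) module" and L L' :: "'a ring" +
  assumes LL': "field_extension L L'"
begin

lemmas ext_simps = field_extensionD(3-7)[OF LL']

abbreviation \<beta> where "\<beta> \<equiv> base_map k R L'"

lemma frags_mono: "x \<in> frags R L \<Longrightarrow> x \<in> frags R L'"
  using ext_simps(1) unfolding frags_def by auto

lemma null_mono: "x \<in> src.null \<Longrightarrow> x \<in> tgt.null"
proof (rule src.null_subset[of tgt.null "\<lambda>x. x"])
  fix x assume "x \<in> tensor_rels k R L"
  then show "x \<in> tgt.null"
  proof (cases rule: src.rels_cases)
    case (left x y a) then show ?thesis using tgt.null_rel(1)[of x y a] ext_simps(1) by auto
  next
    case (right x a b) then show ?thesis using tgt.null_rel(2)[of x a b] ext_simps by auto
  next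
    case (scalar c x a) then show ?thesis using tgt.null_rel(3)[of c x a] ext_simps src.kL by auto
  qed
qed (auto intro: tgt.null_diff)

lemma map_cl: "\<beta> (src.cl x) = tgt.cl x"
proof -
  have "\<beta> (src.cl x) = (\<Union>y\<in>src.cl x. tgt.cl x)"
    unfolding base_map_def
  proof (intro SUP_cong refl)
    fix y assume "y \<in> src.cl x"
    then have "y - x \<in> src.null" using src.cl_mem src.cl_eq_iff by blast
    then show "tgt.cl y = tgt.cl x" using null_mono tgt.cl_eq_iff by auto
  qed
  then show ?thesis using src.cl_self by auto
qed

lemma map_hom: "\<beta> \<in> ring_hom src.S tgt.S"
proof (rule ring_hom_memI)
  fix x assume "x \<in> carrier src.S"
  then show "\<beta> x \<in> carrier tgt.S" unfolding src.S_carrier tgt.S_carrier using map_cl frags_mono by auto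
next
  fix x y assume "x \<in> carrier src.S" "y \<in> carrier src.S"
  then obtain u v where uv: "x = src.cl u" "u \<in> frags R L" "y = src.cl v" "v \<in> frags R L" unfolding src.S_carrier by auto
  have "frag_bilinear src.fm u v = frag_bilinear tgt.fm u v"
    by (rule frag_bilinear_cong[OF uv(2,4)]) (simp add: ext_simps)
  then show "\<beta> (x \<otimes>\<^bsub>src.S\<^esub> y) = \<beta> x \<otimes>\<^bsub>tgt.S\<^esub> \<beta> y"
    using uv frags_mono by (simp add: src.S_mult tgt.S_mult map_cl)
  show "\<beta> (x \<oplus>\<^bsub>src.S\<^esub> y) = \<beta> x \<oplus>\<^bsub>tgt.S\<^esub> \<beta> y"
    using uv by (simp add: src.S_add tgt.S_add map_cl)
next
  show "\<beta> \<one>\<^bsub>src.S\<^esub> = \<one>\<^bsub>tgt.S\<^esub>" unfolding src.S_one tgt.S_one map_cl using ext_simps by simp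
qed

lemma map_unit_scalar: "\<beta> (src.unit_scalar a) = tgt.unit_scalar a"
  unfolding src.unit_scalar_def tgt.unit_scalar_def map_cl ..

lemma map_coeff_map: "\<beta> (src.coeff_map r) = tgt.coeff_map r"
  unfolding src.coeff_map_def tgt.coeff_map_def map_cl using ext_simps by simp

lemma map_simps:
  "x \<in> carrier src.S \<Longrightarrow> \<beta> x \<in> carrier tgt.S"
  "x \<in> carrier src.S \<Longrightarrow> y \<in> carrier src.S \<Longrightarrow> \<beta> (x \<otimes>\<^bsub>src.S\<^esub> y) = \<beta> x \<otimes>\<^bsub>tgt.S\<^esub> \<beta> y"
  "x \<in> carrier src.S \<Longrightarrow> y \<in> carrier src.S \<Longrightarrow> \<beta> (x \<oplus>\<^bsub>src.S\<^esub> y) = \<beta> x \<oplus>\<^bsub>tgt.S\<^esub> \<beta> y"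
  "\<beta> \<one>\<^bsub>src.S\<^esub> = \<one>\<^bsub>tgt.S\<^esub>" "\<beta> \<zero>\<^bsub>src.S\<^esub> = \<zero>\<^bsub>tgt.S\<^esub>"
  using map_hom ring_hom_zero[OF map_hom src.S_ring tgt.S_ring] unfolding ring_hom_def by auto

lemma map_diff:
  "x \<in> carrier src.S \<Longrightarrow> y \<in> carrier src.S \<Longrightarrow> \<beta> (x \<ominus>\<^bsub>src.S\<^esub> y) = \<beta> x \<ominus>\<^bsub>tgt.S\<^esub> \<beta> y"
  unfolding src.S_carrier by (auto simp: src.S_diff tgt.S_diff map_cl frags_mono)

end

lemma base_map_comp:
  assumes "base_change_pair k R L L'" "base_change_pair k R L' L''" "x \<in> carrier (base_change_algebra k R L)"
  shows "base_map k R L'' (base_map k R L' x) = base_map k R L'' x"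
proof -
  interpret a: base_change_pair k R L L' by fact
  interpret b: base_change_pair k R L' L'' by fact
  interpret c: base_change_pair k R L L''
    by unfold_locales (rule field_extension_trans[OF a.LL' b.LL'])
  obtain u where "x = a.src.cl u" using assms(3) unfolding a.src.S_carrier by auto
  then show ?thesis by (simp add: a.map_cl b.map_cl c.map_cl)
qed

section \<open>Noetherianity over finitely generated extensions\<close>

text \<open>The start of the induction on generators. Every scalar of \<open>L\<close> comes from
  \<open>k\<close>, so \<open>R\<close> maps onto the base change.\<close>

lemma base_change_noetherian_trivial:
  assumes R: "assoc_algebra k R" and ext: "field_extension k L" and eq: "carrier L = carrier k"
    and noeth: "right_noetherian R"
  shows "right_noetherian (base_change_algebra k R L)"
proof -
  interpret base_change k R L using R ext by unfold_locales
  \<comment> \<open>With the central element 1 the constants already exhaust the target, and the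
    extension lemma reduces to the case of a quotient ring.\<close>
  interpret C: central_extension R S coeff_map "\<one>\<^bsub>S\<^esub>"
    by unfold_locales (auto simp: coeff_map_hom)
  have surj: "\<exists>r\<in>carrier R. z = coeff_map r" if "z \<in> carrier S" for z
    using that
  proof (induction rule: S_induct)
    case (pure r a)
    then have a: "a \<in> carrier k" using eq by simp
    then have "coeff_map (a \<odot>\<^bsub>R\<^esub> r) = coeff_map r \<otimes>\<^bsub>S\<^esub> unit_scalar a"
      using pure coeff_map_smult S_smult unit_scalar_central by simp
    then show ?case using a pure by (intro bexI[of _ "a \<odot>\<^bsub>R\<^esub> r"]) auto
  next
    case (diff x y)
    then obtain r s where rs: "r \<in> carrier R" "x = coeff_map r" "s \<in> carrier R" "y = coeff_map s" by auto
    have "coeff_map (r \<ominus>\<^bsub>R\<^esub> s) \<oplus>\<^bsub>S\<^esub> coeff_map s = coeff_map (r \<ominus>\<^bsub>R\<^esub> s \<oplus>\<^bsub>R\<^esub> s)"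
      using rs C.h_simps(2) by simp
    also have "r \<ominus>\<^bsub>R\<^esub> s \<oplus>\<^bsub>R\<^esub> s = r" using rs by (simp add: A.M.minus_eq A.M.a_assoc A.M.l_neg)
    finally have "coeff_map (r \<ominus>\<^bsub>R\<^esub> s) = coeff_map r \<ominus>\<^bsub>S\<^esub> coeff_map s"
      using rs by (metis SR.add.inv_solve_right SR.minus_eq coeff_map_closed A.M.minus_closed)
    then show ?case using rs by (intro bexI[of _ "r \<ominus>\<^bsub>R\<^esub> s"]) auto
  qed
  show ?thesis
  proof (rule C.right_noetherian_extension[OF noeth])
    fix z assume z: "z \<in> carrier S"
    then obtain r where r: "r \<in> carrier R" "z = coeff_map r" using surj by auto
    then have "z = coeff_map r \<otimes>\<^bsub>S\<^esub> \<one>\<^bsub>S\<^esub> [^]\<^bsub>S\<^esub> (0::nat) \<oplus>\<^bsub>S\<^esub> \<zero>\<^bsub>S\<^esub>" by simp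
    then have "z \<in> C.polys (Suc 0)" using r(1) unfolding C.polys.simps by blast
    then show "\<exists>u\<in>carrier S. \<exists>v\<in>carrier S. \<exists>n. u \<otimes>\<^bsub>S\<^esub> v = \<one>\<^bsub>S\<^esub> \<and> z \<otimes>\<^bsub>S\<^esub> u \<in> C.polys n"
      using z by (intro bexI[of _ "\<one>\<^bsub>S\<^esub>"] exI[of _ "Suc 0"]) auto
  qed
qed

text \<open>The elements \<open>c\<close> of \<open>L' = L(x)\<close> whose action preserves \<open>S\<^sub>L[x]\<close> form a ring \<open>D\<close> containing \<open>L[x]\<close>, and the
  fractions with numerator and denominator in \<open>D\<close> form a field; so every element of \<open>S\<^sub>L\<^sub>'\<close> has a denominator.\<close>

lemma (in base_change_pair) base_change_noetherian_step:
  assumes noeth: "right_noetherian src.S" and x: "x \<in> carrier L'"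
    and gen: "\<And>F. \<lbrakk>carrier L \<subseteq> F; x \<in> F; F \<subseteq> carrier L'; \<And>a b. \<lbrakk>a \<in> F; b \<in> F\<rbrakk> \<Longrightarrow> a \<oplus>\<^bsub>L'\<^esub> b \<in> F;
      \<And>a b. \<lbrakk>a \<in> F; b \<in> F\<rbrakk> \<Longrightarrow> a \<otimes>\<^bsub>L'\<^esub> b \<in> F; \<And>a. a \<in> F \<Longrightarrow> \<exists>b\<in>F. a \<oplus>\<^bsub>L'\<^esub> b = \<zero>\<^bsub>L'\<^esub>;
      \<And>a. \<lbrakk>a \<in> F; a \<noteq> \<zero>\<^bsub>L'\<^esub>\<rbrakk> \<Longrightarrow> \<exists>b\<in>F. a \<otimes>\<^bsub>L'\<^esub> b = \<one>\<^bsub>L'\<^esub>\<rbrakk> \<Longrightarrow> carrier L' \<subseteq> F"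
  shows "right_noetherian tgt.S"
proof -
  let ?\<zeta> = "tgt.unit_scalar"
  interpret C: central_extension src.S tgt.S \<beta> "?\<zeta> x"
    by unfold_locales (use x map_hom tgt.unit_scalar_central in auto)
  define P where "P = (\<Union>n. C.polys n)"
  have Pc: "p \<in> carrier tgt.S" if "p \<in> P" for p using that C.polys_closed unfolding P_def by auto
  have Padd: "p \<oplus>\<^bsub>tgt.S\<^esub> q \<in> P" if pq: "p \<in> P" "q \<in> P" for p q
  proof -
    obtain n m where nm: "p \<in> C.polys n" "q \<in> C.polys m" using pq unfolding P_def by auto
    then have "p \<in> C.polys (max n m)" "q \<in> C.polys (max n m)"
      using C.polys_mono[of n "max n m"] C.polys_mono[of m "max n m"] by auto
    then show ?thesis using C.polys_add unfolding P_def by blast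
  qed
  have Pneg: "\<ominus>\<^bsub>tgt.S\<^esub> p \<in> P" if "p \<in> P" for p using that C.polys_minus unfolding P_def by auto
  have P0: "\<zero>\<^bsub>tgt.S\<^esub> \<in> P" using C.polys_zero unfolding P_def by auto
  define D where "D = {a \<in> carrier L'. \<forall>p\<in>P. ?\<zeta> a \<otimes>\<^bsub>tgt.S\<^esub> p \<in> P}"
  have Dc: "a \<in> carrier L'" if "a \<in> D" for a using that unfolding D_def by auto
  have DL: "a \<in> D" if a: "a \<in> carrier L" for a
  proof -
    have a': "a \<in> carrier L'" using a ext_simps(1) by auto
    have "?\<zeta> a \<otimes>\<^bsub>tgt.S\<^esub> p \<in> P" if p: "p \<in> P" for p
    proof -
      have "?\<zeta> a \<otimes>\<^bsub>tgt.S\<^esub> p = p \<otimes>\<^bsub>tgt.S\<^esub> \<beta> (src.unit_scalar a)"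
        using tgt.unit_scalar_central[OF a' Pc[OF p]] map_unit_scalar by simp
      then show ?thesis using p C.polys_mult[of p _ "src.unit_scalar a"] a unfolding P_def by auto
    qed
    then show ?thesis using a' unfolding D_def by auto
  qed
  have Dx: "x \<in> D"
  proof -
    have "?\<zeta> x \<otimes>\<^bsub>tgt.S\<^esub> p \<in> P" if p: "p \<in> P" for p
    proof -
      obtain n where "p \<in> C.polys n" using p unfolding P_def by auto
      then have "p \<otimes>\<^bsub>tgt.S\<^esub> ?\<zeta> x \<in> P" using C.polys_shift unfolding P_def by blast
      then show ?thesis using tgt.unit_scalar_central[OF x Pc[OF p]] by simp
    qed
    then show ?thesis using x unfolding D_def by auto
  qed
  have Dadd: "a \<oplus>\<^bsub>L'\<^esub> b \<in> D" if ab: "a \<in> D" "b \<in> D" for a b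
    using ab Padd Pc unfolding D_def by (auto simp: tgt.unit_scalar_simps tgt.SR.l_distr)
  have Dmult: "a \<otimes>\<^bsub>L'\<^esub> b \<in> D" if ab: "a \<in> D" "b \<in> D" for a b
    using ab Pc unfolding D_def by (auto simp: tgt.unit_scalar_simps tgt.SR.m_assoc)
  have D1: "\<one>\<^bsub>L'\<^esub> \<in> D" using DL[of "\<one>\<^bsub>L\<^esub>"] ext_simps(2) src.L.one_closed by simp
  have Dneg: "\<ominus>\<^bsub>L'\<^esub> a \<in> D" if a: "a \<in> D" for a
  proof -
    have "?\<zeta> (\<ominus>\<^bsub>L'\<^esub> a) \<otimes>\<^bsub>tgt.S\<^esub> p = \<ominus>\<^bsub>tgt.S\<^esub> (?\<zeta> a \<otimes>\<^bsub>tgt.S\<^esub> p)" if p: "p \<in> P" for p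
    proof -
      have z: "?\<zeta> \<zero>\<^bsub>L'\<^esub> = \<zero>\<^bsub>tgt.S\<^esub>"
        using ring_hom_zero[OF tgt.unit_scalar_hom tgt.L.ring_axioms tgt.S_ring] .
      have "?\<zeta> (\<ominus>\<^bsub>L'\<^esub> a) \<oplus>\<^bsub>tgt.S\<^esub> ?\<zeta> a = \<zero>\<^bsub>tgt.S\<^esub>"
        using tgt.unit_scalar_simps(2)[of "\<ominus>\<^bsub>L'\<^esub> a" a] Dc[OF a] z by (simp add: tgt.L.l_neg)
      then have "?\<zeta> (\<ominus>\<^bsub>L'\<^esub> a) = \<ominus>\<^bsub>tgt.S\<^esub> ?\<zeta> a" using Dc[OF a] by (simp add: tgt.SR.minus_equality)
      then show ?thesis using Dc[OF a] Pc[OF p] by (simp add: tgt.SR.l_minus)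
    qed
    then show ?thesis using a Pneg unfolding D_def by auto
  qed
  define F where "F = {a \<in> carrier L'. \<exists>c\<in>D. c \<noteq> \<zero>\<^bsub>L'\<^esub> \<and> c \<otimes>\<^bsub>L'\<^esub> a \<in> D}"
  have DF: "D \<subseteq> F"
    unfolding F_def using Dc D1 tgt.L.l_one tgt.L.one_not_zero by (auto intro!: bexI[of _ "\<one>\<^bsub>L'\<^esub>"])
  have F: "carrier L' \<subseteq> F"
  proof (rule gen)
    show "carrier L \<subseteq> F" using DL DF by auto
    show "x \<in> F" using Dx DF by auto
    show "F \<subseteq> carrier L'" unfolding F_def by auto
  next
    fix a b assume "a \<in> F" "b \<in> F"
    then obtain c d where cd: "a \<in> carrier L'" "b \<in> carrier L'" "c \<in> D" "c \<noteq> \<zero>\<^bsub>L'\<^esub>" "c \<otimes>\<^bsub>L'\<^esub> a \<in> D"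
      "d \<in> D" "d \<noteq> \<zero>\<^bsub>L'\<^esub>" "d \<otimes>\<^bsub>L'\<^esub> b \<in> D" unfolding F_def by auto
    have c: "c \<in> carrier L'" "d \<in> carrier L'" using cd Dc by auto
    have nz: "c \<otimes>\<^bsub>L'\<^esub> d \<noteq> \<zero>\<^bsub>L'\<^esub>" "c \<otimes>\<^bsub>L'\<^esub> d \<in> D" using tgt.L.integral[of c d] cd c Dmult by auto
    have "(c \<otimes>\<^bsub>L'\<^esub> d) \<otimes>\<^bsub>L'\<^esub> (a \<oplus>\<^bsub>L'\<^esub> b) = d \<otimes>\<^bsub>L'\<^esub> (c \<otimes>\<^bsub>L'\<^esub> a) \<oplus>\<^bsub>L'\<^esub> c \<otimes>\<^bsub>L'\<^esub> (d \<otimes>\<^bsub>L'\<^esub> b)"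
      using cd c by (simp add: tgt.L.r_distr tgt.L.m_ac)
    then have "(c \<otimes>\<^bsub>L'\<^esub> d) \<otimes>\<^bsub>L'\<^esub> (a \<oplus>\<^bsub>L'\<^esub> b) \<in> D" using cd Dadd Dmult by simp
    then show "a \<oplus>\<^bsub>L'\<^esub> b \<in> F" unfolding F_def using nz cd by auto
    have "(c \<otimes>\<^bsub>L'\<^esub> d) \<otimes>\<^bsub>L'\<^esub> (a \<otimes>\<^bsub>L'\<^esub> b) = (c \<otimes>\<^bsub>L'\<^esub> a) \<otimes>\<^bsub>L'\<^esub> (d \<otimes>\<^bsub>L'\<^esub> b)"
      using cd c by (simp add: tgt.L.m_ac)
    then have "(c \<otimes>\<^bsub>L'\<^esub> d) \<otimes>\<^bsub>L'\<^esub> (a \<otimes>\<^bsub>L'\<^esub> b) \<in> D" using cd Dmult by simp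
    then show "a \<otimes>\<^bsub>L'\<^esub> b \<in> F" unfolding F_def using nz cd by auto
  next
    fix a assume "a \<in> F"
    then obtain c where cd: "a \<in> carrier L'" "c \<in> D" "c \<noteq> \<zero>\<^bsub>L'\<^esub>" "c \<otimes>\<^bsub>L'\<^esub> a \<in> D" unfolding F_def by auto
    have "c \<otimes>\<^bsub>L'\<^esub> (\<ominus>\<^bsub>L'\<^esub> a) = \<ominus>\<^bsub>L'\<^esub> (c \<otimes>\<^bsub>L'\<^esub> a)" using cd Dc by (simp add: tgt.L.r_minus)
    then have "\<ominus>\<^bsub>L'\<^esub> a \<in> F" unfolding F_def using cd Dneg by auto
    then show "\<exists>b\<in>F. a \<oplus>\<^bsub>L'\<^esub> b = \<zero>\<^bsub>L'\<^esub>" using cd by (intro bexI[of _ "\<ominus>\<^bsub>L'\<^esub> a"]) (auto simp: tgt.L.r_neg)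
    assume nz: "a \<noteq> \<zero>\<^bsub>L'\<^esub>"
    have cc: "c \<in> carrier L'" using cd Dc by auto
    have u: "a \<in> Units L'" using nz cd tgt.L.field_Units by auto
    have inv: "inv\<^bsub>L'\<^esub> a \<in> carrier L'" "a \<otimes>\<^bsub>L'\<^esub> inv\<^bsub>L'\<^esub> a = \<one>\<^bsub>L'\<^esub>" using u by auto
    \<comment> \<open>The nonzero numerator \<open>c a\<close> serves as denominator of the inverse
      of \<open>a\<close>, since it multiplies that inverse to \<open>c\<close>.\<close>
    have "(c \<otimes>\<^bsub>L'\<^esub> a) \<otimes>\<^bsub>L'\<^esub> inv\<^bsub>L'\<^esub> a = c" using cc cd inv by (simp add: tgt.L.m_assoc)
    moreover have "c \<otimes>\<^bsub>L'\<^esub> a \<noteq> \<zero>\<^bsub>L'\<^esub>" using tgt.L.integral[of c a] cc cd nz by auto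
    ultimately have "inv\<^bsub>L'\<^esub> a \<in> F" unfolding F_def using cd inv by auto
    then show "\<exists>b\<in>F. a \<otimes>\<^bsub>L'\<^esub> b = \<one>\<^bsub>L'\<^esub>" using inv by auto
  qed
  \<comment> \<open>Pure tensors get a denominator from the field coefficient, differences get the
    product of the two denominators.\<close>
  have den: "\<exists>c\<in>D. c \<noteq> \<zero>\<^bsub>L'\<^esub> \<and> ?\<zeta> c \<otimes>\<^bsub>tgt.S\<^esub> z \<in> P" if "z \<in> carrier tgt.S" for z
    using that
  proof (induction rule: tgt.S_induct)
    case (pure r a)
    then obtain c where c: "c \<in> D" "c \<noteq> \<zero>\<^bsub>L'\<^esub>" "c \<otimes>\<^bsub>L'\<^esub> a \<in> D" using F unfolding F_def by auto
    have "tgt.coeff_map r = \<beta> (src.coeff_map r) \<otimes>\<^bsub>tgt.S\<^esub> ?\<zeta> x [^]\<^bsub>tgt.S\<^esub> (0::nat) \<oplus>\<^bsub>tgt.S\<^esub> \<zero>\<^bsub>tgt.S\<^esub>"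
      using pure map_coeff_map by simp
    then have "tgt.coeff_map r \<in> C.polys (Suc 0)" unfolding C.polys.simps using src.coeff_map_closed[OF pure(1)] by blast
    then have rP: "tgt.coeff_map r \<in> P" unfolding P_def by blast
    have "?\<zeta> c \<otimes>\<^bsub>tgt.S\<^esub> (tgt.coeff_map r \<otimes>\<^bsub>tgt.S\<^esub> ?\<zeta> a) = ?\<zeta> c \<otimes>\<^bsub>tgt.S\<^esub> (?\<zeta> a \<otimes>\<^bsub>tgt.S\<^esub> tgt.coeff_map r)"
      using tgt.unit_scalar_central[OF pure(2) tgt.coeff_map_closed[OF pure(1)]] by simp
    also have "\<dots> = ?\<zeta> (c \<otimes>\<^bsub>L'\<^esub> a) \<otimes>\<^bsub>tgt.S\<^esub> tgt.coeff_map r"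
      using pure c Dc by (simp add: tgt.unit_scalar_simps tgt.SR.m_assoc)
    also have "\<dots> \<in> P" using c(3) rP unfolding D_def by simp
    finally show ?case using c by auto
  next
    case (diff y z)
    then obtain c d where cd: "c \<in> D" "c \<noteq> \<zero>\<^bsub>L'\<^esub>" "?\<zeta> c \<otimes>\<^bsub>tgt.S\<^esub> y \<in> P"
      "d \<in> D" "d \<noteq> \<zero>\<^bsub>L'\<^esub>" "?\<zeta> d \<otimes>\<^bsub>tgt.S\<^esub> z \<in> P" by auto
    have c: "c \<in> carrier L'" "d \<in> carrier L'" using cd Dc by auto
    have nz: "c \<otimes>\<^bsub>L'\<^esub> d \<noteq> \<zero>\<^bsub>L'\<^esub>" "c \<otimes>\<^bsub>L'\<^esub> d \<in> D" using tgt.L.integral[of c d] cd c Dmult by auto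
    have 1: "?\<zeta> (c \<otimes>\<^bsub>L'\<^esub> d) \<otimes>\<^bsub>tgt.S\<^esub> y = ?\<zeta> d \<otimes>\<^bsub>tgt.S\<^esub> (?\<zeta> c \<otimes>\<^bsub>tgt.S\<^esub> y)"
      using c diff by (simp add: tgt.L.m_comm[of c d] tgt.unit_scalar_simps tgt.SR.m_assoc)
    have 2: "?\<zeta> (c \<otimes>\<^bsub>L'\<^esub> d) \<otimes>\<^bsub>tgt.S\<^esub> z = ?\<zeta> c \<otimes>\<^bsub>tgt.S\<^esub> (?\<zeta> d \<otimes>\<^bsub>tgt.S\<^esub> z)"
      using c diff by (simp add: tgt.unit_scalar_simps tgt.SR.m_assoc)
    have DP: "?\<zeta> a \<otimes>\<^bsub>tgt.S\<^esub> p \<in> P" if "a \<in> D" "p \<in> P" for a p using that unfolding D_def by simp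
    have p: "?\<zeta> (c \<otimes>\<^bsub>L'\<^esub> d) \<otimes>\<^bsub>tgt.S\<^esub> y \<in> P" "?\<zeta> (c \<otimes>\<^bsub>L'\<^esub> d) \<otimes>\<^bsub>tgt.S\<^esub> z \<in> P"
      unfolding 1 2 by (rule DP; fact)+
    have "?\<zeta> (c \<otimes>\<^bsub>L'\<^esub> d) \<otimes>\<^bsub>tgt.S\<^esub> (y \<ominus>\<^bsub>tgt.S\<^esub> z) =
       ?\<zeta> (c \<otimes>\<^bsub>L'\<^esub> d) \<otimes>\<^bsub>tgt.S\<^esub> y \<oplus>\<^bsub>tgt.S\<^esub> \<ominus>\<^bsub>tgt.S\<^esub> (?\<zeta> (c \<otimes>\<^bsub>L'\<^esub> d) \<otimes>\<^bsub>tgt.S\<^esub> z)"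
      using c diff by (simp add: tgt.SR.minus_eq tgt.SR.r_distr tgt.SR.r_minus)
    also have "\<dots> \<in> P" using p Padd Pneg by blast
    finally show ?case using nz by auto
  qed
  show ?thesis
  proof (rule C.right_noetherian_extension[OF noeth])
    fix z assume z: "z \<in> carrier tgt.S"
    then obtain c where c: "c \<in> D" "c \<noteq> \<zero>\<^bsub>L'\<^esub>" "?\<zeta> c \<otimes>\<^bsub>tgt.S\<^esub> z \<in> P" using den by auto
    have cc: "c \<in> carrier L'" using c Dc by auto
    have "c \<in> Units L'" using c cc tgt.L.field_Units by auto
    then have inv: "inv\<^bsub>L'\<^esub> c \<in> carrier L'" "c \<otimes>\<^bsub>L'\<^esub> inv\<^bsub>L'\<^esub> c = \<one>\<^bsub>L'\<^esub>" by auto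
    then have uv: "?\<zeta> c \<otimes>\<^bsub>tgt.S\<^esub> ?\<zeta> (inv\<^bsub>L'\<^esub> c) = \<one>\<^bsub>tgt.S\<^esub>"
      using tgt.unit_scalar_simps(1)[OF cc inv(1)] tgt.unit_scalar_simps(3) by simp
    have "z \<otimes>\<^bsub>tgt.S\<^esub> ?\<zeta> c \<in> P" using c tgt.unit_scalar_central[OF cc z] by simp
    then obtain n where n: "z \<otimes>\<^bsub>tgt.S\<^esub> ?\<zeta> c \<in> C.polys n" unfolding P_def by (elim UN_E)
    show "\<exists>u\<in>carrier tgt.S. \<exists>v\<in>carrier tgt.S. \<exists>n. u \<otimes>\<^bsub>tgt.S\<^esub> v = \<one>\<^bsub>tgt.S\<^esub> \<and> z \<otimes>\<^bsub>tgt.S\<^esub> u \<in> C.polys n"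
      by (rule bexI[OF _ tgt.unit_scalar_closed[OF cc]], rule bexI[OF _ tgt.unit_scalar_closed[OF inv(1)]],
          rule exI[of _ n], rule conjI[OF uv n])
  qed
qed

section \<open>Generated subfields and adjunction of one generator at a time\<close>

lemma field_extension_inverses:
  assumes ext: "field_extension L M" and a: "a \<in> carrier L"
  shows "\<ominus>\<^bsub>L\<^esub> a = \<ominus>\<^bsub>M\<^esub> a" "a \<noteq> \<zero>\<^bsub>L\<^esub> \<Longrightarrow> inv\<^bsub>L\<^esub> a = inv\<^bsub>M\<^esub> a"
proof -
  note e = field_extensionD[OF ext]
  interpret L: field L by (rule e(1))
  interpret M: field M by (rule e(2))
  have "\<ominus>\<^bsub>L\<^esub> a \<oplus>\<^bsub>M\<^esub> a = \<zero>\<^bsub>M\<^esub>" using e(5,6)[symmetric] L.l_neg[OF a] a by simp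
  then have "\<ominus>\<^bsub>M\<^esub> a = \<ominus>\<^bsub>L\<^esub> a" using e(3) a by (intro M.minus_equality) auto
  then show "\<ominus>\<^bsub>L\<^esub> a = \<ominus>\<^bsub>M\<^esub> a" by simp
  assume "a \<noteq> \<zero>\<^bsub>L\<^esub>"
  then have "a \<in> Units L" using a L.field_Units by auto
  then have i: "inv\<^bsub>L\<^esub> a \<in> carrier L" "a \<otimes>\<^bsub>L\<^esub> inv\<^bsub>L\<^esub> a = \<one>\<^bsub>L\<^esub>" by auto
  then have "a \<otimes>\<^bsub>M\<^esub> inv\<^bsub>L\<^esub> a = \<one>\<^bsub>M\<^esub>" using e(4,7) a by simp
  then have "inv\<^bsub>M\<^esub> a = inv\<^bsub>L\<^esub> a" using e(3) a i by (intro M.comm_inv_char) auto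
  then show "inv\<^bsub>L\<^esub> a = inv\<^bsub>M\<^esub> a" by simp
qed

text \<open>\<open>generate_field\<close> uses the operations of its ambient record, and those of
  \<open>L\<close> and \<open>M\<close> agree only on \<open>carrier L\<close>. Each step of the
  induction therefore needs the elements already generated to lie in \<open>L\<close>.\<close>

lemma generate_field_extension:
  assumes ext: "field_extension L M" and H: "H \<subseteq> carrier L"
  shows "generate_field L H = generate_field M H"
proof
  note e = field_extensionD[OF ext]
  interpret L: field L by (rule e(1))
  interpret M: field M by (rule e(2))
  have c: "a \<in> carrier L" if "a \<in> generate_field L H" for a using L.generate_field_in_carrier[OF H that] .
  show "generate_field L H \<subseteq> generate_field M H"
  proof
    fix a assume "a \<in> generate_field L H"
    then show "a \<in> generate_field M H"
    proof induction
      case one then show ?case using generate_field.one e(4) by metis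
    next
      case (a_inv h) then show ?case using generate_field.a_inv field_extension_inverses(1)[OF ext c[OF a_inv(1)]] by metis
    next
      case (m_inv h) then show ?case using generate_field.m_inv field_extension_inverses(2)[OF ext c[OF m_inv(1)]] e(5) by metis
    next
      case (eng_add a b) then show ?case using generate_field.eng_add e(6) c by metis
    next
      case (eng_mult a b) then show ?case using generate_field.eng_mult e(7) c by metis
    qed (rule generate_field.incl)
  qed
  show "generate_field M H \<subseteq> generate_field L H"
  proof
    fix a assume "a \<in> generate_field M H"
    then show "a \<in> generate_field L H"
    proof induction
      case one then show ?case using generate_field.one e(4) by metis
    next
      case (a_inv h) then show ?case using generate_field.a_inv field_extension_inverses(1)[OF ext c[OF a_inv(2)]] by metis
    next
      case (m_inv h) then show ?case using generate_field.m_inv field_extension_inverses(2)[OF ext c[OF m_inv(3)]] e(5) by metis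
    next
      case (eng_add a b) then show ?case using generate_field.eng_add e(6) c by metis
    next
      case (eng_mult a b) then show ?case using generate_field.eng_mult e(7) c by metis
    qed (rule generate_field.incl)
  qed
qed

lemma field_extension_generate:
  assumes K: "field K" and H: "H \<subseteq> carrier K"
  shows "field_extension (K\<lparr>carrier := generate_field K H\<rparr>) K"
    "\<And>H'. H \<subseteq> H' \<Longrightarrow> H' \<subseteq> carrier K \<Longrightarrow>
      field_extension (K\<lparr>carrier := generate_field K H\<rparr>) (K\<lparr>carrier := generate_field K H'\<rparr>)"
    "\<And>k. field_extension k K \<Longrightarrow> carrier k \<subseteq> H \<Longrightarrow> field_extension k (K\<lparr>carrier := generate_field K H\<rparr>)"
proof -
  interpret field K by fact
  show "field_extension (K\<lparr>carrier := generate_field K H\<rparr>) K"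
    unfolding field_extension_def ring_hom_def
    using generate_field_is_field[OF H] generate_field_incl[OF H] K by auto
  show "field_extension (K\<lparr>carrier := generate_field K H\<rparr>) (K\<lparr>carrier := generate_field K H'\<rparr>)"
    if "H \<subseteq> H'" "H' \<subseteq> carrier K" for H'
    unfolding field_extension_def ring_hom_def
    using generate_field_is_field[OF H] generate_field_is_field[OF that(2)] mono_generate_field[OF that] by auto
  show "field_extension k (K\<lparr>carrier := generate_field K H\<rparr>)" if k: "field_extension k K" "carrier k \<subseteq> H" for k
  proof -
    have "carrier k \<subseteq> generate_field K H" using k(2) generate_field.incl[of _ H K] by auto
    then show ?thesis
      unfolding field_extension_def ring_hom_def
      using field_extensionD[OF k(1)] generate_field_is_field[OF H] by auto
  qed
qed

text \<open>Induction on a finite generating set; each further generator is one application of the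
  Hilbert basis and localization step.\<close>

lemma base_change_noetherian_fg:
  assumes R: "assoc_algebra k R" and noeth: "right_noetherian R" and fg: "fg_field_extension k L"
  shows "right_noetherian (base_change_algebra k R L)"
proof -
  have ext: "field_extension k L" using fg unfolding fg_field_extension_def by auto
  interpret L: field L using field_extensionD(2)[OF ext] .
  interpret k: field k using field_extensionD(1)[OF ext] .
  have kc: "carrier k \<subseteq> carrier L" using field_extensionD(3)[OF ext] .
  let ?L = "\<lambda>X. L\<lparr>carrier := generate_field L (carrier k \<union> X)\<rparr>"
  have *: "right_noetherian (base_change_algebra k R (?L X))" if "finite X" "X \<subseteq> carrier L" for X
    using that
  proof (induction X)
    case empty
    have "generate_field L (carrier k) \<subseteq> carrier k"
      using generate_field_extension[OF ext order_refl] k.generate_field_incl[OF order_refl] by simp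
    then have "carrier (?L {}) = carrier k" using generate_field.incl[of _ "carrier k" L] by auto
    moreover have "field_extension k (?L {})" using field_extension_generate(3)[OF L.field_axioms] kc ext by simp
    ultimately show ?case using base_change_noetherian_trivial[OF R _ _ noeth, of "?L {}"] by blast
  next
    case (insert x X)
    let ?H = "carrier k \<union> X" and ?H' = "carrier k \<union> insert x X"
    have H: "?H \<subseteq> carrier L" "?H' \<subseteq> carrier L" "?H \<subseteq> ?H'" using insert kc by auto
    interpret base_change_pair k R "?L X" "?L (insert x X)"
      using R field_extension_generate[OF L.field_axioms H(1)] field_extension_generate[OF L.field_axioms H(2)] H ext
      by unfold_locales auto
    have sf: "subfield (generate_field L ?H') L" using L.generate_field_is_subfield[OF H(2)] .
    show ?case
    proof (rule base_change_noetherian_step)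
      show "right_noetherian src.S" using insert by auto
      show "x \<in> carrier (?L (insert x X))" using generate_field.incl[of x ?H' L] by auto
    next
      fix F assume *: "carrier (?L X) \<subseteq> F" "x \<in> F" "F \<subseteq> carrier (?L (insert x X))"
        "\<And>a b. \<lbrakk>a \<in> F; b \<in> F\<rbrakk> \<Longrightarrow> a \<oplus>\<^bsub>?L (insert x X)\<^esub> b \<in> F"
        "\<And>a b. \<lbrakk>a \<in> F; b \<in> F\<rbrakk> \<Longrightarrow> a \<otimes>\<^bsub>?L (insert x X)\<^esub> b \<in> F"
        "\<And>a. a \<in> F \<Longrightarrow> \<exists>b\<in>F. a \<oplus>\<^bsub>?L (insert x X)\<^esub> b = \<zero>\<^bsub>?L (insert x X)\<^esub>"
        "\<And>a. \<lbrakk>a \<in> F; a \<noteq> \<zero>\<^bsub>?L (insert x X)\<^esub>\<rbrakk> \<Longrightarrow> \<exists>b\<in>F. a \<otimes>\<^bsub>?L (insert x X)\<^esub> b = \<one>\<^bsub>?L (insert x X)\<^esub>"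
      have Fc: "F \<subseteq> carrier L" using *(3) L.generate_field_incl[OF H(2)] by auto
      have "a \<in> F" if "a \<in> generate_field L ?H'" for a
        using that
      proof induction
        case one then show ?case using *(1) generate_field.one[of L ?H] by auto
      next
        case (incl h) then show ?case using *(1,2) generate_field.incl[of h ?H L] by auto
      next
        case (a_inv h)
        then obtain b where b: "b \<in> F" "h \<oplus>\<^bsub>L\<^esub> b = \<zero>\<^bsub>L\<^esub>" using *(6) by auto
        then have "\<ominus>\<^bsub>L\<^esub> h = b" using a_inv Fc by (metis L.a_comm L.minus_equality subsetD)
        then show ?case using b by simp
      next
        case (m_inv h)
        then obtain b where b: "b \<in> F" "h \<otimes>\<^bsub>L\<^esub> b = \<one>\<^bsub>L\<^esub>" using *(7)[of h] by auto
        then have "inv\<^bsub>L\<^esub> h = b" using m_inv Fc by (intro L.comm_inv_char) auto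
        then show ?case using b by simp
      next
        case (eng_add a b) then show ?case using *(4) by auto
      next
        case (eng_mult a b) then show ?case using *(5) by auto
      qed
      then show "carrier (?L (insert x X)) \<subseteq> F" by auto
    qed
  qed
  obtain X where X: "finite X" "X \<subseteq> carrier L" "generate_field L (carrier k \<union> X) = carrier L"
    using fg unfolding fg_field_extension_def by auto
  show ?thesis using *[OF X(1,2)] unfolding X(3) by simp
qed

section \<open>Base change of cyclic modules\<close>

text \<open>Right exactness of base change for cyclic modules: if \<open>M\<close> is
  \<open>S\<^sub>L/I\<close>, then its base change is
  \<open>S\<^sub>L\<^sub>'/I S\<^sub>L\<^sub>'\<close>. This turns hypothesis (ii), a statement
  about base changed modules, into one about extended right ideals.\<close>

locale cyclic_base_change = base_change_pair k R L L'
  for k :: "'a ring" and R :: "('a, 'r) module" and L L' :: "'a ring" +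
  fixes M :: "(('r, 'a) tensor, 'm) module" and f
  assumes f: "hom_onto (base_change_algebra k R L) (regular_module (base_change_algebra k R L)) M f"
begin

sublocale M: rmod src.S M by (rule hom_onto_rmod[OF f])

abbreviation "M\<^sub>0 \<equiv> restrict_scalars src.S M"

sublocale mt: tensor_space L M\<^sub>0 L'
  by (intro tensor_space.intro restrict_scalars_vectorspace[OF src.S_algebra M.rmod_axioms] LL')

abbreviation B where "B \<equiv> base_change_module k R L L' M"

lemma f_simps:
  "x \<in> carrier src.S \<Longrightarrow> f x \<in> carrier M" "f ` carrier src.S = carrier M" "f \<zero>\<^bsub>src.S\<^esub> = \<zero>\<^bsub>M\<^esub>"
  "x \<in> carrier src.S \<Longrightarrow> y \<in> carrier src.S \<Longrightarrow> f (x \<oplus>\<^bsub>src.S\<^esub> y) = f x \<oplus>\<^bsub>M\<^esub> f y"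
  "x \<in> carrier src.S \<Longrightarrow> s \<in> carrier src.S \<Longrightarrow> f (x \<otimes>\<^bsub>src.S\<^esub> s) = s \<odot>\<^bsub>M\<^esub> f x"
  using f unfolding hom_onto_def by (auto simp: regular_module_def)

lemma f_diff: "x \<in> carrier src.S \<Longrightarrow> y \<in> carrier src.S \<Longrightarrow> f (x \<ominus>\<^bsub>src.S\<^esub> y) = f x \<ominus>\<^bsub>M\<^esub> f y"
  using hom_onto_diff[OF f, of x y] by (simp add: a_minus_def a_inv_def m_inv_def regular_module_def)

lemma M0_smult: "c \<in> carrier L \<Longrightarrow> c \<odot>\<^bsub>M\<^sub>0\<^esub> m = src.unit_scalar c \<odot>\<^bsub>M\<^esub> m"
  using src.S_smult[of c "\<one>\<^bsub>src.S\<^esub>"] by (simp add: restrict_scalars_def)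

lemma coeff_act_smult:
  assumes "c \<in> carrier L" "r \<in> carrier R" "m \<in> carrier M"
  shows "src.coeff_map r \<odot>\<^bsub>M\<^esub> (c \<odot>\<^bsub>M\<^sub>0\<^esub> m) = c \<odot>\<^bsub>M\<^sub>0\<^esub> (src.coeff_map r \<odot>\<^bsub>M\<^esub> m)"
  using assms src.unit_scalar_central[of c "src.coeff_map r"]
  by (simp add: M0_smult M.act_mult[symmetric])

definition fa :: "'m \<times> 'a \<Rightarrow> 'r \<times> 'a \<Rightarrow> ('m \<times> 'a \<Rightarrow>\<^sub>0 int)" where
  "fa = (\<lambda>(m, a) (r, b). frag_of (src.coeff_map r \<odot>\<^bsub>M\<^esub> m, a \<otimes>\<^bsub>L'\<^esub> b))"

lemma fa_simp [simp]: "fa (m, a) (r, b) = frag_of (src.coeff_map r \<odot>\<^bsub>M\<^esub> m, a \<otimes>\<^bsub>L'\<^esub> b)"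
  unfolding fa_def by simp

lemma fa_frags: "x \<in> frags M\<^sub>0 L' \<Longrightarrow> t \<in> frags R L' \<Longrightarrow> frag_bilinear fa x t \<in> frags M\<^sub>0 L'"
  by (rule frag_bilinear_frags) auto

lemma fa_null_left: "x \<in> mt.null \<Longrightarrow> t \<in> frags R L' \<Longrightarrow> frag_bilinear fa x t \<in> mt.null"
proof (rule mt.bilinear_null_left[of mt.null])
  fix x s b assume "x \<in> tensor_rels L M\<^sub>0 L'" and s: "s \<in> carrier R" "b \<in> carrier L'"
  then show "frag_bilinear fa x (frag_of (s, b)) \<in> mt.null"
  proof (cases rule: mt.rels_cases)
    case (left x y a)
    then show ?thesis using s mt.null_rel(1)[of "src.coeff_map s \<odot>\<^bsub>M\<^esub> x" "src.coeff_map s \<odot>\<^bsub>M\<^esub> y" "a \<otimes>\<^bsub>L'\<^esub> b"]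
      by (simp add: M.act_radd)
  next
    case (right x a b')
    then show ?thesis using s mt.null_rel(2)[of "src.coeff_map s \<odot>\<^bsub>M\<^esub> x" "a \<otimes>\<^bsub>L'\<^esub> b" "b' \<otimes>\<^bsub>L'\<^esub> b"]
      by (simp add: tgt.L.l_distr)
  next
    case (scalar c x a)
    then show ?thesis using s mt.null_rel(3)[of c "src.coeff_map s \<odot>\<^bsub>M\<^esub> x" "a \<otimes>\<^bsub>L'\<^esub> b"]
      by (simp add: coeff_act_smult mt.kL tgt.L.m_assoc)
  qed
qed (auto intro: mt.null_diff)

lemma fa_null_right: "t \<in> tgt.null \<Longrightarrow> x \<in> frags M\<^sub>0 L' \<Longrightarrow> frag_bilinear fa x t \<in> mt.null"
proof (rule tgt.bilinear_null_right[of mt.null])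
  fix t m b assume "t \<in> tensor_rels k R L'" and s: "m \<in> carrier M\<^sub>0" "b \<in> carrier L'"
  then show "frag_bilinear fa (frag_of (m, b)) t \<in> mt.null"
  proof (cases rule: tgt.rels_cases)
    case (left x y a)
    then show ?thesis using s mt.null_rel(1)[of "src.coeff_map x \<odot>\<^bsub>M\<^esub> m" "src.coeff_map y \<odot>\<^bsub>M\<^esub> m" "b \<otimes>\<^bsub>L'\<^esub> a"]
      using src.coeff_map_hom M.act_ladd[of "src.coeff_map x" "src.coeff_map y" m] by (simp add: ring_hom_def)
  next
    case (right x a b')
    then show ?thesis using s mt.null_rel(2)[of "src.coeff_map x \<odot>\<^bsub>M\<^esub> m" "b \<otimes>\<^bsub>L'\<^esub> a" "b \<otimes>\<^bsub>L'\<^esub> b'"]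
      by (simp add: tgt.L.r_distr)
  next
    case (scalar c x a)
    have cL: "c \<in> carrier L" using scalar src.kL by simp
    have "src.coeff_map (c \<odot>\<^bsub>R\<^esub> x) \<odot>\<^bsub>M\<^esub> m = (src.unit_scalar c \<otimes>\<^bsub>src.S\<^esub> src.coeff_map x) \<odot>\<^bsub>M\<^esub> m"
      using scalar cL by (simp add: src.coeff_map_smult src.S_smult)
    also have "\<dots> = c \<odot>\<^bsub>M\<^sub>0\<^esub> (src.coeff_map x \<odot>\<^bsub>M\<^esub> m)"
      using scalar cL s src.unit_scalar_central[of c "src.coeff_map x"]
      by (simp add: M0_smult M.act_mult[symmetric])
    finally show ?thesis using s scalar cL mt.kL[OF cL] mt.null_rel(3)[of c "src.coeff_map x \<odot>\<^bsub>M\<^esub> m" "b \<otimes>\<^bsub>L'\<^esub> a"]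
      by (simp add: tgt.L.m_lcomm)
  qed
qed (auto intro: mt.null_diff)

lemma B_carrier: "carrier B = mt.cl ` frags M\<^sub>0 L'"
  unfolding base_change_module_def Let_def using mt.cosets_eq by simp

lemma B_add: "mt.cl x \<oplus>\<^bsub>B\<^esub> mt.cl y = mt.cl (x + y)"
  unfolding base_change_module_def Let_def using mt.cl_add by simp

lemma B_zero: "\<zero>\<^bsub>B\<^esub> = mt.cl 0"
  unfolding base_change_module_def Let_def using mt.cl_zero by simp

lemma B_smult:
  assumes t: "t \<in> frags R L'" and x: "x \<in> frags M\<^sub>0 L'"
  shows "tgt.cl t \<odot>\<^bsub>B\<^esub> mt.cl x = mt.cl (frag_bilinear fa x t)"
proof -
  have e: "(\<lambda>(m, a). frag_extend (\<lambda>(r, b).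
           frag_of (tensor_class k R L (frag_of (r, \<one>\<^bsub>L\<^esub>)) \<odot>\<^bsub>M\<^esub> m, a \<otimes>\<^bsub>L'\<^esub> b)) y) = (\<lambda>p. frag_extend (fa p) y)" for y
    by (auto simp: fun_eq_iff fa_def src.coeff_map_def)
  have "tgt.cl t \<odot>\<^bsub>B\<^esub> mt.cl x = (\<Union>t'\<in>tgt.cl t. \<Union>x'\<in>mt.cl x. mt.cl (frag_bilinear fa x' t'))"
    unfolding base_change_module_def Let_def frag_bilinear_def by (simp add: e)
  also have "\<dots> = (\<Union>t'\<in>tgt.cl t. \<Union>x'\<in>mt.cl x. mt.cl (frag_bilinear fa x t))"
  proof (intro SUP_cong refl)
    fix t' x' assume tx: "t' \<in> tgt.cl t" "x' \<in> mt.cl x"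
    have fr: "t' \<in> frags R L'" "x' \<in> frags M\<^sub>0 L'" using tx t x tgt.cl_mem_frags mt.cl_mem_frags by auto
    have n: "t' - t \<in> tgt.null" "x' - x \<in> mt.null"
      using tgt.cl_mem[OF tx(1)] mt.cl_mem[OF tx(2)] tgt.cl_eq_iff mt.cl_eq_iff by auto
    have eq: "frag_bilinear fa x' t' - frag_bilinear fa x t = frag_bilinear fa (x' - x) t' + frag_bilinear fa x (t' - t)"
      by simp
    show "mt.cl (frag_bilinear fa x' t') = mt.cl (frag_bilinear fa x t)"
      unfolding mt.cl_eq_iff eq by (intro mt.null_add fa_null_left fa_null_right n fr x)
  qed
  also have "\<dots> = mt.cl (frag_bilinear fa x t)" using tgt.cl_self[of t] mt.cl_self[of x] by auto
  finally show ?thesis .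
qed

definition gen where "gen = frag_of (f \<one>\<^bsub>src.S\<^esub>, \<one>\<^bsub>L'\<^esub>)"

definition \<psi> where "\<psi> X = X \<odot>\<^bsub>B\<^esub> mt.cl gen"

lemma f_one_closed [simp]: "f \<one>\<^bsub>src.S\<^esub> \<in> carrier M"
  using f_simps(1) by simp

lemma f_one_act: "s \<in> carrier src.S \<Longrightarrow> s \<odot>\<^bsub>M\<^esub> f \<one>\<^bsub>src.S\<^esub> = f s"
  using f_simps(5)[of "\<one>\<^bsub>src.S\<^esub>" s] by simp

lemma gen_frags [simp]: "gen \<in> frags M\<^sub>0 L'"
  unfolding gen_def by simp

lemma \<psi>_cl: "t \<in> frags R L' \<Longrightarrow> \<psi> (tgt.cl t) = mt.cl (frag_bilinear fa gen t)"
  unfolding \<psi>_def by (simp add: B_smult)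

lemma fa_fm:
  assumes "t \<in> frags R L'" "u \<in> frags R L'"
  shows "frag_bilinear fa gen (frag_bilinear tgt.fm t u) = frag_bilinear fa (frag_bilinear fa gen t) u"
  using assms(1)
proof (induction rule: frags_induct)
  case (pure r a)
  show ?case using assms(2)
  proof (induction rule: frags_induct)
    case (pure s b)
    have "src.coeff_map (r \<otimes>\<^bsub>R\<^esub> s) = src.coeff_map r \<otimes>\<^bsub>src.S\<^esub> src.coeff_map s"
      using src.coeff_map_hom pure \<open>r \<in> carrier R\<close> by (simp add: ring_hom_def)
    then show ?case using pure \<open>r \<in> carrier R\<close> \<open>a \<in> carrier L'\<close>
      by (simp add: gen_def M.act_mult)
  qed auto
qed auto

lemma zero_null: "a \<in> carrier L' \<Longrightarrow> frag_of (\<zero>\<^bsub>M\<^esub>, a) \<in> mt.null"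
  using mt.null_minus[OF mt.null_rel(1)[of "\<zero>\<^bsub>M\<^esub>" "\<zero>\<^bsub>M\<^esub>" a]] by simp

text \<open>The tensor of \<open>f u\<close> and \<open>a\<close> is the generator acted on by
  \<open>u (1 \<otimes> a)\<close>. For general \<open>a\<close> this gives surjectivity of
  \<open>\<psi>\<close>; for \<open>a = 1\<close> it shows that \<open>\<psi>\<close> kills the
  image of the kernel of \<open>f\<close>.\<close>

lemma pure_in_image:
  assumes u: "u \<in> frags R L" and a: "a \<in> carrier L'"
  shows "frag_of (f (src.cl u), a) - frag_bilinear fa gen (frag_bilinear tgt.fm u (frag_of (\<one>\<^bsub>R\<^esub>, a))) \<in> mt.null"
  using u
proof (induction rule: frags_induct)
  case zero
  show ?case using zero_null[OF a] f_simps(3) by (simp add: src.S_zero)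
next
  case (pure r c)
  have cL: "c \<in> carrier L'" using pure ext_simps(1) by auto
  have "f (src.cl (frag_of (r, c))) = src.unit_scalar c \<odot>\<^bsub>M\<^esub> (src.coeff_map r \<odot>\<^bsub>M\<^esub> f \<one>\<^bsub>src.S\<^esub>)"
    using pure f_simps(5) by (simp add: src.pure_eq f_one_act)
  also have "\<dots> = c \<odot>\<^bsub>M\<^sub>0\<^esub> (src.coeff_map r \<odot>\<^bsub>M\<^esub> f \<one>\<^bsub>src.S\<^esub>)" using pure by (simp add: M0_smult)
  finally show ?case
    using pure cL a mt.null_rel(3)[of c "src.coeff_map r \<odot>\<^bsub>M\<^esub> f \<one>\<^bsub>src.S\<^esub>" a] by (simp add: gen_def)
next
  case (diff x y)
  have c: "src.cl x \<in> carrier src.S" "src.cl y \<in> carrier src.S" "src.cl (x - y) \<in> carrier src.S"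
    using diff unfolding src.S_carrier by auto
  have "f (src.cl x) = f (src.cl (x - y)) \<oplus>\<^bsub>M\<^esub> f (src.cl y)"
    using f_simps(4)[OF c(3,2)] by (simp add: src.S_add)
  then have "frag_of (f (src.cl x), a) - frag_of (f (src.cl (x - y)), a) - frag_of (f (src.cl y), a) \<in> mt.null"
    using mt.null_rel(1)[of "f (src.cl (x - y))" "f (src.cl y)" a] c a f_simps(1) by simp
  from mt.null_diff[OF mt.null_diff[OF diff.IH] this] show ?case by (simp add: algebra_simps)
qed

lemma \<psi>_hom_onto: "hom_onto tgt.S (regular_module tgt.S) B \<psi>"
  unfolding hom_onto_def
proof (intro conjI ballI)
  show "rmod tgt.S (regular_module tgt.S)" by (rule tgt.SR.regular_rmod)
  show "\<psi> \<zero>\<^bsub>regular_module tgt.S\<^esub> = \<zero>\<^bsub>B\<^esub>"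
    by (simp add: regular_module_def tgt.S_zero \<psi>_cl B_zero)
next
  fix x y assume "x \<in> carrier (regular_module tgt.S)" "y \<in> carrier (regular_module tgt.S)"
  then obtain t u where "x = tgt.cl t" "t \<in> frags R L'" "y = tgt.cl u" "u \<in> frags R L'"
    unfolding regular_module_def tgt.S_carrier by auto
  then show "\<psi> (x \<oplus>\<^bsub>regular_module tgt.S\<^esub> y) = \<psi> x \<oplus>\<^bsub>B\<^esub> \<psi> y"
    by (simp add: regular_module_def tgt.S_add \<psi>_cl B_add)
next
  fix s x assume "s \<in> carrier tgt.S" "x \<in> carrier (regular_module tgt.S)"
  then obtain t u where "x = tgt.cl t" "t \<in> frags R L'" "s = tgt.cl u" "u \<in> frags R L'"
    unfolding regular_module_def tgt.S_carrier by auto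
  then show "\<psi> (s \<odot>\<^bsub>regular_module tgt.S\<^esub> x) = s \<odot>\<^bsub>B\<^esub> \<psi> x"
    by (simp add: regular_module_def tgt.S_mult \<psi>_cl B_smult tgt.fm_frags fa_frags fa_fm)
next
  have "mt.cl x \<in> \<psi> ` carrier tgt.S" if "x \<in> frags M\<^sub>0 L'" for x
  proof -
    have "\<exists>t\<in>frags R L'. x - frag_bilinear fa gen t \<in> mt.null"
      using that
    proof (induction rule: frags_induct)
      case zero show ?case by (intro bexI[of _ 0]) auto
    next
      case (pure m a)
      then obtain s where s: "s \<in> carrier src.S" "m = f s" using f_simps(2) by auto
      then obtain u where u: "s = src.cl u" "u \<in> frags R L" unfolding src.S_carrier by auto
      show ?case using pure_in_image[OF u(2) pure(2)] s u pure frags_mono tgt.fm_frags by auto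
    next
      case (diff x y)
      then obtain t u where tu: "t \<in> frags R L'" "x - frag_bilinear fa gen t \<in> mt.null"
        "u \<in> frags R L'" "y - frag_bilinear fa gen u \<in> mt.null" by auto
      then have "x - y - frag_bilinear fa gen (t - u) \<in> mt.null"
        using mt.null_diff[OF tu(2,4)] by (simp add: algebra_simps)
      then show ?case using tu by (intro bexI[of _ "t - u"]) auto
    qed
    then obtain t where t: "t \<in> frags R L'" "x - frag_bilinear fa gen t \<in> mt.null" by auto
    then have "mt.cl x = \<psi> (tgt.cl t)" using \<psi>_cl mt.cl_eq_iff by auto
    then show ?thesis using t unfolding tgt.S_carrier by auto
  qed
  moreover have "\<psi> x \<in> mt.cl ` frags M\<^sub>0 L'" if "x \<in> carrier tgt.S" for x
    using that unfolding tgt.S_carrier by (auto simp: \<psi>_cl fa_frags)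
  ultimately show "\<psi> ` carrier (regular_module tgt.S) = carrier B"
    unfolding B_carrier by (auto simp: regular_module_def)
qed

abbreviation J where "J \<equiv> tgt.SR.right_ideal_gen (\<beta> ` hom_kernel (regular_module src.S) M f)"

lemma kernel_carrier: "hom_kernel (regular_module src.S) M f \<subseteq> carrier src.S"
  unfolding hom_kernel_def by (auto simp: regular_module_def)

lemma J_facts: "right_ideal tgt.S J" "\<beta> ` hom_kernel (regular_module src.S) M f \<subseteq> J"
  "\<And>K. right_ideal tgt.S K \<Longrightarrow> \<beta> ` hom_kernel (regular_module src.S) M f \<subseteq> K \<Longrightarrow> J \<subseteq> K"
proof -
  have c: "\<beta> ` hom_kernel (regular_module src.S) M f \<subseteq> carrier tgt.S"
    using kernel_carrier map_simps(1) by auto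
  show "right_ideal tgt.S J" "\<beta> ` hom_kernel (regular_module src.S) M f \<subseteq> J"
    "\<And>K. right_ideal tgt.S K \<Longrightarrow> \<beta> ` hom_kernel (regular_module src.S) M f \<subseteq> K \<Longrightarrow> J \<subseteq> K"
    using tgt.SR.right_ideal_gen[OF c] by auto
qed

lemma J_le_kernel: "J \<subseteq> hom_kernel (regular_module tgt.S) B \<psi>"
proof (rule J_facts(3))
  show "right_ideal tgt.S (hom_kernel (regular_module tgt.S) B \<psi>)"
    using hom_kernel_submodule[OF \<psi>_hom_onto] tgt.SR.right_ideal_iff by blast
  show "\<beta> ` hom_kernel (regular_module src.S) M f \<subseteq> hom_kernel (regular_module tgt.S) B \<psi>"
  proof clarify
    fix s assume "s \<in> hom_kernel (regular_module src.S) M f"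
    then have s: "s \<in> carrier src.S" "f s = \<zero>\<^bsub>M\<^esub>" unfolding hom_kernel_def by (auto simp: regular_module_def)
    then obtain u where u: "s = src.cl u" "u \<in> frags R L" unfolding src.S_carrier by auto
    have u': "u \<in> frags R L'" using u frags_mono by auto
    have "frag_of (f s, \<one>\<^bsub>L'\<^esub>) - frag_bilinear fa gen u \<in> mt.null"
      using pure_in_image[OF u(2), of "\<one>\<^bsub>L'\<^esub>"] u(1) tgt.fm_one(2)[OF u'] by simp
    then have "frag_bilinear fa gen u \<in> mt.null"
      using mt.null_diff[OF zero_null[of "\<one>\<^bsub>L'\<^esub>"], of "frag_of (f s, \<one>\<^bsub>L'\<^esub>) - frag_bilinear fa gen u"] s by simp
    then have "\<psi> (\<beta> s) = \<zero>\<^bsub>B\<^esub>" unfolding u(1) map_cl using \<psi>_cl[OF u'] mt.cl_null B_zero mt.cl_zero by simp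
    then show "\<beta> s \<in> hom_kernel (regular_module tgt.S) B \<psi>"
      unfolding hom_kernel_def using s map_simps(1) by (simp add: regular_module_def)
  qed
qed

text \<open>The inverse of \<open>\<psi>\<close> sends \<open>m \<otimes> a\<close> to a preimage of \<open>m\<close> times \<open>a\<close>; it is constructed on the level of
  representatives.\<close>

lemma kernel_le_J: "hom_kernel (regular_module tgt.S) B \<psi> \<subseteq> J"
proof -
  have "\<exists>u\<in>frags R L. f (src.cl u) = m" if "m \<in> carrier M" for m
    using that f_simps(2) unfolding src.S_carrier by force
  then obtain \<tau> where \<tau>: "\<And>m. m \<in> carrier M \<Longrightarrow> \<tau> m \<in> frags R L" "\<And>m. m \<in> carrier M \<Longrightarrow> f (src.cl (\<tau> m)) = m"
    by metis
  define q where "q m = src.cl (\<tau> m)" for m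
  have q: "q m \<in> carrier src.S" "f (q m) = m" if "m \<in> carrier M" for m
    using \<tau>[OF that] unfolding q_def src.S_carrier by auto
  define th where "th = (\<lambda>(m, a). frag_bilinear tgt.fm (\<tau> m) (frag_of (\<one>\<^bsub>R\<^esub>, a)))"
  define \<Theta> where "\<Theta> = frag_extend th"
  define N where "N = {y \<in> frags R L'. tgt.cl y \<in> J}"
  have Jadd: "x \<oplus>\<^bsub>tgt.S\<^esub> y \<in> J" "x \<ominus>\<^bsub>tgt.S\<^esub> y \<in> J" if "x \<in> J" "y \<in> J" for x y
    using J_facts(1) tgt.SR.right_ideal_diff[OF J_facts(1)] that unfolding right_ideal_def by auto
  have Jmult: "x \<otimes>\<^bsub>tgt.S\<^esub> y \<in> J" if "x \<in> J" "y \<in> carrier tgt.S" for x y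
    using J_facts(1) that unfolding right_ideal_def by auto
  have N0: "0 \<in> N" using J_facts(1) unfolding N_def right_ideal_def by (auto simp: tgt.S_zero)
  have Nd: "x - y \<in> N" if "x \<in> N" "y \<in> N" for x y
    using that Jadd(2) tgt.S_diff unfolding N_def by fastforce
  \<comment> \<open>Two preimages of the same element agree modulo \<open>J\<close> after base
    change; this compensates for the arbitrary and nonadditive choice of preimages in
    \<open>\<tau>\<close>.\<close>
  have ker: "\<beta> s \<ominus>\<^bsub>tgt.S\<^esub> \<beta> s' \<in> J" if s: "s \<in> carrier src.S" "s' \<in> carrier src.S" "f s = f s'" for s s'
  proof -
    have "s \<ominus>\<^bsub>src.S\<^esub> s' \<in> hom_kernel (regular_module src.S) M f"
      using f_diff[OF s(1,2)] s f_simps(1) unfolding hom_kernel_def by (simp add: regular_module_def)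
    then show ?thesis using J_facts(2) map_diff[OF s(1,2)] by auto
  qed
  have th: "th (m, a) \<in> frags R L'" "tgt.cl (th (m, a)) = \<beta> (q m) \<otimes>\<^bsub>tgt.S\<^esub> tgt.unit_scalar a"
    if "m \<in> carrier M" "a \<in> carrier L'" for m a
    using \<tau>(1)[OF that(1)] that frags_mono unfolding th_def q_def map_cl tgt.unit_scalar_def
    by (auto simp: tgt.S_mult tgt.fm_frags)
  have \<beta>q: "\<beta> (q m) \<in> carrier tgt.S" if "m \<in> carrier M" for m using q that map_simps(1) by auto
  have null_N: "\<Theta> x \<in> N" if "x \<in> mt.null" for x
    using that
  proof (rule mt.null_subset[OF N0 Nd, rotated -1])
    show "\<Theta> 0 = 0" "\<And>x y. \<Theta> (x - y) = \<Theta> x - \<Theta> y" unfolding \<Theta>_def by (auto simp: frag_extend_diff)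
    fix x assume "x \<in> tensor_rels L M\<^sub>0 L'"
    then show "\<Theta> x \<in> N"
    proof (cases rule: mt.rels_cases)
      case (left m m' a)
      then have m: "m \<in> carrier M" "m' \<in> carrier M" "m \<oplus>\<^bsub>M\<^esub> m' \<in> carrier M" by auto
      let ?z = "tgt.unit_scalar a"
      have fr: "\<Theta> x = th (m \<oplus>\<^bsub>M\<^esub> m', a) - (th (m, a) + th (m', a))"
        unfolding \<Theta>_def left(4) by (simp add: frag_extend_diff frag_extend_add algebra_simps)
      have frc: "th (m \<oplus>\<^bsub>M\<^esub> m', a) \<in> frags R L'" "th (m, a) + th (m', a) \<in> frags R L'"
        using th(1) m left by auto
      have "tgt.cl (\<Theta> x) = \<beta> (q (m \<oplus>\<^bsub>M\<^esub> m')) \<otimes>\<^bsub>tgt.S\<^esub> ?z \<ominus>\<^bsub>tgt.S\<^esub> (\<beta> (q m) \<otimes>\<^bsub>tgt.S\<^esub> ?z \<oplus>\<^bsub>tgt.S\<^esub> \<beta> (q m') \<otimes>\<^bsub>tgt.S\<^esub> ?z)"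
        unfolding fr tgt.S_diff[OF frc, symmetric] tgt.S_add[symmetric] using th(2) m left by simp
      also have "\<dots> = (\<beta> (q (m \<oplus>\<^bsub>M\<^esub> m')) \<ominus>\<^bsub>tgt.S\<^esub> \<beta> (q m \<oplus>\<^bsub>src.S\<^esub> q m')) \<otimes>\<^bsub>tgt.S\<^esub> ?z"
        using m \<beta>q left q(1) by (simp add: map_simps(3) tgt.SR.minus_eq tgt.SR.l_distr tgt.SR.l_minus)
      also have "\<dots> \<in> J" using m left q by (intro Jmult ker) (auto simp: f_simps(4))
      finally show ?thesis unfolding N_def using fr frc by auto
    next
      case (right m a b)
      then have m: "m \<in> carrier M" by auto
      have fr: "\<Theta> x = th (m, a \<oplus>\<^bsub>L'\<^esub> b) - (th (m, a) + th (m, b))"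
        unfolding \<Theta>_def right(4) by (simp add: frag_extend_diff frag_extend_add algebra_simps)
      have frc: "th (m, a \<oplus>\<^bsub>L'\<^esub> b) \<in> frags R L'" "th (m, a) + th (m, b) \<in> frags R L'"
        using th(1) m right by auto
      have "tgt.cl (\<Theta> x) = \<beta> (q m) \<otimes>\<^bsub>tgt.S\<^esub> tgt.unit_scalar (a \<oplus>\<^bsub>L'\<^esub> b) \<ominus>\<^bsub>tgt.S\<^esub>
          (\<beta> (q m) \<otimes>\<^bsub>tgt.S\<^esub> tgt.unit_scalar a \<oplus>\<^bsub>tgt.S\<^esub> \<beta> (q m) \<otimes>\<^bsub>tgt.S\<^esub> tgt.unit_scalar b)"
        unfolding fr tgt.S_diff[OF frc, symmetric] tgt.S_add[symmetric] using th(2) m right by simp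
      also have "\<dots> = \<zero>\<^bsub>tgt.S\<^esub>"
        using m \<beta>q right by (simp add: tgt.unit_scalar_simps tgt.SR.r_distr tgt.SR.r_neg tgt.SR.minus_eq)
      also have "\<dots> \<in> J" using J_facts(1) unfolding right_ideal_def by simp
      finally show ?thesis unfolding N_def using fr frc by auto
    next
      case (scalar c m a)
      then have m: "m \<in> carrier M" "c \<odot>\<^bsub>M\<^sub>0\<^esub> m \<in> carrier M" by (auto simp: M0_smult)
      have cL: "c \<in> carrier L'" "c \<in> carrier L" using scalar mt.kL by auto
      let ?z = "tgt.unit_scalar a"
      have fr: "\<Theta> x = th (c \<odot>\<^bsub>M\<^sub>0\<^esub> m, a) - th (m, c \<otimes>\<^bsub>L'\<^esub> a)"
        unfolding \<Theta>_def scalar(4) by (simp add: frag_extend_diff)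
      have frc: "th (c \<odot>\<^bsub>M\<^sub>0\<^esub> m, a) \<in> frags R L'" "th (m, c \<otimes>\<^bsub>L'\<^esub> a) \<in> frags R L'"
        using th(1) m scalar cL by auto
      have "tgt.cl (\<Theta> x) = \<beta> (q (c \<odot>\<^bsub>M\<^sub>0\<^esub> m)) \<otimes>\<^bsub>tgt.S\<^esub> ?z \<ominus>\<^bsub>tgt.S\<^esub> \<beta> (q m) \<otimes>\<^bsub>tgt.S\<^esub> tgt.unit_scalar (c \<otimes>\<^bsub>L'\<^esub> a)"
        unfolding fr tgt.S_diff[OF frc, symmetric] using th(2) m scalar cL by simp
      also have "\<dots> = (\<beta> (q (c \<odot>\<^bsub>M\<^sub>0\<^esub> m)) \<ominus>\<^bsub>tgt.S\<^esub> \<beta> (q m \<otimes>\<^bsub>src.S\<^esub> src.unit_scalar c)) \<otimes>\<^bsub>tgt.S\<^esub> ?z"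
        using m \<beta>q scalar cL q(1)
        by (simp add: map_simps(2) map_unit_scalar tgt.unit_scalar_simps tgt.SR.minus_eq tgt.SR.l_distr tgt.SR.l_minus tgt.SR.m_assoc)
      also have "\<dots> \<in> J" using m scalar q cL by (intro Jmult ker) (auto simp: f_simps(5) M0_smult)
      finally show ?thesis unfolding N_def using fr frc by auto
    qed
  qed
  \<comment> \<open>Modulo \<open>J\<close>, the map \<open>\<Theta>\<close> undoes
    \<open>\<psi>\<close>. If \<open>\<psi>\<close> sends \<open>t\<close> to a null element, then
    \<open>null_N\<close> puts its image under \<open>\<Theta>\<close> in \<open>N\<close>, and
    hence \<open>t\<close> as well.\<close>
  have retract: "\<Theta> (frag_bilinear fa gen t) - t \<in> N" if "t \<in> frags R L'" for t
    using that
  proof (induction rule: frags_induct)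
    case zero then show ?case using N0 by (simp add: \<Theta>_def)
  next
    case (pure r b)
    let ?m = "src.coeff_map r \<odot>\<^bsub>M\<^esub> f \<one>\<^bsub>src.S\<^esub>"
    have m: "?m \<in> carrier M" "?m = f (src.coeff_map r)" using pure f_simps(1) by (auto simp: f_one_act)
    have fr: "\<Theta> (frag_bilinear fa gen (frag_of (r, b))) = th (?m, b)" using pure by (simp add: gen_def \<Theta>_def)
    have "tgt.cl (th (?m, b) - frag_of (r, b)) = \<beta> (q ?m) \<otimes>\<^bsub>tgt.S\<^esub> tgt.unit_scalar b \<ominus>\<^bsub>tgt.S\<^esub> \<beta> (src.coeff_map r) \<otimes>\<^bsub>tgt.S\<^esub> tgt.unit_scalar b"
      using tgt.S_diff[OF th(1)[OF m(1) pure(2)], of "frag_of (r, b)"] th(2)[OF m(1) pure(2)] pure tgt.pure_eq[OF pure] map_coeff_map by simp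
    also have "\<dots> = (\<beta> (q ?m) \<ominus>\<^bsub>tgt.S\<^esub> \<beta> (src.coeff_map r)) \<otimes>\<^bsub>tgt.S\<^esub> tgt.unit_scalar b"
      using \<beta>q[OF m(1)] map_simps(1)[OF src.coeff_map_closed[OF pure(1)]] pure
      by (simp add: tgt.SR.minus_eq tgt.SR.l_distr tgt.SR.l_minus)
    also have "\<dots> \<in> J" using m q pure by (intro Jmult ker) auto
    finally show ?case unfolding N_def fr using th(1)[OF m(1) pure(2)] pure by auto
  next
    case (diff x y)
    then show ?case using Nd[OF diff.IH] by (simp add: \<Theta>_def frag_extend_diff algebra_simps)
  qed
  show ?thesis
  proof
    fix s assume "s \<in> hom_kernel (regular_module tgt.S) B \<psi>"
    then have s: "s \<in> carrier tgt.S" "\<psi> s = \<zero>\<^bsub>B\<^esub>" unfolding hom_kernel_def by (auto simp: regular_module_def)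
    then obtain t where t: "s = tgt.cl t" "t \<in> frags R L'" unfolding tgt.S_carrier by auto
    have "mt.cl (frag_bilinear fa gen t) = mt.cl 0" using s t \<psi>_cl B_zero by simp
    then have "frag_bilinear fa gen t \<in> mt.null" unfolding mt.cl_eq_iff by simp
    then have "\<Theta> (frag_bilinear fa gen t) \<in> N" by (rule null_N)
    then have "\<Theta> (frag_bilinear fa gen t) - (\<Theta> (frag_bilinear fa gen t) - t) \<in> N" using Nd retract[OF t(2)] by blast
    then show "s \<in> J" unfolding N_def t(1) by simp
  qed
qed

lemma base_change_module_cyclic:
  "hom_onto tgt.S (regular_module tgt.S) B \<psi>" "hom_kernel (regular_module tgt.S) B \<psi> = J"
  using \<psi>_hom_onto J_le_kernel kernel_le_J by auto

end

section \<open>The dimension function on right ideals\<close>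

lemma hom_kernel_comp_inj:
  assumes "hom_onto S M P f" "hom_onto S P Q h" "inj_on h (carrier P)"
  shows "hom_kernel M Q (h \<circ> f) = hom_kernel M P f"
proof -
  interpret P: rmod S P using hom_onto_rmod[OF assms(1)] .
  have "h (f x) = \<zero>\<^bsub>Q\<^esub> \<longleftrightarrow> f x = \<zero>\<^bsub>P\<^esub>" if "x \<in> carrier M" for x
  proof -
    have "f x \<in> carrier P" "h \<zero>\<^bsub>P\<^esub> = \<zero>\<^bsub>Q\<^esub>" using assms that unfolding hom_onto_def by auto
    then show ?thesis using inj_on_eq_iff[OF assms(3) _ P.M.zero_closed, of "f x"] by simp
  qed
  then show ?thesis unfolding hom_kernel_def by auto
qed

lemma (in ring) quotient_copy:
  assumes X: "right_ideal R X" and Y: "right_ideal R Y" "Y \<subseteq> X"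
  obtains Q :: "('a, 'a fg_elem) module" and \<pi>
  where "hom_onto R (ideal_module R X) Q \<pi>" "hom_kernel (ideal_module R X) Q \<pi> = Y"
proof -
  \<comment> \<open>Each ring element is viewed as a constant function, so a coset becomes an
    element of the prescribed type.\<close>
  let ?j = "\<lambda>C. (\<lambda>x. (\<lambda>_. x)) ` C :: 'a fg_elem"
  have "inj ?j" by (intro injI) (auto simp: inj_image_eq_iff inj_def fun_eq_iff)
  then have j: "inj_on ?j (carrier (quotient_module (ideal_module R X) Y))" by (rule inj_on_subset) auto
  have sub: "is_submodule R (ideal_module R X) Y" using submodule_ideal_module_iff[OF X] Y by auto
  note q = quotient_module_hom_onto[OF ideal_module_rmod[OF X] sub]
  obtain Q :: "('a, 'a fg_elem) module" where Q: "hom_onto R (quotient_module (ideal_module R X) Y) Q ?j"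
    using hom_onto_copy[OF hom_onto_rmod[OF q(1)] j] .
  from that[OF hom_onto_comp[OF q(1) Q]] show thesis
    using hom_kernel_comp_inj[OF q(1) Q j] q(2) by simp
qed

locale gk_algebra =
  fixes L :: "'a ring" and S :: "('a, 's) module"
  assumes alg: "assoc_algebra L S" and noeth: "right_noetherian S"
    and exact: "GK_exact L S" and partitive: "GK_finitely_partitive L S" and integer: "GK_integer_valued L S"
begin

sublocale ring S using alg unfolding assoc_algebra_def by auto

abbreviation ideals where "ideals \<equiv> {I. right_ideal S I}"

lemma fg_quotient:
  "right_ideal S X \<Longrightarrow> hom_onto S (ideal_module S X) Q \<pi> \<Longrightarrow> fg_right_module S Q"
  using fg_right_module_hom_onto noeth unfolding right_noetherian_iff by blast

lemma GKdim_factor_copy: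
  "right_ideal S X \<Longrightarrow> hom_onto S (ideal_module S X) Q \<pi> \<Longrightarrow>
    GKdim L S Q = GKdim_factor L S X (hom_kernel (ideal_module S X) Q \<pi>)"
  using GKdim_factor_eq[OF alg] .

text \<open>Integer valuedness makes this well defined whenever \<open>Y\<close> lies in
  \<open>X\<close>, and integers support the inductions on dimension that extended reals do
  not.\<close>

definition gk :: "'s set \<Rightarrow> 's set \<Rightarrow> int" where
  "gk X Y = (THE z. GKdim_factor L S X Y = ereal (of_int z))"

lemma gk_eq:
  assumes X: "right_ideal S X" and Y: "right_ideal S Y" "Y \<subseteq> X"
  shows "GKdim_factor L S X Y = ereal (of_int (gk X Y))"
proof -
  obtain Q :: "('s, 's fg_elem) module" and \<pi> where
    Q: "hom_onto S (ideal_module S X) Q \<pi>" "hom_kernel (ideal_module S X) Q \<pi> = Y"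
    using quotient_copy[OF X Y] .
  obtain z :: int where "GKdim L S Q = ereal (of_int z)"
    using integer fg_quotient[OF X Q(1)] unfolding GK_integer_valued_def by blast
  then have z: "GKdim_factor L S X Y = ereal (of_int z)" using GKdim_factor_copy[OF X Q(1)] Q(2) by simp
  show ?thesis unfolding gk_def by (rule theI[of _ z]) (use z in auto)
qed

lemma gk_copy:
  assumes X: "right_ideal S X" and \<pi>: "hom_onto S (ideal_module S X) Q \<pi>"
  shows "GKdim L S Q = ereal (of_int (gk X (hom_kernel (ideal_module S X) Q \<pi>)))"
proof -
  have "right_ideal S (hom_kernel (ideal_module S X) Q \<pi>) \<and> hom_kernel (ideal_module S X) Q \<pi> \<subseteq> X"
    using hom_kernel_submodule[OF \<pi>] submodule_ideal_module_iff[OF X] by blast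
  then show ?thesis using GKdim_factor_copy[OF assms] gk_eq[OF X] by simp
qed

lemma restrict_hom:
  assumes X: "right_ideal S X" and \<pi>: "hom_onto S (ideal_module S X) Q \<pi>"
    and A: "right_ideal S A" "A \<subseteq> X"
  shows "hom_onto S (ideal_module S A) (Q\<lparr>carrier := \<pi> ` A\<rparr>) \<pi>"
    "hom_kernel (ideal_module S A) (Q\<lparr>carrier := \<pi> ` A\<rparr>) \<pi> = A \<inter> hom_kernel (ideal_module S X) Q \<pi>"
  using hom_onto_restrict[OF \<pi>, of A] submodule_ideal_module_iff[OF X] A
  by (auto simp: ideal_module_restrict hom_kernel_def)

lemma mem_image_iff:
  assumes X: "right_ideal S X" and \<pi>: "hom_onto S (ideal_module S X) Q \<pi>"
    and A: "right_ideal S A" "A \<subseteq> X" and B: "right_ideal S B" "B \<subseteq> A" "hom_kernel (ideal_module S X) Q \<pi> \<subseteq> B"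
    and a: "a \<in> A"
  shows "\<pi> a \<in> \<pi> ` B \<longleftrightarrow> a \<in> B"
proof
  assume "\<pi> a \<in> \<pi> ` B"
  then obtain b where ab: "a \<in> A" "\<pi> a = \<pi> b" "b \<in> B" using a by auto
  then have c: "a \<in> carrier (ideal_module S X)" "b \<in> carrier (ideal_module S X)" using A B by auto
  \<comment> \<open>Subtraction in a restricted record is determined by inverses in the smaller
    carrier, so its agreement with subtraction in the ring has to be established.\<close>
  have "a \<ominus>\<^bsub>ideal_module S X\<^esub> b = a \<ominus>\<^bsub>S\<^esub> b"
  proof -
    interpret IX: rmod S "ideal_module S X" by (rule ideal_module_rmod[OF X])
    have bc: "b \<in> carrier S" "a \<in> carrier S" using c X unfolding right_ideal_def by auto
    have "\<ominus>\<^bsub>S\<^esub> b \<in> X" using right_ideal_minus[OF X] c by auto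
    moreover have "\<ominus>\<^bsub>S\<^esub> b \<oplus>\<^bsub>ideal_module S X\<^esub> b = \<zero>\<^bsub>ideal_module S X\<^esub>" using bc by (simp add: l_neg)
    ultimately have "\<ominus>\<^bsub>ideal_module S X\<^esub> b = \<ominus>\<^bsub>S\<^esub> b" using c by (intro IX.M.minus_equality) auto
    then show ?thesis by (simp add: IX.M.minus_eq minus_eq)
  qed
  moreover have "a \<ominus>\<^bsub>S\<^esub> b \<in> X" using right_ideal_diff[OF X] c by auto
  ultimately have "a \<ominus>\<^bsub>S\<^esub> b \<in> hom_kernel (ideal_module S X) Q \<pi>"
    using ab hom_onto_eq_iff[OF \<pi> c] unfolding hom_kernel_def by auto
  then have "a \<ominus>\<^bsub>S\<^esub> b \<in> B" using B by auto
  then have "a \<ominus>\<^bsub>S\<^esub> b \<oplus>\<^bsub>S\<^esub> b \<in> B" using ab B unfolding right_ideal_def by blast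
  moreover have "a \<ominus>\<^bsub>S\<^esub> b \<oplus>\<^bsub>S\<^esub> b = a"
  proof -
    have "a \<in> carrier S" "b \<in> carrier S" using c X unfolding right_ideal_def by auto
    then show ?thesis by (simp add: minus_eq a_assoc l_neg)
  qed
  ultimately show "a \<in> B" by simp
qed auto

lemma image_strict:
  assumes X: "right_ideal S X" and \<pi>: "hom_onto S (ideal_module S X) Q \<pi>"
    and A: "right_ideal S A" "A \<subseteq> X" and B: "right_ideal S B" "B \<subset> A" "hom_kernel (ideal_module S X) Q \<pi> \<subseteq> B"
  shows "\<pi> ` B \<subset> \<pi> ` A"
proof -
  obtain a where a: "a \<in> A" "a \<notin> B" using psubset_imp_ex_mem[OF B(2)] by auto
  then have "\<pi> a \<notin> \<pi> ` B" using mem_image_iff[OF X \<pi> A B(1) psubset_imp_subset[OF B(2)] B(3) a(1)] by simp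
  then show ?thesis using a(1) image_mono[OF psubset_imp_subset[OF B(2)], of \<pi>] by auto
qed

lemma image_quotient:
  assumes X: "right_ideal S X" and \<pi>: "hom_onto S (ideal_module S X) Q \<pi>"
    and A: "right_ideal S A" "A \<subseteq> X" and B: "right_ideal S B" "B \<subseteq> A" "hom_kernel (ideal_module S X) Q \<pi> \<subseteq> B"
  obtains h where "hom_onto S (ideal_module S A) (quotient_module (Q\<lparr>carrier := \<pi> ` A\<rparr>) (\<pi> ` B)) h"
    "hom_kernel (ideal_module S A) (quotient_module (Q\<lparr>carrier := \<pi> ` A\<rparr>) (\<pi> ` B)) h = B"
proof -
  note r = restrict_hom[OF X \<pi> A]
  let ?Q = "Q\<lparr>carrier := \<pi> ` A\<rparr>"
  have sub: "is_submodule S ?Q (\<pi> ` B)"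
    using hom_onto_submodule_image[OF r(1)] submodule_ideal_module_iff[OF A(1)] B by auto
  note q = quotient_module_hom_onto[OF hom_onto_rmod[OF r(1)] sub]
  have "hom_kernel (ideal_module S A) (quotient_module ?Q (\<pi> ` B)) ((\<lambda>x. \<pi> ` B +>\<^bsub>?Q\<^esub> x) \<circ> \<pi>) = {a \<in> A. \<pi> a \<in> \<pi> ` B}"
    using q(2) unfolding hom_kernel_def by auto
  also have "\<dots> = B" using mem_image_iff[OF X \<pi> A B] B(2) by auto
  finally show thesis using that[OF hom_onto_comp[OF r(1) q(1)]] by blast
qed

text \<open>The sequence \<open>0 \<rightarrow> Y/Z \<rightarrow> X/Z \<rightarrow> X/Y
  \<rightarrow> 0\<close>, realized by copies in the type that \<open>GK_exact\<close> speaks of.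
  Both maps come from factoring the quotient maps.\<close>

lemma gk_exactness:
  assumes X: "right_ideal S X" and Y: "right_ideal S Y" and Z: "right_ideal S Z" and sub: "Z \<subseteq> Y" "Y \<subseteq> X"
  shows "gk X Z = max (gk Y Z) (gk X Y)"
proof -
  obtain P1 :: "('s, 's fg_elem) module" and p1 where
    P1: "hom_onto S (ideal_module S Y) P1 p1" "hom_kernel (ideal_module S Y) P1 p1 = Z"
    using quotient_copy[OF Y Z sub(1)] .
  obtain P2 :: "('s, 's fg_elem) module" and p2 where
    P2: "hom_onto S (ideal_module S X) P2 p2" "hom_kernel (ideal_module S X) P2 p2 = Z"
    using quotient_copy[OF X Z order_trans[OF sub]] .
  obtain P3 :: "('s, 's fg_elem) module" and p3 where
    P3: "hom_onto S (ideal_module S X) P3 p3" "hom_kernel (ideal_module S X) P3 p3 = Y"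
    using quotient_copy[OF X Y sub(2)] .
  note r = restrict_hom[OF X P2(1) Y sub(2)]
  have "hom_kernel (ideal_module S Y) P1 p1 = hom_kernel (ideal_module S Y) (P2\<lparr>carrier := p2 ` Y\<rparr>) p2"
    using r(2) P1(2) P2(2) sub by auto
  then obtain \<phi> where \<phi>: "hom_onto S P1 (P2\<lparr>carrier := p2 ` Y\<rparr>) \<phi>" "inj_on \<phi> (carrier P1)"
    using hom_onto_factor_iso[OF P1(1) r(1)] by blast
  obtain \<gamma> where \<gamma>: "hom_onto S P2 P3 \<gamma>" "\<And>x. x \<in> carrier (ideal_module S X) \<Longrightarrow> \<gamma> (p2 x) = p3 x"
    using hom_onto_factor[OF P2(1) P3(1)] P2(2) P3(2) sub by auto
  have c2: "p2 ` X = carrier P2" using P2(1) unfolding hom_onto_def by auto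
  have im: "\<phi> ` carrier P1 = p2 ` Y" using \<phi>(1) unfolding hom_onto_def by auto
  have ex: "\<phi> ` carrier P1 = {x \<in> carrier P2. \<gamma> x = \<zero>\<^bsub>P3\<^esub>}"
    using P3(2) \<gamma>(2) sub unfolding im c2[symmetric] hom_kernel_def by auto
  have "\<phi> ` carrier P1 \<subseteq> carrier P2" unfolding im c2[symmetric] using sub by auto
  then have "\<And>x. x \<in> carrier P1 \<Longrightarrow> \<phi> x \<in> carrier P2" by auto
  then have h1: "\<phi> \<in> module_hom S P1 P2"
    using \<phi>(1) unfolding module_hom_def hom_onto_def by auto
  have h2: "\<gamma> \<in> module_hom S P2 P3" "\<gamma> ` carrier P2 = carrier P3"
    using \<gamma>(1) unfolding module_hom_def hom_onto_def by auto
  note fg = fg_quotient[OF Y P1(1)] fg_quotient[OF X P2(1)] fg_quotient[OF X P3(1)]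
  have "GKdim L S P2 = max (GKdim L S P1) (GKdim L S P3)"
    by (rule exact[unfolded GK_exact_def, rule_format, of P1 P2 P3 \<phi> \<gamma>]) (intro conjI fg h1 h2 \<phi>(2) ex)
  then have "ereal (of_int (gk X Z)) = max (ereal (of_int (gk Y Z))) (ereal (of_int (gk X Y)))"
    using gk_copy[OF Y P1(1)] gk_copy[OF X P2(1)] gk_copy[OF X P3(1)] P1(2) P2(2) P3(2) by simp
  then show ?thesis by (auto simp: max_def split: if_splits)
qed

sublocale lat: dimension_lattice ideals "\<lambda>X Y. X <+>\<^bsub>S\<^esub> Y" gk
proof
  fix A B C N X Y :: "'s set"
  show "A \<in> ideals \<Longrightarrow> B \<in> ideals \<Longrightarrow> A \<inter> B \<in> ideals" using right_ideal_Int by auto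
  show "A \<in> ideals \<Longrightarrow> B \<in> ideals \<Longrightarrow> A <+>\<^bsub>S\<^esub> B \<in> ideals" using right_ideal_sum by auto
  show "A \<in> ideals \<Longrightarrow> B \<in> ideals \<Longrightarrow> A \<subseteq> A <+>\<^bsub>S\<^esub> B" using right_ideal_sum_upper(1) by simp
  show "A \<in> ideals \<Longrightarrow> B \<in> ideals \<Longrightarrow> B \<subseteq> A <+>\<^bsub>S\<^esub> B" using right_ideal_sum_upper(2) by simp
  show "A \<in> ideals \<Longrightarrow> B \<in> ideals \<Longrightarrow> C \<in> ideals \<Longrightarrow> A \<subseteq> C \<Longrightarrow> B \<subseteq> C \<Longrightarrow> A <+>\<^bsub>S\<^esub> B \<subseteq> C"
    using right_ideal_sum_least by simp
  show "A \<in> ideals \<Longrightarrow> B \<in> ideals \<Longrightarrow> N \<in> ideals \<Longrightarrow> B \<subseteq> A \<Longrightarrow> A \<inter> (B <+>\<^bsub>S\<^esub> N) \<subseteq> B <+>\<^bsub>S\<^esub> (A \<inter> N)"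
    using right_ideal_modular by simp
  show "A \<in> ideals \<Longrightarrow> B \<in> ideals \<Longrightarrow> C \<in> ideals \<Longrightarrow> C \<subseteq> B \<Longrightarrow> B \<subseteq> A \<Longrightarrow> gk A C = max (gk B C) (gk A B)"
    by (rule gk_exactness; simp)
  show "gk A A = -1" if "A \<in> ideals"
  proof -
    have A: "right_ideal S A" using that by simp
    obtain Q :: "('s, 's fg_elem) module" and \<pi> where
      Q: "hom_onto S (ideal_module S A) Q \<pi>" "hom_kernel (ideal_module S A) Q \<pi> = A"
      using quotient_copy[OF A A order_refl] .
    have ne: "A \<noteq> {}" using that unfolding right_ideal_def by auto
    have "\<pi> ` A = carrier Q" using Q(1) unfolding hom_onto_def by auto
    moreover have "\<pi> ` A = {\<zero>\<^bsub>Q\<^esub>}" using Q(2) ne unfolding hom_kernel_def by force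
    ultimately have "GKdim L S Q = - 1" using GKdim_zero by metis
    then have "ereal (of_int (gk A A)) = ereal (-1)" using gk_copy[of A Q \<pi>] Q that by (simp add: one_ereal_def)
    then have "of_int (gk A A) = (of_int (-1) :: real)" by simp
    then show ?thesis unfolding of_int_eq_iff .
  qed
  show "0 \<le> gk A B" if "A \<in> ideals" "B \<in> ideals" "B \<subset> A"
  proof -
    have AB: "right_ideal S A" "right_ideal S B" "B \<subseteq> A" using that by auto
    obtain Q :: "('s, 's fg_elem) module" and \<pi> where
      Q: "hom_onto S (ideal_module S A) Q \<pi>" "hom_kernel (ideal_module S A) Q \<pi> = B"
      using quotient_copy[OF AB] .
    obtain a where "a \<in> A" "a \<notin> B" using psubset_imp_ex_mem[OF \<open>B \<subset> A\<close>] by auto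
    then have "\<pi> a \<in> carrier Q" "\<pi> a \<noteq> \<zero>\<^bsub>Q\<^esub>" using Q unfolding hom_kernel_def hom_onto_def by auto
    then have "0 \<le> GKdim L S Q" using GKdim_nonneg[OF alg hom_onto_rmod[OF Q(1)]] by auto
    then show ?thesis using gk_copy[of A Q \<pi>] Q that by simp
  qed
  \<comment> \<open>Second isomorphism theorem: \<open>A\<close> maps onto \<open>(A + B)/B\<close>
    with kernel \<open>A \<inter> B\<close>.\<close>
  show "gk (A <+>\<^bsub>S\<^esub> B) B = gk A (A \<inter> B)" if AB: "A \<in> ideals" "B \<in> ideals"
  proof -
    have B: "right_ideal S B" using AB by simp
    have s: "right_ideal S (A <+>\<^bsub>S\<^esub> B)" "A \<subseteq> A <+>\<^bsub>S\<^esub> B" "B \<subseteq> A <+>\<^bsub>S\<^esub> B"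
      using AB right_ideal_sum right_ideal_sum_upper by auto
    obtain Q :: "('s, 's fg_elem) module" and \<pi> where
      Q: "hom_onto S (ideal_module S (A <+>\<^bsub>S\<^esub> B)) Q \<pi>" "hom_kernel (ideal_module S (A <+>\<^bsub>S\<^esub> B)) Q \<pi> = B"
      using quotient_copy[OF s(1) B s(3)] .
    interpret Q: rmod S Q using hom_onto_rmod[OF Q(1)] .
    note r = restrict_hom[OF s(1) Q(1) _ s(2)]
    have im: "\<pi> ` (A <+>\<^bsub>S\<^esub> B) = carrier Q" using Q(1) unfolding hom_onto_def by auto
    have "carrier Q \<subseteq> \<pi> ` A"
    proof
      fix q assume "q \<in> carrier Q"
      then obtain a b where ab: "q = \<pi> (a \<oplus>\<^bsub>S\<^esub> b)" "a \<in> A" "b \<in> B" unfolding im[symmetric] set_add_def' by auto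
      have "a \<in> A <+>\<^bsub>S\<^esub> B" "b \<in> A <+>\<^bsub>S\<^esub> B" using ab s by auto
      then have "q = \<pi> a \<oplus>\<^bsub>Q\<^esub> \<pi> b" "\<pi> a \<in> carrier Q" using ab(1) Q(1) unfolding hom_onto_def by auto
      moreover have "\<pi> b = \<zero>\<^bsub>Q\<^esub>" using ab Q(2) unfolding hom_kernel_def by auto
      ultimately show "q \<in> \<pi> ` A" using ab by auto
    qed
    then have "\<pi> ` A = carrier Q" using im image_mono[OF s(2), of \<pi>] by simp
    then have "Q\<lparr>carrier := \<pi> ` A\<rparr> = Q" by simp
    then have "hom_onto S (ideal_module S A) Q \<pi>" "hom_kernel (ideal_module S A) Q \<pi> = A \<inter> B"
      using r AB Q(2) by auto
    then have "ereal (of_int (gk A (A \<inter> B))) = ereal (of_int (gk (A <+>\<^bsub>S\<^esub> B) B))"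
      using gk_copy[of A Q \<pi>] gk_copy[OF s(1) Q(1)] Q(2) AB by simp
    then show ?thesis by simp
  qed
  show "\<exists>M\<in>F. \<forall>I\<in>F. M \<subseteq> I \<longrightarrow> I = M" if "F \<subseteq> ideals" "F \<noteq> {}" for F
    using noetherian_maximal[OF noeth that(2)] that(1) by (metis mem_Collect_eq subsetD)
  show "\<exists>b. \<forall>n C. C 0 = X \<and> (\<forall>i\<le>n. C i \<in> ideals \<and> Y \<subseteq> C i) \<and>
        (\<forall>i<n. C (Suc i) \<subset> C i \<and> gk (C i) (C (Suc i)) = gk X Y) \<longrightarrow> n \<le> b"
    if XY: "X \<in> ideals" "Y \<in> ideals" "Y \<subseteq> X"
  proof -
    have X: "right_ideal S X" and Y: "right_ideal S Y" using XY by auto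
    obtain Q :: "('s, 's fg_elem) module" and \<pi> where
      Q: "hom_onto S (ideal_module S X) Q \<pi>" "hom_kernel (ideal_module S X) Q \<pi> = Y"
      using quotient_copy[OF X Y XY(3)] .
    obtain b where b: "\<forall>n C. C 0 = carrier Q \<and> (\<forall>i\<le>n. is_submodule S Q (C i)) \<and>
        (\<forall>i<n. C (Suc i) \<subset> C i \<and> GKdim L S (quotient_module (Q\<lparr>carrier := C i\<rparr>) (C (Suc i))) = GKdim L S Q) \<longrightarrow> n \<le> b"
      using partitive[unfolded GK_finitely_partitive_def, rule_format, OF fg_quotient[OF X Q(1)]] by (elim exE)
    have "n \<le> b" if C: "C 0 = X" "\<forall>i\<le>n. C i \<in> ideals \<and> Y \<subseteq> C i"
      "\<forall>i<n. C (Suc i) \<subset> C i \<and> gk (C i) (C (Suc i)) = gk X Y" for n C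
    \<comment> \<open>A chain of right ideals above \<open>Y\<close> is pushed to submodules of the
      copy \<open>Q\<close> of \<open>X/Y\<close>; since the ideals contain the kernel, strictness
      and the dimensions of factors are preserved.\<close>
    proof (rule mp[OF spec[OF spec[OF b, of n], of "\<lambda>i. \<pi> ` C i"]], intro conjI)
      have CX: "C i \<subseteq> X" if "i \<le> n" for i
        using that
      proof (induction i)
        case (Suc i) then show ?case using C(3) by (metis Suc_le_lessD Suc_leD order_trans psubset_imp_subset)
      qed (use C in auto)
      show "\<pi> ` C 0 = carrier Q" using Q(1) C unfolding hom_onto_def by auto
      show "\<forall>i\<le>n. is_submodule S Q (\<pi> ` C i)"
        using hom_onto_submodule_image[OF Q(1)] submodule_ideal_module_iff[OF X] C CX by auto
      show "\<forall>i<n. \<pi> ` C (Suc i) \<subset> \<pi> ` C i \<and>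
         GKdim L S (quotient_module (Q\<lparr>carrier := \<pi> ` C i\<rparr>) (\<pi> ` C (Suc i))) = GKdim L S Q"
      proof (intro allI impI)
        fix i assume i: "i < n"
        have A: "right_ideal S (C i)" "C i \<subseteq> X" and B: "right_ideal S (C (Suc i))" "C (Suc i) \<subset> C i" "Y \<subseteq> C (Suc i)"
          using i C CX[of i] by auto
        obtain h where h: "hom_onto S (ideal_module S (C i)) (quotient_module (Q\<lparr>carrier := \<pi> ` C i\<rparr>) (\<pi> ` C (Suc i))) h"
          "hom_kernel (ideal_module S (C i)) (quotient_module (Q\<lparr>carrier := \<pi> ` C i\<rparr>) (\<pi> ` C (Suc i))) h = C (Suc i)"
          using image_quotient[OF X Q(1) A B(1)] B Q(2) by auto
        have gd: "GKdim L S (quotient_module (Q\<lparr>carrier := \<pi> ` C i\<rparr>) (\<pi> ` C (Suc i))) = ereal (of_int (gk (C i) (C (Suc i))))"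
          using gk_copy[OF A(1) h(1)] h(2) by simp
        have e: "GKdim L S (quotient_module (Q\<lparr>carrier := \<pi> ` C i\<rparr>) (\<pi> ` C (Suc i))) = GKdim L S Q"
          unfolding gd using gk_copy[OF X Q(1)] Q(2) C(3) i by simp
        show "\<pi> ` C (Suc i) \<subset> \<pi> ` C i \<and>
         GKdim L S (quotient_module (Q\<lparr>carrier := \<pi> ` C i\<rparr>) (\<pi> ` C (Suc i))) = GKdim L S Q"
          using e image_strict[OF X Q(1) A B(1,2)] B(3) Q(2) by auto
      qed
    qed
    then show ?thesis by blast
  qed
qed

text \<open>Unrolls the inductive series into an indexed one. The final conjunct records the top
  dimension, which the next inductive step compares with the dimension of its new factor.\<close>

lemma critical_series_chain:
  assumes "lat.critical_series I X d n"
  shows "\<exists>C dd. C 0 = I \<and> C n = X \<and> (\<forall>i\<le>n. right_ideal S (C i) \<and> I \<subseteq> C i \<and> C i \<subseteq> X) \<and>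
    (\<forall>i\<in>{1..n}. C (i - 1) \<subset> C i \<and> gk (C i) (C (i - 1)) = dd i \<and>
      (\<forall>Q. right_ideal S Q \<and> C (i - 1) \<subset> Q \<and> Q \<subseteq> C i \<longrightarrow> gk (C i) Q < dd i)) \<and>
    (\<forall>i. 1 \<le> i \<and> i < n \<longrightarrow> dd i \<le> dd (i + 1)) \<and> (1 \<le> n \<longrightarrow> dd n = d)"
  using assms
proof (induction rule: lat.critical_series.induct)
  case refl then show ?case by (intro exI[of _ "\<lambda>_. I"] exI[of _ "\<lambda>_. 0"]) auto
next
  case (step N d' n X d)
  then obtain C dd where C: "C 0 = I" "C n = N" "\<forall>i\<le>n. right_ideal S (C i) \<and> I \<subseteq> C i \<and> C i \<subseteq> N"
    "\<forall>i\<in>{1..n}. C (i - 1) \<subset> C i \<and> gk (C i) (C (i - 1)) = dd i \<and>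
      (\<forall>Q. right_ideal S Q \<and> C (i - 1) \<subset> Q \<and> Q \<subseteq> C i \<longrightarrow> gk (C i) Q < dd i)"
    "\<forall>i. 1 \<le> i \<and> i < n \<longrightarrow> dd i \<le> dd (i + 1)" "1 \<le> n \<longrightarrow> dd n = d'" by blast
  let ?C = "C(Suc n := X)" and ?d = "dd(Suc n := d)"
  have "?C 0 = I" "?C (Suc n) = X" using C by auto
  moreover have "\<forall>i\<le>Suc n. right_ideal S (?C i) \<and> I \<subseteq> ?C i \<and> ?C i \<subseteq> X"
  proof (intro allI impI)
    fix i assume "i \<le> Suc n"
    then show "right_ideal S (?C i) \<and> I \<subseteq> ?C i \<and> ?C i \<subseteq> X"
      using C(3)[rule_format, of i] C(3)[rule_format, of n] C(2) step by (cases "i = Suc n") auto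
  qed
  moreover have "\<forall>i\<in>{1..Suc n}. ?C (i - 1) \<subset> ?C i \<and> gk (?C i) (?C (i - 1)) = ?d i \<and>
      (\<forall>Q. right_ideal S Q \<and> ?C (i - 1) \<subset> Q \<and> Q \<subseteq> ?C i \<longrightarrow> gk (?C i) Q < ?d i)"
  proof
    fix i assume i: "i \<in> {1..Suc n}"
    show "?C (i - 1) \<subset> ?C i \<and> gk (?C i) (?C (i - 1)) = ?d i \<and>
      (\<forall>Q. right_ideal S Q \<and> ?C (i - 1) \<subset> Q \<and> Q \<subseteq> ?C i \<longrightarrow> gk (?C i) Q < ?d i)"
    proof (cases "i = Suc n")
      case True then show ?thesis using C(2) step by auto
    next
      case False
      then have "i \<in> {1..n}" "i - 1 \<noteq> Suc n" using i by auto
      then show ?thesis using C(4) False by simp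
    qed
  qed
  moreover have "\<forall>i. 1 \<le> i \<and> i < Suc n \<longrightarrow> ?d i \<le> ?d (i + 1)"
  proof (intro allI impI)
    fix i assume i: "1 \<le> i \<and> i < Suc n"
    show "?d i \<le> ?d (i + 1)"
      using C(5)[rule_format, of i] C(6) i step by (cases "i = n") auto
  qed
  ultimately show ?case by (intro exI[of _ ?C] exI[of _ ?d]) simp
qed

lemma critical_composition_series_of_quotient:
  assumes \<psi>: "hom_onto S (regular_module S) Q \<psi>"
    and cs: "lat.critical_series (hom_kernel (regular_module S) Q \<psi>) (carrier S) d n"
  shows "\<exists>C. critical_composition_series L S Q C n"
proof -
  let ?I = "hom_kernel (regular_module S) Q \<psi>"
  have top: "right_ideal S (carrier S)" by (rule right_ideal_carrier)
  have \<psi>': "hom_onto S (ideal_module S (carrier S)) Q \<psi>" "hom_kernel (ideal_module S (carrier S)) Q \<psi> = ?I"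
    using \<psi> by (simp_all add: ideal_module_carrier)
  obtain C dd where C: "C 0 = ?I" "C n = carrier S" "\<forall>i\<le>n. right_ideal S (C i) \<and> ?I \<subseteq> C i \<and> C i \<subseteq> carrier S"
    "\<forall>i\<in>{1..n}. C (i - 1) \<subset> C i \<and> gk (C i) (C (i - 1)) = dd i \<and>
      (\<forall>Q. right_ideal S Q \<and> C (i - 1) \<subset> Q \<and> Q \<subseteq> C i \<longrightarrow> gk (C i) Q < dd i)"
    "\<forall>i. 1 \<le> i \<and> i < n \<longrightarrow> dd i \<le> dd (i + 1)"
    using critical_series_chain[OF cs] by blast
  interpret Q: rmod S Q using hom_onto_rmod[OF \<psi>] .
  have z: "\<zero>\<^bsub>S\<^esub> \<in> ?I" "\<psi> \<zero>\<^bsub>S\<^esub> = \<zero>\<^bsub>Q\<^esub>" using \<psi> unfolding hom_onto_def hom_kernel_def by (auto simp: regular_module_def)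
  have "critical_composition_series L S Q (\<lambda>i. \<psi> ` C i) n"
    unfolding critical_composition_series_def
  proof (intro conjI exI[of _ "\<lambda>i. ereal (of_int (dd i))"] ballI allI impI)
    have "\<psi> ` ?I \<subseteq> {\<zero>\<^bsub>Q\<^esub>}" unfolding hom_kernel_def by auto
    moreover have "\<zero>\<^bsub>Q\<^esub> \<in> \<psi> ` ?I" using imageI[OF z(1), of \<psi>] z(2) by simp
    ultimately show "\<psi> ` C 0 = {\<zero>\<^bsub>Q\<^esub>}" using C(1) by auto
    show "\<psi> ` C n = carrier Q" using C(2) \<psi>' unfolding hom_onto_def by auto
    show "is_submodule S Q (\<psi> ` C i)" if "i \<le> n" for i
      using hom_onto_submodule_image[OF \<psi>'(1)] submodule_ideal_module_iff[OF top] C(3) that by auto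
    show "ereal (real_of_int (dd i)) \<le> ereal (real_of_int (dd (i + 1)))" if "1 \<le> i \<and> i < n" for i
      using C(5) that by simp
  next
    fix i assume i: "i \<in> {1..n}"
    let ?A = "C i" and ?B = "C (i - 1)"
    have A: "right_ideal S ?A" "?A \<subseteq> carrier S" using C(3)[rule_format, of i] i by auto
    have B: "right_ideal S ?B" "?B \<subset> ?A" "?I \<subseteq> ?B"
    proof -
      have "i - 1 \<le> n" using i by auto
      then show "right_ideal S ?B" "?I \<subseteq> ?B" using C(3) by blast+
      show "?B \<subset> ?A" using C(4) i by blast
    qed
    let ?P = "quotient_module (Q\<lparr>carrier := \<psi> ` ?A\<rparr>) (\<psi> ` ?B)"
    obtain h where h: "hom_onto S (ideal_module S ?A) ?P h" "hom_kernel (ideal_module S ?A) ?P h = ?B"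
      using image_quotient[OF top \<psi>'(1) A B(1)] B \<psi>'(2) by auto
    have hd: "GKdim L S ?P = ereal (of_int (dd i))"
      using gk_copy[OF A(1) h(1)] h(2) C(4) i by simp
    obtain a where a: "a \<in> ?A" "a \<notin> ?B" using B by auto
    have hP: "h ` ?A = carrier ?P" using h(1) unfolding hom_onto_def by simp
    have nz: "carrier ?P \<noteq> {\<zero>\<^bsub>?P\<^esub>}"

    proof -
      have "h a \<in> carrier ?P" unfolding hP[symmetric] using a by auto
      moreover have "h a \<noteq> \<zero>\<^bsub>?P\<^esub>" using h(2) a unfolding hom_kernel_def by auto
      ultimately show ?thesis by auto
    qed
    show "GK_critical L S (ereal (of_int (dd i))) ?P"
      unfolding GK_critical_def
    proof (intro conjI allI impI)
      fix N assume N: "is_submodule S ?P N \<and> N \<noteq> {\<zero>\<^bsub>?P\<^esub>}"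
      interpret P: rmod S ?P using hom_onto_rmod[OF h(1)] .
      note q = quotient_module_hom_onto[OF P.rmod_axioms, of N]
      \<comment> \<open>A nonzero submodule \<open>N\<close> of the factor pulls back to a right
        ideal \<open>T\<close> strictly above \<open>C (i - 1)\<close>, and the quotient by
        \<open>N\<close> is isomorphic to \<open>C i/T\<close>; so criticality in the lattice
        applies.\<close>
      define T where "T = {a \<in> ?A. h a \<in> N}"
      have T: "right_ideal S T" "T \<subseteq> ?A"
        using hom_onto_submodule_preimage[OF h(1), of N] submodule_ideal_module_iff[OF A(1)] N unfolding T_def by auto
      have N': "N \<subseteq> carrier ?P" "\<zero>\<^bsub>?P\<^esub> \<in> N" using N unfolding P.submodule_iff by auto
      have "?B \<subseteq> T"
      proof
        fix x assume "x \<in> ?B"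
        then have "x \<in> hom_kernel (ideal_module S ?A) ?P h" using h(2) by simp
        then show "x \<in> T" using N'(2) unfolding T_def hom_kernel_def by simp
      qed
      moreover obtain y where y: "y \<in> N" "y \<noteq> \<zero>\<^bsub>?P\<^esub>" using N N'(2) by auto
      then have "y \<in> h ` ?A" unfolding hP using N'(1) by auto
      then obtain a where "a \<in> ?A" "y = h a" by (elim imageE)
      then have "a \<in> T" "a \<notin> ?B" using y h(2) unfolding T_def hom_kernel_def by auto
      ultimately have BT: "?B \<subset> T" by auto
      have "hom_kernel (ideal_module S ?A) (quotient_module ?P N) ((\<lambda>x. N +>\<^bsub>?P\<^esub> x) \<circ> h) = T"
        using q(2) N hP unfolding T_def hom_kernel_def by auto
      then have "GKdim L S (quotient_module ?P N) = ereal (of_int (gk ?A T))"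
        using gk_copy[OF A(1) hom_onto_comp[OF h(1) q(1)]] N by simp
      then show "GKdim L S (quotient_module ?P N) < ereal (of_int (dd i))"
        using C(4) i T BT by simp
    qed (use nz hd in auto)
    show "\<psi> ` ?B \<subset> \<psi> ` ?A" using image_strict[OF top \<psi>'(1) A B(1,2)] B(3) \<psi>'(2) by auto
  qed
  then show ?thesis by blast
qed

end

section \<open>Small fields\<close>

lemma fg_field_extension_trans:
  assumes kL: "fg_field_extension k L" and LM: "fg_field_extension L M"
  shows "fg_field_extension k M"
proof -
  have ext: "field_extension k L" "field_extension L M" using assms unfolding fg_field_extension_def by auto
  obtain X where X: "finite X" "X \<subseteq> carrier L" "generate_field L (carrier k \<union> X) = carrier L"
    using kL unfolding fg_field_extension_def by auto
  obtain Y where Y: "finite Y" "Y \<subseteq> carrier M" "generate_field M (carrier L \<union> Y) = carrier M"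
    using LM unfolding fg_field_extension_def by auto
  interpret M: field M using field_extensionD(2)[OF ext(2)] .
  have c: "carrier k \<subseteq> carrier L" "carrier L \<subseteq> carrier M" using field_extensionD(3) ext by auto
  let ?G = "generate_field M (carrier k \<union> (X \<union> Y))"
  have sub: "carrier k \<union> (X \<union> Y) \<subseteq> carrier M" using c X Y by auto
  have "generate_field M (carrier k \<union> X) \<subseteq> ?G" using sub by (intro M.mono_generate_field) auto
  moreover have "generate_field M (carrier k \<union> X) = carrier L"
    using generate_field_extension[OF ext(2), of "carrier k \<union> X"] X c by auto
  moreover have "Y \<subseteq> ?G" using generate_field.incl[of _ "carrier k \<union> (X \<union> Y)" M] by auto
  ultimately have "generate_field M (carrier L \<union> Y) \<subseteq> ?G"
    using M.generate_field_is_subfield[OF sub] c Y by (intro M.generate_field_min_subfield1) auto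
  then have "?G = carrier M" using Y(3) M.generate_field_incl[OF sub] by auto
  then show ?thesis unfolding fg_field_extension_def
    using field_extension_trans[OF ext] X(1,2) Y(1,2) c by (intro conjI exI[of _ "X \<union> Y"]) auto
qed

lemma extensiveD:
  assumes "extensive \<F>"
  shows "\<F> k L \<Longrightarrow> field_extension k L" "\<F> k L \<Longrightarrow> \<F> L K \<Longrightarrow> \<F> k K"
    "\<F> k K \<Longrightarrow> fg_field_extension k L \<Longrightarrow> field_extension L K \<Longrightarrow> fg_field_extension k L' \<Longrightarrow> field_extension L' K \<Longrightarrow>
      \<exists>M. generate_field K (carrier L \<union> carrier L') \<subseteq> carrier M \<and> \<F> k M \<and> \<F> M K \<and> fg_field_extension k M"
  using assms unfolding extensive_def by blast+

lemma fg_field_extension_generated: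
  assumes ext: "field_extension L K" and B: "finite B" "B \<subseteq> carrier K"
  shows "fg_field_extension L (K\<lparr>carrier := generate_field K (carrier L \<union> B)\<rparr>)"
    "field_extension (K\<lparr>carrier := generate_field K (carrier L \<union> B)\<rparr>) K"
proof -
  let ?H = "carrier L \<union> B"
  let ?E = "K\<lparr>carrier := generate_field K ?H\<rparr>"
  have H: "?H \<subseteq> carrier K" using B field_extensionD(3)[OF ext] by auto
  show e: "field_extension ?E K" using field_extension_generate(1)[OF field_extensionD(2)[OF ext] H] .
  have "?H \<subseteq> carrier ?E" using generate_field.incl[of _ ?H K] by auto
  then have "generate_field ?E ?H = carrier ?E" using generate_field_extension[OF e, of ?H] by simp
  then show "fg_field_extension L ?E"
    unfolding fg_field_extension_def
    using field_extension_generate(3)[OF field_extensionD(2)[OF ext] H ext] B generate_field.incl[of _ ?H K]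
    by (intro conjI exI[of _ B]) auto
qed

lemma fg_extension_within:
  assumes F: "extensive \<F>" and LK: "\<F> L K" and B: "finite B" "B \<subseteq> carrier K"
  obtains M where "\<F> L M" "\<F> M K" "fg_field_extension L M" "B \<subseteq> carrier M"
proof -
  have ext: "field_extension L K" using extensiveD(1)[OF F LK] .
  let ?E = "K\<lparr>carrier := generate_field K (carrier L \<union> B)\<rparr>"
  note E = fg_field_extension_generated[OF ext B]
  \<comment> \<open>Axiom (iii) is applied with both subextensions equal to the field generated by
    \<open>B\<close>.\<close>
  obtain M where M: "generate_field K (carrier ?E \<union> carrier ?E) \<subseteq> carrier M" "\<F> L M" "\<F> M K" "fg_field_extension L M"
    using extensiveD(3)[OF F LK E E] by blast
  have "B \<subseteq> carrier ?E" using generate_field.incl[of _ "carrier L \<union> B" K] by auto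
  then have "B \<subseteq> generate_field K (carrier ?E \<union> carrier ?E)"
    using generate_field.incl[of _ "carrier ?E \<union> carrier ?E" K] by auto
  then show thesis using that M by auto
qed

text \<open>A representative is a finite formal sum, so only the finitely many field elements
  occurring in it have to be adjoined.\<close>

lemma base_change_element:
  assumes R: "assoc_algebra k R" and ext: "field_extension k K" and z: "z \<in> carrier (base_change_algebra k R K)"
  obtains B where "finite B" "B \<subseteq> carrier K"
    "\<And>L. field_extension k L \<Longrightarrow> field_extension L K \<Longrightarrow> B \<subseteq> carrier L \<Longrightarrow>
      \<exists>y\<in>carrier (base_change_algebra k R L). base_map k R K y = z"
proof -
  interpret base_change k R K using R ext by unfold_locales
  obtain u where u: "z = cl u" "u \<in> frags R K" using z unfolding S_carrier by auto
  show thesis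
  proof (rule that[of "snd ` Poly_Mapping.keys u"])
    show "snd ` Poly_Mapping.keys u \<subseteq> carrier K" using u(2) unfolding frags_def by auto
    fix L assume L: "field_extension k L" "field_extension L K" "snd ` Poly_Mapping.keys u \<subseteq> carrier L"
    interpret p: base_change_pair k R L K using R L ext by unfold_locales
    have "u \<in> frags R L" using u(2) L(3) unfolding frags_def by force
    then show "\<exists>y\<in>carrier (base_change_algebra k R L). base_map k R K y = z"
      using u(1) p.map_cl unfolding p.src.S_carrier by auto
  qed auto
qed

section \<open>Contraction and extension of right ideals\<close>

lemma (in base_change_pair) preimage_right_ideal:
  assumes "right_ideal tgt.S J" shows "right_ideal src.S {s \<in> carrier src.S. \<beta> s \<in> J}"
  using assms unfolding right_ideal_def by (auto simp: map_simps)

text \<open>The extended right ideal \<open>I S\<^sub>L\<^sub>'\<close>.\<close>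

definition extend_ideal :: "'a ring \<Rightarrow> ('a, 'r) module \<Rightarrow> 'a ring \<Rightarrow> ('r, 'a) tensor set \<Rightarrow> ('r, 'a) tensor set" where
  "extend_ideal k R L' I = ring.right_ideal_gen (base_change_algebra k R L') (base_map k R L' ` I)"

lemma (in base_change_pair) extend_ideal:
  assumes "I \<subseteq> carrier src.S"
  shows "right_ideal tgt.S (extend_ideal k R L' I)" "\<beta> ` I \<subseteq> extend_ideal k R L' I"
    "\<And>J. right_ideal tgt.S J \<Longrightarrow> \<beta> ` I \<subseteq> J \<Longrightarrow> extend_ideal k R L' I \<subseteq> J"
proof -
  have "\<beta> ` I \<subseteq> carrier tgt.S" using assms map_simps(1) by auto
  from tgt.SR.right_ideal_gen[OF this]
  show "right_ideal tgt.S (extend_ideal k R L' I)" "\<beta> ` I \<subseteq> extend_ideal k R L' I"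
    "\<And>J. right_ideal tgt.S J \<Longrightarrow> \<beta> ` I \<subseteq> J \<Longrightarrow> extend_ideal k R L' I \<subseteq> J"
    unfolding extend_ideal_def by auto
qed

lemma (in base_change_pair) extend_ideal_fg:
  assumes I: "right_ideal src.S I" "src.SR.fg_ideal I"
  shows "tgt.SR.fg_ideal (extend_ideal k R L' I)"
proof -
  have c: "I \<subseteq> carrier src.S" using I unfolding right_ideal_def by auto
  note e = extend_ideal[OF c]
  obtain X where X: "finite X" "X \<subseteq> I" "\<forall>J. right_ideal src.S J \<and> X \<subseteq> J \<longrightarrow> I \<subseteq> J"
    using I(2) unfolding src.SR.fg_ideal_def by (elim exE conjE)
  have "extend_ideal k R L' I \<subseteq> J" if J: "right_ideal tgt.S J" "\<beta> ` X \<subseteq> J" for J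
  proof (rule e(3)[OF J(1)])
    have "I \<subseteq> {s \<in> carrier src.S. \<beta> s \<in> J}" using X preimage_right_ideal[OF J(1)] J(2) c by blast
    then show "\<beta> ` I \<subseteq> J" by auto
  qed
  then show ?thesis unfolding tgt.SR.fg_ideal_def using X(1) order_trans[OF image_mono[OF X(2), of \<beta>] e(2)] by (intro exI[of _ "\<beta> ` X"]) auto
qed

section \<open>Noetherianity of the base change\<close>

context
  fixes k :: "'a ring" and R :: "('a, 'r) module" and \<F> :: "'a ring \<Rightarrow> 'a ring \<Rightarrow> bool" and K :: "'a ring" and D :: real
  assumes R: "assoc_algebra k R" and noeth: "right_noetherian R"
    and D: "GKdim_algebra k R \<le> ereal D" "0 \<le> D"
    and F: "extensive \<F>" and kK: "\<F> k K"
    and wb: "GK_well_behaved \<F> k R K" and bounded: "critical_lengths_bounded \<F> k R K"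
begin

private abbreviation (input) "small \<equiv> small_field \<F> k K"
private abbreviation (input) "RL L \<equiv> base_change_algebra k R L"
text \<open>Strictly larger than the bound of \<open>GKdim_cyclic_bound\<close>. It is the same for
  all small fields, so the vectors taken over different fields have one common length.\<close>

private definition b :: nat where "b = nat \<lceil>2 * (D + 1)\<rceil> + 1"

private lemma smallD:
  assumes "small L" shows "\<F> k L" "\<F> L K" "fg_field_extension k L" "field_extension k L" "field_extension L K"
  using assms extensiveD(1)[OF F] unfolding small_field_def by auto

private lemma gk: "small L \<Longrightarrow> gk_algebra L (RL L)"
proof
  assume L: "small L"
  interpret bc: base_change k R L using R smallD(4)[OF L] by unfold_locales
  show "assoc_algebra L (RL L)" by (rule bc.S_algebra)
  show "right_noetherian (RL L)" by (rule base_change_noetherian_fg[OF R noeth smallD(3)[OF L]])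
  show "GK_exact L (RL L)" "GK_finitely_partitive L (RL L)" "GK_integer_valued L (RL L)"
    using wb L unfolding GK_well_behaved_def by auto
qed

private lemma pair: "small L \<Longrightarrow> small L' \<Longrightarrow> \<F> L L' \<Longrightarrow> base_change_pair k R L L'"
  using R smallD extensiveD(1)[OF F] by unfold_locales auto

private lemma pair_K: "small L \<Longrightarrow> base_change_pair k R L K"
  using R smallD extensiveD(1)[OF F kK] by unfold_locales auto

private lemma small_above:
  assumes "small L" "finite B" "B \<subseteq> carrier K"
  obtains L' where "small L'" "\<F> L L'" "B \<subseteq> carrier L'"
proof -
  obtain M where M: "\<F> L M" "\<F> M K" "fg_field_extension L M" "B \<subseteq> carrier M"
    using fg_extension_within[OF F smallD(2)[OF assms(1)] assms(2,3)] .
  have "small M" unfolding small_field_def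
    using M extensiveD(2)[OF F smallD(1)[OF assms(1)] M(1)] fg_field_extension_trans[OF smallD(3)[OF assms(1)] M(3)] by auto
  then show thesis using that M by auto
qed

text \<open>The trivial extension of \<open>k\<close> is not known to belong to the class, so
  \<open>k\<close> itself cannot serve as the starting field.\<close>

private lemma small_exists: obtains L where "small L"
  using fg_extension_within[OF F kK, of "{}"] that unfolding small_field_def by auto

private definition vec :: "'a ring \<Rightarrow> ('r, 'a) tensor set \<Rightarrow> nat list" where
  "vec L I = dimension_lattice.length_vector {I. right_ideal (RL L) I} (gk_algebra.gk L (RL L)) b I"

private lemma gk_less:
  assumes L: "small L" and IJ: "right_ideal (RL L) I" "right_ideal (RL L) J" "I \<subseteq> J"
  shows "gk_algebra.gk L (RL L) J I < int b"
proof -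
  interpret gk_algebra L "RL L" using gk[OF L] .
  interpret bc: base_change k R L using R smallD(4)[OF L] by unfold_locales
  have top: "right_ideal (RL L) (carrier (RL L))" by (rule right_ideal_carrier)
  have J: "J \<subseteq> carrier (RL L)" using IJ unfolding right_ideal_def by auto
  obtain Q :: "(('r, 'a) tensor, ('r, 'a) tensor fg_elem) module" and \<pi> where
    Q: "hom_onto (RL L) (ideal_module (RL L) (carrier (RL L))) Q \<pi>" "hom_kernel (ideal_module (RL L) (carrier (RL L))) Q \<pi> = I"
    using quotient_copy[OF top IJ(1) order_trans[OF IJ(3) J]] .
  have "GKdim L (RL L) Q \<le> ereal (2 * (D + 1))"
    using Q(1) bc.kL by (intro GKdim_cyclic_bound[OF R alg _ bc.coeff_map_hom bc.coeff_map_smult bc.S_span D])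
      (auto simp: ideal_module_carrier)
  then have "of_int (gk (carrier (RL L)) I) \<le> 2 * (D + 1)" using gk_copy[OF top Q(1)] Q(2) by simp
  then have "gk (carrier (RL L)) I < int b" unfolding b_def using D(2) by linarith
  \<comment> \<open>The bound on cyclic modules concerns quotients of the whole ring; exactness
    passes it on to the subquotient \<open>J/I\<close>.\<close>
  moreover have "gk (carrier (RL L)) I = max (gk J I) (gk (carrier (RL L)) J)"
    using gk_exactness[OF top IJ(2,1,3) J] .
  ultimately show ?thesis by simp
qed

private lemma vec_less:
  assumes L: "small L" and IJ: "right_ideal (RL L) I" "right_ideal (RL L) J" "I \<subset> J"
  shows "(vec L J, vec L I) \<in> lex less_than"
proof -
  interpret gk_algebra L "RL L" using gk[OF L] .
  have "right_ideal (RL L) A \<Longrightarrow> A \<subseteq> carrier (RL L)" for A unfolding right_ideal_def by auto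
  then show ?thesis unfolding vec_def
    using IJ gk_less[OF L IJ(1,2)] right_ideal_carrier
    by (intro lat.length_vector_less[of "carrier (RL L)"]) auto
qed

private lemma vec_length: "small L \<Longrightarrow> length (vec L I) = b"
proof -
  assume L: "small L"
  interpret gk_algebra L "RL L" using gk[OF L] .
  show ?thesis unfolding vec_def lat.length_vector_def by simp
qed

private lemma extend_right_ideal:
  assumes "small L" "small L'" "\<F> L L'" "right_ideal (RL L) I"
  shows "right_ideal (RL L') (extend_ideal k R L' I)"
proof -
  interpret base_change_pair k R L L' using pair assms by auto
  show ?thesis using extend_ideal(1) assms(4) unfolding right_ideal_def by auto
qed

text \<open>The values that the vector of \<open>I\<close> can take after base change. Enlarging the
  field only shrinks this set; its lexicographic maximum is the measure of \<open>I\<close>.\<close>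

private definition vecs :: "'a ring \<Rightarrow> ('r, 'a) tensor set \<Rightarrow> nat list set" where
  "vecs L I = {vec L' (extend_ideal k R L' I) | L'. small L' \<and> \<F> L L'}"

text \<open>Hypothesis (ii) for the cyclic module with annihilating ideal replaced by the kernel
  \<open>I\<close>: over each larger small field a critical series of the quotient by the extended
  ideal exists and has length at most \<open>n\<close>. All entries are then at most
  \<open>n\<close>, and finitely many vectors of length \<open>b\<close> remain.\<close>

private lemma vecs_finite:
  assumes L: "small L" and I: "right_ideal (RL L) I"
  shows "finite (vecs L I)"
proof -
  interpret gk_algebra L "RL L" using gk[OF L] .
  have top: "right_ideal (RL L) (carrier (RL L))" by (rule right_ideal_carrier)
  have Ic: "I \<subseteq> carrier (RL L)" using I unfolding right_ideal_def by auto
  obtain M :: "(('r, 'a) tensor, ('r, 'a) tensor fg_elem) module" and \<pi> where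
    M: "hom_onto (RL L) (ideal_module (RL L) (carrier (RL L))) M \<pi>" "hom_kernel (ideal_module (RL L) (carrier (RL L))) M \<pi> = I"
    using quotient_copy[OF top I Ic] .
  have M': "hom_onto (RL L) (regular_module (RL L)) M \<pi>" "hom_kernel (regular_module (RL L)) M \<pi> = I"
    using M by (simp_all add: ideal_module_carrier)
  obtain n where n: "\<And>L' C m. small L' \<Longrightarrow> \<F> L L' \<Longrightarrow>
      critical_composition_series L' (RL L') (base_change_module k R L L' M) C m \<Longrightarrow> m \<le> n"
    using bounded L fg_quotient[OF top M(1)] unfolding critical_lengths_bounded_def by blast
  have "vec L' (extend_ideal k R L' I) \<in> {xs. set xs \<subseteq> {..n} \<and> length xs = b}" if L': "small L'" "\<F> L L'" for L'
  proof -
    interpret p: base_change_pair k R L L' using pair L L' by auto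
    interpret c: cyclic_base_change k R L L' M \<pi> using M'(1) by unfold_locales
    interpret g: gk_algebra L' "RL L'" using gk[OF L'(1)] .
    have E: "right_ideal (RL L') (extend_ideal k R L' I)" using extend_right_ideal L L' I by auto
    have top': "A \<subseteq> carrier (RL L')" if "A \<in> g.ideals" for A using that unfolding right_ideal_def by auto
    have ctop: "carrier (RL L') \<in> g.ideals" using p.tgt.SR.right_ideal_carrier by auto
    have ker: "hom_kernel (regular_module (RL L')) c.B c.\<psi> = extend_ideal k R L' I"
      using c.base_change_module_cyclic(2) M'(2) unfolding extend_ideal_def by simp
    obtain d m where cs: "g.lat.critical_series (extend_ideal k R L' I) (carrier (RL L')) d m"
      using g.lat.critical_series_exists[of "extend_ideal k R L' I" "carrier (RL L')"] E ctop top' by auto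
    obtain C where "critical_composition_series L' (RL L') c.B C m"
      using g.critical_composition_series_of_quotient[OF c.base_change_module_cyclic(1) cs[folded ker]] by blast
    then have "m \<le> n" using n L' by auto
    then have "g.lat.chain_length (extend_ideal k R L' I) (int e) \<le> n" for e
      using g.lat.chain_length_le[OF ctop top' cs, of "int e"] by simp
    then show ?thesis using vec_length[OF L'(1)] unfolding vec_def g.lat.length_vector_def by auto
  qed
  then have "vecs L I \<subseteq> {xs. set xs \<subseteq> {..n} \<and> length xs = b}" unfolding vecs_def by blast
  then show ?thesis using finite_lists_length_eq[of "{..n}" b] finite_subset by blast
qed

private lemma vecs_length: "w \<in> vecs L I \<Longrightarrow> length w = b"
  unfolding vecs_def by (auto simp: vec_length)

private lemma vecs_nonempty: "small L \<Longrightarrow> vecs L I \<noteq> {}"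
proof -
  assume "small L"
  \<comment> \<open>Since \<open>\<F> L L\<close> is not an axiom, some field above \<open>L\<close>
    has to be produced instead of taking \<open>L\<close> itself.\<close>
  then obtain L' where "small L'" "\<F> L L'" using small_above[of L "{}"] by auto
  then have "vec L' (extend_ideal k R L' I) \<in> vecs L I" unfolding vecs_def by auto
  then show ?thesis by auto
qed

private lemma vecs_maximum:
  assumes "small L" "right_ideal (RL L) I"
  shows "\<exists>v\<in>vecs L I. \<forall>w\<in>vecs L I. w = v \<or> (w, v) \<in> lex less_than"
proof (rule finite_lex_maximum[OF vecs_finite[OF assms] vecs_nonempty[OF assms(1)]])
  show "length w = b" if "w \<in> vecs L I" for w using vecs_length[OF that] .
qed blast

text \<open>The induction runs over the maximum of \<open>vecs L I\<close>. Enlarging the extended ideal \<open>I S\<^sub>L\<^sub>'\<close> by one element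
  that is not in \<open>I S\<^sub>K\<close> lowers the vector over every larger small field, hence lowers the maximum.\<close>

private lemma right_ideal_above_fg:
  assumes "small L" "right_ideal (RL L) I" "v \<in> vecs L I" "\<forall>w\<in>vecs L I. w = v \<or> (w, v) \<in> lex less_than"
    "right_ideal (RL K) J" "extend_ideal k R K I \<subseteq> J"
  shows "ring.fg_ideal (RL K) J"
  using assms
proof (induction v arbitrary: L I rule: wf_induct_rule[OF wf_lex[OF wf_less_than]])
  case (1 v L I)
  note L = \<open>small L\<close> and I = \<open>right_ideal (RL L) I\<close> and J = \<open>right_ideal (RL K) J\<close>
  interpret LK: base_change_pair k R L K using pair_K[OF L] .
  interpret gL: gk_algebra L "RL L" using gk[OF L] .
  have Ic: "I \<subseteq> carrier (RL L)" using I unfolding right_ideal_def by auto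
  note EK = LK.extend_ideal[OF Ic]
  show ?case
  proof (cases "J = extend_ideal k R K I")
    case True
    have "LK.src.SR.fg_ideal I" using gL.noeth I LK.src.SR.right_noetherian_iff by blast
    then show ?thesis unfolding True using LK.extend_ideal_fg[OF I] by simp
  next
    case False
    then obtain x where x: "x \<in> J" "x \<notin> extend_ideal k R K I" using 1 by auto
    have xc: "x \<in> carrier (RL K)" using x J unfolding right_ideal_def by auto
    obtain Bs where B: "finite Bs" "Bs \<subseteq> carrier K"
      "\<And>L. field_extension k L \<Longrightarrow> field_extension L K \<Longrightarrow> Bs \<subseteq> carrier L \<Longrightarrow> \<exists>y\<in>carrier (RL L). base_map k R K y = x"
      using base_change_element[OF R extensiveD(1)[OF F kK] xc] by metis
    obtain L' where L': "small L'" "\<F> L L'" "Bs \<subseteq> carrier L'" using small_above[OF L B(1,2)] .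
    obtain y where y: "y \<in> carrier (RL L')" "base_map k R K y = x"
      using B(3) smallD[OF L'(1)] L'(3) by blast
    interpret LL': base_change_pair k R L L' using pair[OF L L'(1,2)] .
    interpret L'K: base_change_pair k R L' K using pair_K[OF L'(1)] .
    define I' where "I' = LL'.tgt.SR.right_ideal_gen (insert y (base_map k R L' ` I))"
    have gc: "insert y (base_map k R L' ` I) \<subseteq> carrier (RL L')" using y(1) Ic LL'.map_simps(1) by auto
    note I' = LL'.tgt.SR.right_ideal_gen[OF gc, folded I'_def]
    have I'c: "I' \<subseteq> carrier (RL L')" using I'(1) unfolding right_ideal_def by auto
    have comp: "base_map k R K (base_map k R L' s) = base_map k R K s" if "s \<in> I" for s
      using base_map_comp[OF pair[OF L L'(1,2)] pair_K[OF L'(1)]] that Ic by auto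
    have sub: "extend_ideal k R K I' \<subseteq> J"
    proof (rule L'K.extend_ideal(3)[OF I'c J])
      have "I' \<subseteq> {s \<in> carrier (RL L'). base_map k R K s \<in> J}"
      proof (rule I'(3)[OF L'K.preimage_right_ideal[OF J]])
        have "base_map k R K (base_map k R L' s) \<in> J" if "s \<in> I" for s
          using comp[OF that] EK(2) \<open>extend_ideal k R K I \<subseteq> J\<close> that by auto
        then show "insert y (base_map k R L' ` I) \<subseteq> {s \<in> carrier (RL L'). base_map k R K s \<in> J}"
          using x(1) y gc by auto
      qed
      then show "base_map k R K ` I' \<subseteq> J" by auto
    qed
    obtain v' where v': "v' \<in> vecs L' I'" "\<forall>w\<in>vecs L' I'. w = v' \<or> (w, v') \<in> lex less_than"
      using vecs_maximum[OF L'(1) I'(1)] by blast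
    \<comment> \<open>The maximum for \<open>I'\<close> is attained over some \<open>L''\<close>.
      The vector of \<open>I\<close> over this same field belongs to \<open>vecs L I\<close>, so it
      is at most \<open>v\<close>, and the two ideals can be compared in one lattice.\<close>
    obtain L'' where L'': "small L''" "\<F> L' L''" "v' = vec L'' (extend_ideal k R L'' I')"
      using v'(1) unfolding vecs_def by auto
    have LL'': "\<F> L L''" using extensiveD(2)[OF F L'(2) L''(2)] .
    interpret a: base_change_pair k R L L'' using pair[OF L L''(1) LL''] .
    interpret c: base_change_pair k R L' L'' using pair[OF L'(1) L''(1,2)] .
    interpret d: base_change_pair k R L'' K using pair_K[OF L''(1)] .
    let ?E = "extend_ideal k R L'' I" and ?E' = "extend_ideal k R L'' I'"
    have "?E \<subseteq> ?E'"
    proof (rule a.extend_ideal(3)[OF Ic c.extend_ideal(1)[OF I'c]])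
      show "base_map k R L'' ` I \<subseteq> ?E'"
      proof clarify
        fix s assume s: "s \<in> I"
        have "base_map k R L'' s = base_map k R L'' (base_map k R L' s)"
          using base_map_comp[OF pair[OF L L'(1,2)] pair[OF L'(1) L''(1,2)]] s Ic by auto
        moreover have "base_map k R L' s \<in> I'" using I'(2) s by auto
        ultimately show "base_map k R L'' s \<in> ?E'" using c.extend_ideal(2)[OF I'c] by auto
      qed
    qed
    moreover have "base_map k R L'' y \<in> ?E'" using I'(2) c.extend_ideal(2)[OF I'c] by auto
    \<comment> \<open>The contraction of \<open>I S\<^sub>K\<close> to \<open>L''\<close> contains
      \<open>?E\<close>; as the image \<open>x\<close> of \<open>y\<close> over \<open>K\<close>
      lies outside \<open>I S\<^sub>K\<close>, the image of \<open>y\<close> over \<open>L''\<close>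
      lies outside \<open>?E\<close>.\<close>
    moreover have "base_map k R L'' y \<notin> ?E"
    proof
      assume yE: "base_map k R L'' y \<in> ?E"
      have "?E \<subseteq> {s \<in> carrier (RL L''). base_map k R K s \<in> extend_ideal k R K I}"
      proof (rule a.extend_ideal(3)[OF Ic d.preimage_right_ideal[OF EK(1)]], clarify)
        fix s assume s: "s \<in> I"
        have "base_map k R K (base_map k R L'' s) = base_map k R K s"
          using base_map_comp[OF pair[OF L L''(1) LL''] pair_K[OF L''(1)]] s Ic by auto
        then show "base_map k R L'' s \<in> carrier (RL L'') \<and> base_map k R K (base_map k R L'' s) \<in> extend_ideal k R K I"
          using EK(2) s Ic a.map_simps(1) by auto
      qed
      then have "base_map k R K (base_map k R L'' y) \<in> extend_ideal k R K I" using yE by auto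
      then show False
        using base_map_comp[OF pair[OF L'(1) L''(1,2)] pair_K[OF L''(1)] y(1)] y(2) x(2) by simp
    qed
    ultimately have lt: "?E \<subset> ?E'" by auto
    have "(v', vec L'' ?E) \<in> lex less_than" unfolding L''(3)
      by (rule vec_less[OF L''(1) a.extend_ideal(1)[OF Ic] c.extend_ideal(1)[OF I'c] lt])
    moreover have vE: "vec L'' ?E \<in> vecs L I" using L''(1) LL'' unfolding vecs_def by blast
    have "vec L'' ?E = v \<or> (vec L'' ?E, v) \<in> lex less_than" by (rule bspec[OF "1.prems"(4) vE])
    ultimately have less: "(v', v) \<in> lex less_than"
      using lexord_trans[of v' "vec L'' ?E" less_than v] by (auto simp: lexord_lex)
    show ?thesis by (rule "1.IH"[OF less L'(1) I'(1) v' J sub])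
  qed
qed

lemma base_change_right_noetherian: "right_noetherian (base_change_algebra k R K)"
proof -
  obtain L where L: "small L" using small_exists .
  interpret LK: base_change_pair k R L K using pair_K[OF L] .
  let ?I = "{\<zero>\<^bsub>RL L\<^esub>}"
  have I: "right_ideal (RL L) ?I" unfolding right_ideal_def by auto
  obtain v where v: "v \<in> vecs L ?I" "\<forall>w\<in>vecs L ?I. w = v \<or> (w, v) \<in> lex less_than"
    using vecs_maximum[OF L I] by blast
  have "LK.tgt.SR.fg_ideal J" if J: "right_ideal (RL K) J" for J
  proof (rule right_ideal_above_fg[OF L I v J])
    show "extend_ideal k R K ?I \<subseteq> J"
      using J by (intro LK.extend_ideal(3)) (auto simp: right_ideal_def LK.map_simps)
  qed
  then show ?thesis using LK.tgt.SR.right_noetherian_iff by blast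
qed

end

theorem theorem4p1:
  fixes k :: "'a ring" and R :: "('a, 'r) module" and \<F> :: "'a ring \<Rightarrow> 'a ring \<Rightarrow> bool"
  assumes "field k"
    and "assoc_algebra k R"
    and "right_noetherian R"
    and "GKdim_algebra k R < \<infinity>"
    and "extensive \<F>"
  shows "(\<forall>K. \<F> k K \<and> GK_well_behaved \<F> k R K \<and> critical_lengths_bounded \<F> k R K \<longrightarrow>
            right_noetherian (base_change_algebra k R K)) \<and>
         ((\<forall>K. \<F> k K \<longrightarrow> GK_well_behaved \<F> k R K \<and> critical_lengths_bounded \<F> k R K) \<longrightarrow>
            stably_right_noetherian \<F> k R)"
proof -
  \<comment> \<open>Only an upper bound matters, and replacing the dimension by its maximum with 0
    also covers the formal value \<open>-\<infinity>\<close>.\<close>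
  obtain D where D: "GKdim_algebra k R \<le> ereal D" "0 \<le> D"
  proof (cases "GKdim_algebra k R")
    case (real r)
    then show thesis using that[of "max r 0"] by simp
  qed (use assms(4) that[of 0] in auto)
  have "right_noetherian (base_change_algebra k R K)"
    if "\<F> k K" "GK_well_behaved \<F> k R K" "critical_lengths_bounded \<F> k R K" for K
    using base_change_right_noetherian[OF assms(2,3) D assms(5) that] .
  then show ?thesis unfolding stably_right_noetherian_def by blast
qed

end
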